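(* Let $K$ be a totally real number field such that $|\mathcal{U}_K^+/\mathcal{U}_K^2|=2$, with system of representatives $1,\varepsilon$ (so $\varepsilon\in\mathcal{U}_K^+\setminus\mathcal{U}_K^2$). Assume there exists a universal ternary lattice $L$ over $K$. Then: (a) $L\simeq\langle1,\varepsilon\rangle\perp L_u$ where $L_u$ is a unary lattice; (b) if $L$ is free, then $\langle1,1,\varepsilon,\varepsilon\rangle$ is universal; (c) for each indecomposable $\lambda\in\mathcal{O}_K^+$, $\lambda$ or $\varepsilon\lambda$ is a square in $\mathcal{O}_K$; (d) for each indecomposable $\lambda\in\mathcal{O}_K^+$, $\lambda$ or $2\lambda$ is a square in $\mathcal{O}_K$; (e) $2\varepsilon$ is a square in $\mathcal{O}_K$; in particular, $2$ is ramified in $K$; (f) $\sqrt2\notin K$; (g) every element of $2\mathcal{O}_K^+$ is a sum of squares of elements of $\mathcal{O}_K$; (h) for every $\alpha\in\mathcal{O}_K^+$ with $N_{K/\mathbb{Q}}(\alpha)<2^{[K:\mathbb{Q}]}$, $N_{K/\mathbb{Q}}(\alpha)$ is a power of $2$.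
   Context: $\mathcal{O}_K$ is the ring of integers of $K$; $\alpha$ is totally positive if $\sigma(\alpha)>0$ for all embeddings $\sigma:K\hookrightarrow\mathbb{R}$; $\mathcal{O}_K^+$ is the set of totally positive elements of $\mathcal{O}_K$. $\mathcal{U}_K$ is the unit group, $\mathcal{U}_K^+$ the totally positive units, $\mathcal{U}_K^2$ the squares of units. An element of $\mathcal{O}_K^+$ is indecomposable if it is not a sum of two elements of $\mathcal{O}_K^+$. A (quadratic) lattice over $K$ is a finitely generated torsion-free $\mathcal{O}_K$-module $L$ with a map $Q:L\to\mathcal{O}_K$ such that $Q(av)=a^2Q(v)$ for $a\in\mathcal{O}_K$ and $B(u,v)=\frac12(Q(u+v)-Q(u)-Q(v))$ is bilinear; its rank is its rank as a module (ternary = rank 3, unary = rank 1). All lattices are assumed positive definite ($Q(v)\in\mathcal{O}_K^+$ for $v\neq0$) and classical ($B(u,v)\in\mathcal{O}_K$ for all $u,v$). A lattice is free if it is free as an $\mathcal{O}_K$-module; free lattices correspond to quadratic forms. $L$ is universal if for each $\alpha\in\mathcal{O}_K^+$ there is $v\in L$ with $Q(v)=\alpha$. $\langle\alpha_1,\dots,\alpha_n\rangle$ denotes the free lattice $\mathcal{O}_K^n$ with diagonal form $\alpha_1x_1^2+\dots+\alpha_nx_n^2$; $\perp$ denotes orthogonal sum and $\simeq$ isometry. *)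

theory Defs
  imports
    Complex_Main
    "HOL-Computational_Algebra.Polynomial"
    "HOL-Algebra.Coset"
    "HOL-Algebra.Module"
    "HOL-Algebra.Ideal_Product"
begin

section \<open>Totally real number fields\<close>

text \<open>
  A number field is a type of class \<^class>\<open>field_char_0\<close> that is finite-dimensional over the
  rationals; quantifying over the field is quantifying over that type.
\<close>

interpretation rat_space: vector_space "\<lambda>(q::rat) (x::'k::field_char_0). of_rat q * x"
  by unfold_locales (simp_all add: of_rat_add of_rat_mult algebra_simps)

definition number_field :: "'k::field_char_0 itself \<Rightarrow> bool" where
  "number_field _ \<longleftrightarrow> (\<exists>B::'k set. finite B \<and> rat_space.span B = UNIV)"

definition field_degree :: "'k::field_char_0 itself \<Rightarrow> nat" where
  "field_degree _ = rat_space.dim (UNIV :: 'k set)"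

definition field_embedding :: "('a::field \<Rightarrow> 'b::field) \<Rightarrow> bool" where
  "field_embedding \<sigma> \<longleftrightarrow>
     \<sigma> 1 = 1 \<and> (\<forall>x y. \<sigma> (x + y) = \<sigma> x + \<sigma> y) \<and> (\<forall>x y. \<sigma> (x * y) = \<sigma> x * \<sigma> y)"

definition totally_real :: "'k::field_char_0 itself \<Rightarrow> bool" where
  "totally_real _ \<longleftrightarrow> (\<forall>\<sigma>::'k \<Rightarrow> complex. field_embedding \<sigma> \<longrightarrow> range \<sigma> \<subseteq> \<real>)"

definition totally_positive :: "'k::field_char_0 \<Rightarrow> bool" where
  "totally_positive \<alpha> \<longleftrightarrow> (\<forall>\<sigma>::'k \<Rightarrow> real. field_embedding \<sigma> \<longrightarrow> \<sigma> \<alpha> > 0)"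

text \<open>
  The norm to the rationals, as a real number: the product of all conjugates.  Only real embeddings
  occur in the product, so this is the norm only when the field is totally real.
\<close>

definition field_norm :: "'k::field_char_0 \<Rightarrow> real" where
  "field_norm \<alpha> = (\<Prod>\<sigma> | field_embedding (\<sigma> :: 'k \<Rightarrow> real). \<sigma> \<alpha>)"

definition ring_of_integers :: "'k::field_char_0 ring" where
  "ring_of_integers =
     \<lparr>carrier = {x. algebraic_int x}, mult = (*), one = 1, zero = 0, add = (+)\<rparr>"

abbreviation integers :: "'k::field_char_0 set" where
  "integers \<equiv> carrier ring_of_integers"

definition pos_integers :: "'k::field_char_0 set" where
  "pos_integers = {\<alpha> \<in> integers. totally_positive \<alpha>}"

definition pos_units :: "'k::field_char_0 set" where
  "pos_units = {u \<in> Units ring_of_integers. totally_positive u}"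

definition unit_squares :: "'k::field_char_0 set" where
  "unit_squares = {u\<^sup>2 | u. u \<in> Units ring_of_integers}"

definition pos_unit_group :: "'k::field_char_0 monoid" where
  "pos_unit_group = (units_of ring_of_integers)\<lparr>carrier := pos_units\<rparr>"

definition indecomposable :: "'k::field_char_0 \<Rightarrow> bool" where
  "indecomposable \<mu> \<longleftrightarrow>
     \<mu> \<in> pos_integers \<and> \<not> (\<exists>\<alpha>\<in>pos_integers. \<exists>\<beta>\<in>pos_integers. \<mu> = \<alpha> + \<beta>)"

definition integer_square :: "'k::field_char_0 \<Rightarrow> bool" where
  "integer_square \<alpha> \<longleftrightarrow> (\<exists>\<beta>\<in>integers. \<alpha> = \<beta>\<^sup>2)"

definition sum_of_integer_squares :: "'k::field_char_0 \<Rightarrow> bool" where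
  "sum_of_integer_squares \<alpha> \<longleftrightarrow> (\<exists>xs. set xs \<subseteq> integers \<and> \<alpha> = (\<Sum>x\<leftarrow>xs. x\<^sup>2))"

text \<open>
  A rational prime ramifies if the ramification index of some prime ideal \<open>P\<close> above it, i.e. the
  largest \<open>e\<close> such that \<open>P\<close> to the power \<open>e\<close> divides (equivalently, as ideals: contains) the
  ideal it generates, exceeds 1.
\<close>

definition ramified :: "nat \<Rightarrow> 'k::field_char_0 itself \<Rightarrow> bool" where
  "ramified p _ \<longleftrightarrow>
     (\<exists>P. primeideal P (ring_of_integers :: 'k ring) \<and>
          cgenideal ring_of_integers (of_nat p) \<subseteq> ideal_prod ring_of_integers P P)"


section \<open>Quadratic lattices\<close>

record ('k, 'v) quad_module = "('k, 'v) module" +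
  qform :: "'v \<Rightarrow> 'k"

definition bform :: "('k::field_char_0, 'v) quad_module \<Rightarrow> 'v \<Rightarrow> 'v \<Rightarrow> 'k" where
  "bform L u v = (qform L (u \<oplus>\<^bsub>L\<^esub> v) - qform L u - qform L v) / 2"

definition generates :: "('k::field_char_0, 'v) quad_module \<Rightarrow> 'v set \<Rightarrow> bool" where
  "generates L S \<longleftrightarrow> finite S \<and> S \<subseteq> carrier L \<and>
     (\<forall>v\<in>carrier L. \<exists>c\<in>S \<rightarrow> integers. v = (\<Oplus>\<^bsub>L\<^esub>s\<in>S. c s \<odot>\<^bsub>L\<^esub> s))"

definition lin_independent :: "('k::field_char_0, 'v) quad_module \<Rightarrow> 'v set \<Rightarrow> bool" where
  "lin_independent L S \<longleftrightarrow> finite S \<and> S \<subseteq> carrier L \<and>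
     (\<forall>c\<in>S \<rightarrow> integers. (\<Oplus>\<^bsub>L\<^esub>s\<in>S. c s \<odot>\<^bsub>L\<^esub> s) = \<zero>\<^bsub>L\<^esub> \<longrightarrow> (\<forall>s\<in>S. c s = 0))"

text \<open>The lattices considered are positive definite and classical.\<close>

locale quadratic_lattice =
  Module.module ring_of_integers L for L :: "('k::field_char_0, 'v) quad_module" +
  assumes finitely_generated: "\<exists>S. generates L S"
    and torsion_free: "\<lbrakk>a \<in> integers; v \<in> carrier L; a \<odot>\<^bsub>L\<^esub> v = \<zero>\<^bsub>L\<^esub>\<rbrakk> \<Longrightarrow> a = 0 \<or> v = \<zero>\<^bsub>L\<^esub>"
    and qform_closed: "v \<in> carrier L \<Longrightarrow> qform L v \<in> integers"
    and qform_smult: "\<lbrakk>a \<in> integers; v \<in> carrier L\<rbrakk> \<Longrightarrow> qform L (a \<odot>\<^bsub>L\<^esub> v) = a\<^sup>2 * qform L v"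
    and bform_add_left: "\<lbrakk>u \<in> carrier L; u' \<in> carrier L; v \<in> carrier L\<rbrakk> \<Longrightarrow>
          bform L (u \<oplus>\<^bsub>L\<^esub> u') v = bform L u v + bform L u' v"
    and bform_smult_left: "\<lbrakk>a \<in> integers; u \<in> carrier L; v \<in> carrier L\<rbrakk> \<Longrightarrow>
          bform L (a \<odot>\<^bsub>L\<^esub> u) v = a * bform L u v"
    and bform_add_right: "\<lbrakk>u \<in> carrier L; v \<in> carrier L; v' \<in> carrier L\<rbrakk> \<Longrightarrow>
          bform L u (v \<oplus>\<^bsub>L\<^esub> v') = bform L u v + bform L u v'"
    and bform_smult_right: "\<lbrakk>a \<in> integers; u \<in> carrier L; v \<in> carrier L\<rbrakk> \<Longrightarrow>
          bform L u (a \<odot>\<^bsub>L\<^esub> v) = a * bform L u v"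
    and classical_form: "\<lbrakk>u \<in> carrier L; v \<in> carrier L\<rbrakk> \<Longrightarrow> bform L u v \<in> integers"
    and positive_definite: "\<lbrakk>v \<in> carrier L; v \<noteq> \<zero>\<^bsub>L\<^esub>\<rbrakk> \<Longrightarrow> qform L v \<in> pos_integers"

definition has_rank :: "('k::field_char_0, 'v) quad_module \<Rightarrow> nat \<Rightarrow> bool" where
  "has_rank L n \<longleftrightarrow>
     (\<exists>S. lin_independent L S \<and> card S = n) \<and> (\<forall>S. lin_independent L S \<longrightarrow> card S \<le> n)"

text \<open>Bases are finite here, which is no restriction for finitely generated modules.\<close>

definition free_lattice :: "('k::field_char_0, 'v) quad_module \<Rightarrow> bool" where
  "free_lattice L \<longleftrightarrow> (\<exists>B. lin_independent L B \<and> generates L B)"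

definition universal :: "('k::field_char_0, 'v) quad_module \<Rightarrow> bool" where
  "universal L \<longleftrightarrow> (\<forall>\<alpha>\<in>pos_integers. \<exists>v\<in>carrier L. qform L v = \<alpha>)"

text \<open>
  The fields \<open>mult\<close> and \<open>one\<close> of a module record carry no information and are left undefined.
\<close>

definition diag_lattice :: "'k::field_char_0 list \<Rightarrow> ('k, 'k list) quad_module" where
  "diag_lattice as =
     \<lparr>carrier = {x. length x = length as \<and> set x \<subseteq> integers}, mult = undefined, one = undefined,
      zero = replicate (length as) 0, add = map2 (+), smult = (\<lambda>a. map ((*) a)),
      qform = (\<lambda>x. \<Sum>i<length as. as ! i * (x ! i)\<^sup>2)\<rparr>"

definition orth_sum :: "('k::field_char_0, 'v) quad_module \<Rightarrow> ('k, 'w) quad_module \<Rightarrow>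
    ('k, 'v \<times> 'w) quad_module" where
  "orth_sum L M =
     \<lparr>carrier = carrier L \<times> carrier M, mult = undefined, one = undefined,
      zero = (\<zero>\<^bsub>L\<^esub>, \<zero>\<^bsub>M\<^esub>), add = (\<lambda>(u, v) (u', v'). (u \<oplus>\<^bsub>L\<^esub> u', v \<oplus>\<^bsub>M\<^esub> v')),
      smult = (\<lambda>a (u, v). (a \<odot>\<^bsub>L\<^esub> u, a \<odot>\<^bsub>M\<^esub> v)), qform = (\<lambda>(u, v). qform L u + qform M v)\<rparr>"

definition isometric ::
    "('k::field_char_0, 'v) quad_module \<Rightarrow> ('k, 'w) quad_module \<Rightarrow> bool" where
  "isometric L M \<longleftrightarrow> (\<exists>f. bij_betw f (carrier L) (carrier M) \<and>
     (\<forall>u\<in>carrier L. \<forall>v\<in>carrier L. f (u \<oplus>\<^bsub>L\<^esub> v) = f u \<oplus>\<^bsub>M\<^esub> f v) \<and>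
     (\<forall>a\<in>integers. \<forall>v\<in>carrier L. f (a \<odot>\<^bsub>L\<^esub> v) = a \<odot>\<^bsub>M\<^esub> f v) \<and>
     (\<forall>v\<in>carrier L. qform M (f v) = qform L v))"

end

theory Submission
  imports
    "HOL-Algebra.Ring_Divisibility"
    Defs
    "HOL-Computational_Algebra.Field_as_Ring"
    "Jordan_Normal_Form.Char_Poly"
begin

text \<open>
  Totally positive units are indecomposable, so vectors of norms 1 and \<open>\<epsilon>\<close> are orthogonal and split off.
  What remains is a unary lattice, any two of whose values have a square product.  If \<open>\<lambda>\<close> is
  indecomposable, then \<open>\<lambda>\<close> and \<open>\<epsilon> * \<lambda>\<close> are each given by a single term of \<open>\<langle>1, \<epsilon>\<rangle> \<perp> L\<^sub>u\<close>; both cannot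
  come from \<open>L\<^sub>u\<close>, as \<open>\<epsilon> * \<lambda>\<^sup>2\<close> is not a square, so one of them is a square.  The elements 2 and 3
  have so few decompositions that the same comparison applies to them.

  If \<open>N(\<alpha>) < 2\<^sup>d\<close>, where \<open>d\<close> is the degree, then \<open>\<alpha>\<close> is indecomposable because
  \<open>N(\<alpha> + \<beta>)\<^sup>2 \<ge> 4\<^sup>d N(\<alpha> * \<beta>)\<close>, hence a square up to units, and a descent shows that its norm is a power
  of 2.  To stay among totally positive elements the descent uses that the units realise at least
  half of all signatures (a part of Dirichlet's unit theorem) and an auxiliary element of 2-power norm
  without totally positive associate.  If \<open>sqrt 2\<close> were in the field, 3 and \<open>2 + sqrt 2\<close> would lead
  to elements of small norm contradicting this.
\<close>

text \<open>The obstacle is sign control: universality speaks only about totally positive elements,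
  and a square root of such an element may have any signs. Let d be the degree and N the absolute
  norm. Two classes of totally positive units modulo squares mean that two classes of units modulo
  squares share each unit signature, which together with the rank of the unit group is where the
  index 2 comes from. Consequently, if neither s nor x has the signature of a unit, then x * s does:
  multiplication by s repairs x at the price of a factor N(s). From N(z) < 2^d a root y has N(y) <
  2^(d/2), so the price is affordable at every further step once N(s) is at most 2^(d/2). A root of
  2 \<epsilon> has norm exactly 2^(d/2); if it has a totally positive associate, square roots are
  taken up to units until one has none, which must happen because the exponent of 2 cannot be halved
  forever. The same budget fixes the numbers in the exclusion of sqrt 2, where d = 4 f: the norm 9^f
  is played against auxiliary norms up to 2^(f/2), and the norms 3^f and 7^f against 2^f.\<close>

section \<open>Homogeneous linear systems\<close>

text \<open>Gaussian elimination, one equation per induction step. Arbitrary finite index sets let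
  the unknowns be powers, embeddings or basis elements, and the equations be basis elements,
  embeddings or units.\<close>

lemma homogeneous_system_solution:
  fixes a :: "'j \<Rightarrow> 'i \<Rightarrow> 'a::field"
  assumes "finite J" "finite I" "card J < card I"
  shows "\<exists>x. (\<exists>i\<in>I. x i \<noteq> 0) \<and> (\<forall>j\<in>J. (\<Sum>i\<in>I. a j i * x i) = 0)"
  using assms
proof (induction J arbitrary: I a rule: finite_induct)
  case empty
  then have "I \<noteq> {}" by auto
  then show ?case by (intro exI[of _ "\<lambda>_. 1"]) auto
next
  case (insert j J)
  show ?case
  proof (cases "\<forall>i\<in>I. a j i = 0")
    case True
    from insert have "card J < card I" by simp
    from insert.IH[OF insert.prems(1) this, of a] obtain x
      where x: "\<exists>i\<in>I. x i \<noteq> 0" "\<forall>k\<in>J. (\<Sum>i\<in>I. a k i * x i) = 0" by blast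
    from True x show ?thesis by (intro exI[of _ x]) auto
  next
    case False
    then obtain p where p: "p \<in> I" "a j p \<noteq> 0" by blast
    have "card J < card (I - {p})" using insert p by simp
    from insert.IH[OF _ this, of "\<lambda>k i. a k i - a k p * a j i / a j p"] insert.prems(1)
    obtain x where x: "\<exists>i\<in>I - {p}. x i \<noteq> 0"
      "\<forall>k\<in>J. (\<Sum>i\<in>I - {p}. (a k i - a k p * a j i / a j p) * x i) = 0" by auto
    define s where "s = (\<Sum>i\<in>I - {p}. a j i * x i)"
    define y where "y = x(p := - s / a j p)"
    have split: "(\<Sum>i\<in>I. a k i * y i) = a k p * y p + (\<Sum>i\<in>I - {p}. a k i * x i)" for k
    proof -
      have "(\<Sum>i\<in>I - {p}. a k i * y i) = (\<Sum>i\<in>I - {p}. a k i * x i)"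
        by (rule sum.cong) (auto simp: y_def)
      then show ?thesis using p insert.prems(1) by (simp add: sum.remove)
    qed
    have "(\<Sum>i\<in>I. a k i * y i) = 0" if "k \<in> J" for k
    proof -
      have "0 = (\<Sum>i\<in>I - {p}. (a k i - a k p * a j i / a j p) * x i)" using x that by simp
      also have "\<dots> = (\<Sum>i\<in>I - {p}. a k i * x i) - a k p / a j p * s"
        by (simp add: s_def sum_subtractf sum_distrib_left algebra_simps)
      finally show ?thesis using split[of k] by (simp add: y_def)
    qed
    moreover have "(\<Sum>i\<in>I. a j i * y i) = 0"
      using split[of j] p by (simp add: y_def s_def)
    moreover have "\<exists>i\<in>I. y i \<noteq> 0" using x(1) by (auto simp: y_def)
    ultimately show ?thesis by auto
  qed
qed

section \<open>Field embeddings\<close>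

context
  fixes \<sigma> :: "'a::field_char_0 \<Rightarrow> 'b::field_char_0"
  assumes emb: "field_embedding \<sigma>"
begin

lemma emb_1: "\<sigma> 1 = 1" and emb_add: "\<sigma> (x + y) = \<sigma> x + \<sigma> y" and emb_mult: "\<sigma> (x * y) = \<sigma> x * \<sigma> y"
  using emb by (auto simp: field_embedding_def)

lemma emb_0: "\<sigma> 0 = 0"
  using emb_add[of 0 0] by simp

lemma emb_minus: "\<sigma> (- x) = - \<sigma> x"
  using emb_add[of x "- x"] by (simp add: emb_0 eq_neg_iff_add_eq_0 add.commute)

lemma emb_diff: "\<sigma> (x - y) = \<sigma> x - \<sigma> y"
  using emb_add[of x "- y"] by (simp add: emb_minus)

lemma emb_eq_0_iff: "\<sigma> x = 0 \<longleftrightarrow> x = 0"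
proof
  assume *: "\<sigma> x = 0"
  show "x = 0"
  proof (rule ccontr)
    assume "x \<noteq> 0"
    then have "1 = \<sigma> (x * inverse x)" by (simp add: emb_1)
    also have "\<dots> = 0" using * by (simp add: emb_mult)
    finally show False by simp
  qed
qed (simp add: emb_0)

lemma emb_inverse: "\<sigma> (inverse x) = inverse (\<sigma> x)"
proof (cases "x = 0")
  case False
  then have "\<sigma> x * \<sigma> (inverse x) = 1" by (simp flip: emb_mult add: emb_1)
  then show ?thesis using inverse_unique by metis
qed (simp add: emb_0)

lemma emb_divide: "\<sigma> (x / y) = \<sigma> x / \<sigma> y"
  by (simp add: divide_inverse emb_mult emb_inverse)

lemma emb_power: "\<sigma> (x ^ n) = \<sigma> x ^ n"
  by (induction n) (simp_all add: emb_1 emb_mult)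

lemma emb_of_nat: "\<sigma> (of_nat n) = of_nat n"
  by (induction n) (simp_all add: emb_0 emb_1 emb_add)

lemma emb_numeral: "\<sigma> (numeral n) = numeral n"
  using emb_of_nat[of "numeral n"] by simp

lemma emb_of_int: "\<sigma> (of_int n) = of_int n"
  by (cases n rule: int_cases2) (simp_all add: emb_of_nat emb_minus)

lemma emb_of_rat: "\<sigma> (of_rat q) = of_rat q"
  by (cases q) (simp add: of_rat_rat emb_divide emb_of_int)

lemma emb_sum: "\<sigma> (sum f A) = (\<Sum>x\<in>A. \<sigma> (f x))"
  by (induction A rule: infinite_finite_induct) (simp_all add: emb_0 emb_add)

lemma emb_prod: "\<sigma> (prod f A) = (\<Prod>x\<in>A. \<sigma> (f x))"
  by (induction A rule: infinite_finite_induct) (simp_all add: emb_1 emb_mult)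

lemma emb_poly: "\<sigma> (poly (map_poly of_int p) x) = poly (map_poly of_int p) (\<sigma> x)"
  by (induction p) (simp_all add: map_poly_pCons emb_0 emb_add emb_mult emb_of_int)

lemma algebraic_int_emb_iff: "algebraic_int (\<sigma> x) \<longleftrightarrow> algebraic_int x"
  unfolding algebraic_int_altdef_ipoly by (simp flip: emb_poly add: emb_eq_0_iff)

lemmas emb_simps = emb_0 emb_1 emb_add emb_mult emb_minus emb_diff emb_power emb_numeral

end

text \<open>Artin's argument: subtracting \<open>\<rho> y\<close> times the relation at
  \<open>x\<close> from the relation at \<open>y * x\<close> removes the term of
  \<open>\<rho>\<close>, and for each other \<open>\<sigma>\<close> some \<open>y\<close> keeps its
  coefficient alive.\<close>

lemma embeddings_independent:
  fixes c :: "('a::field_char_0 \<Rightarrow> 'b::field_char_0) \<Rightarrow> 'b"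
  assumes "finite S" "\<forall>\<sigma>\<in>S. field_embedding \<sigma>" "\<And>x. (\<Sum>\<sigma>\<in>S. c \<sigma> * \<sigma> x) = 0" "\<tau> \<in> S"
  shows "c \<tau> = 0"
  using assms
proof (induction S arbitrary: c \<tau> rule: finite_induct)
  case (insert \<rho> S)
  have c0: "c \<sigma> = 0" if "\<sigma> \<in> S" for \<sigma>
  proof -
    have "c \<sigma> * (\<sigma> y - \<rho> y) = 0" for y
    proof (rule insert.IH[of "\<lambda>\<sigma>. c \<sigma> * (\<sigma> y - \<rho> y)", OF _ _ that])
      show "(\<Sum>\<sigma>\<in>S. c \<sigma> * (\<sigma> y - \<rho> y) * \<sigma> x) = 0" for x
      proof -
        have "(\<Sum>\<sigma>\<in>S. c \<sigma> * (\<sigma> y - \<rho> y) * \<sigma> x) = (\<Sum>\<sigma>\<in>S. c \<sigma> * \<sigma> (y * x) - \<rho> y * (c \<sigma> * \<sigma> x))"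
          using insert.prems(1) by (intro sum.cong) (auto simp: emb_mult algebra_simps)
        also have "\<dots> = (\<Sum>\<sigma>\<in>S. c \<sigma> * \<sigma> (y * x)) - \<rho> y * (\<Sum>\<sigma>\<in>S. c \<sigma> * \<sigma> x)"
          by (simp add: sum_subtractf sum_distrib_left)
        also have "\<dots> = 0"
        proof -
          have "(\<Sum>\<sigma>\<in>S. c \<sigma> * \<sigma> z) = - (c \<rho> * \<rho> z)" for z
            using insert.prems(2)[of z] insert.hyps by (simp add: eq_neg_iff_add_eq_0 add.commute)
          then show ?thesis using insert.prems(1) by (simp only: emb_mult) (simp add: emb_mult)
        qed
        finally show ?thesis .
      qed
    qed (use insert.prems in auto)
    moreover have "\<sigma> \<noteq> \<rho>" using insert.hyps that by auto
    then obtain y where "\<sigma> y \<noteq> \<rho> y" by blast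
    ultimately show ?thesis by (metis mult_eq_0_iff right_minus_eq)
  qed
  have "c \<rho> = 0"
    using insert.prems(2)[of 1] insert.prems(1) insert.hyps c0 by (simp add: emb_1)
  with c0 insert.prems(3) show ?case by auto
qed simp

section \<open>The algebraic integers form a ring\<close>

text \<open>An eigenvalue of an integer matrix is a root of its characteristic polynomial, which is
  monic over the integers. Here the matrix describes multiplication by \<open>z\<close> on a
  finitely generated additive group.\<close>

lemma algebraic_int_eigenvalue:
  fixes z :: "'a::field_char_0"
  assumes "finite I" and nz: "\<exists>i\<in>I. v i \<noteq> 0"
    and ev: "\<And>i. i \<in> I \<Longrightarrow> z * v i = (\<Sum>j\<in>I. of_int (m i j) * v j)"
  shows "algebraic_int z"
proof -
  define n where "n = card I"
  obtain h where h: "bij_betw h {..<n} I"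
    using assms(1) ex_bij_betw_nat_finite unfolding n_def atLeast0LessThan[symmetric] by blast
  define M where "M = mat n n (\<lambda>(i, j). m (h i) (h j))"
  define A :: "'a mat" where "A = map_mat of_int M"
  define w where "w = vec n (\<lambda>i. v (h i))"
  have M: "M \<in> carrier_mat n n" by (simp add: M_def)
  have A: "A \<in> carrier_mat n n" using M by (simp add: A_def)
  have Aw: "A *\<^sub>v w = z \<cdot>\<^sub>v w"
  proof (rule eq_vecI)
    fix i assume i: "i < dim_vec (z \<cdot>\<^sub>v w)"
    then have i: "i < n" by (simp add: w_def)
    then have "h i \<in> I" using h by (auto simp: bij_betw_def)
    have "(A *\<^sub>v w) $ i = (\<Sum>j<n. of_int (m (h i) (h j)) * v (h j))"
      using i by (simp add: A_def M_def w_def scalar_prod_def atLeast0LessThan)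
    also have "\<dots> = (\<Sum>j\<in>I. of_int (m (h i) j) * v j)"
      by (rule sum.reindex_bij_betw[OF h])
    also have "\<dots> = z * v (h i)" using ev[OF \<open>h i \<in> I\<close>] by simp
    finally show "(A *\<^sub>v w) $ i = (z \<cdot>\<^sub>v w) $ i" using i by (simp add: w_def)
  qed (use A in \<open>simp add: w_def\<close>)
  have "w \<noteq> 0\<^sub>v n"
  proof
    assume w0: "w = 0\<^sub>v n"
    from nz obtain i where "i \<in> I" "v i \<noteq> 0" by blast
    then obtain k where "k < n" "h k = i" using h by (auto simp: bij_betw_def)
    with w0 \<open>v i \<noteq> 0\<close> show False by (metis index_vec index_zero_vec(1) w_def)
  qed
  then have "eigenvector A w z" using A Aw by (simp add: eigenvector_def w_def)
  then have "eigenvalue A z" by (auto simp: eigenvalue_def)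
  then have "poly (char_poly A) z = 0" using eigenvalue_root_char_poly[OF A] by simp
  moreover have "char_poly A = map_poly of_int (char_poly M)"
    unfolding A_def using of_int_hom.char_poly_hom[OF M] by simp
  ultimately have "poly (map_poly of_int (char_poly M)) z = 0" by simp
  moreover have "lead_coeff (char_poly M) = 1" using degree_monic_char_poly[OF M] by simp
  ultimately show ?thesis unfolding algebraic_int_altdef_ipoly by blast
qed

lemma algebraic_int_power_reduce:
  fixes x :: "'a::field_char_0"
  assumes "algebraic_int x"
  obtains n c where "n > 0" "x ^ n = (\<Sum>i<n. of_int (c i) * x ^ i)"
proof -
  from assms obtain p where p: "poly (map_poly of_int p) x = 0" "lead_coeff p = 1"
    unfolding algebraic_int_altdef_ipoly by blast
  have d: "degree (map_poly of_int p :: 'a poly) = degree p" by (simp add: degree_map_poly)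
  have "degree p \<noteq> 0"
  proof
    assume "degree p = 0"
    then obtain a where "p = [:a:]" by (metis degree_eq_zeroE)
    with p show False by simp
  qed
  have "0 = (\<Sum>i\<le>degree p. of_int (poly.coeff p i) * x ^ i)"
    using p(1) by (simp add: poly_altdef d coeff_map_poly)
  also have "\<dots> = (\<Sum>i<degree p. of_int (poly.coeff p i) * x ^ i) + x ^ degree p"
    using p(2) by (simp flip: lessThan_Suc_atMost)
  finally have "x ^ degree p = (\<Sum>i<degree p. of_int (- poly.coeff p i) * x ^ i)"
    by (simp add: sum_negf eq_neg_iff_add_eq_0 add.commute)
  with \<open>degree p \<noteq> 0\<close> show ?thesis by (intro that[of "degree p" "\<lambda>i. - poly.coeff p i"]) auto
qed

text \<open>The coefficients are the companion matrix: multiplication shifts the powers below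
  \<open>n - 1\<close>, and the monic equation rewrites the last one.\<close>

lemma algebraic_int_companion:
  fixes x :: "'a::field_char_0"
  assumes "algebraic_int x"
  obtains n c where "n > 0" "\<And>i. i < n \<Longrightarrow> x * x ^ i = (\<Sum>j<n. of_int (c i j) * x ^ j)"
proof -
  obtain n a where a: "n > 0" "x ^ n = (\<Sum>i<n. of_int (a i) * x ^ i)"
    using algebraic_int_power_reduce[OF assms] .
  define c where "c = (\<lambda>i j. if Suc i < n then (if j = Suc i then 1 else 0) else a j)"
  have "x * x ^ i = (\<Sum>j<n. of_int (c i j) * x ^ j)" if "i < n" for i
  proof (cases "Suc i < n")
    case True
    have "(\<Sum>j<n. of_int (c i j) * x ^ j) = (\<Sum>j<n. if j = Suc i then x ^ j else 0)"
      using True by (intro sum.cong) (auto simp: c_def)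
    with True show ?thesis by simp
  next
    case False
    with that have "n = Suc i" by simp
    with False a show ?thesis by (simp add: c_def)
  qed
  with a(1) show ?thesis by (rule that)
qed

text \<open>The products of powers of \<open>x\<close> and \<open>y\<close> span a group stable
  under both multiplications, so matrices for \<open>x + y\<close> and \<open>x * y\<close> are the
  sum and the product of the two given ones.\<close>

lemma algebraic_int_common_module:
  fixes x y :: "'a::field_char_0"
  assumes "algebraic_int x" "algebraic_int y"
  obtains I :: "(nat \<times> nat) set" and v c e where "finite I" "\<exists>i\<in>I. v i \<noteq> 0"
    "\<And>i. i \<in> I \<Longrightarrow> x * v i = (\<Sum>j\<in>I. of_int (c i j) * v j)"
    "\<And>i. i \<in> I \<Longrightarrow> y * v i = (\<Sum>j\<in>I. of_int (e i j) * v j)"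
proof -
  obtain n c where c: "n > 0" "\<And>i. i < n \<Longrightarrow> x * x ^ i = (\<Sum>j<n. of_int (c i j) * x ^ j)"
    using algebraic_int_companion[OF assms(1)] by blast
  obtain k e where e: "k > 0" "\<And>i. i < k \<Longrightarrow> y * y ^ i = (\<Sum>j<k. of_int (e i j) * y ^ j)"
    using algebraic_int_companion[OF assms(2)] by blast
  show ?thesis
  proof (rule that[of "{..<n} \<times> {..<k}" "\<lambda>(i, j). x ^ i * y ^ j"
        "\<lambda>(i, j) (i', j'). if j' = j then c i i' else 0"
        "\<lambda>(i, j) (i', j'). if i' = i then e j j' else 0"])
    show "\<exists>i\<in>{..<n} \<times> {..<k}. (case i of (i, j) \<Rightarrow> x ^ i * y ^ j) \<noteq> 0"
      using c(1) e(1) by (intro bexI[of _ "(0, 0)"]) auto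
  next
    fix i assume "i \<in> {..<n} \<times> {..<k}"
    then obtain a b where ab: "i = (a, b)" "a < n" "b < k" by auto
    have "(\<Sum>a'<n. \<Sum>b'<k. of_int (if b' = b then c a a' else 0) * (x ^ a' * y ^ b')) =
        (\<Sum>a'<n. \<Sum>b'<k. if b' = b then of_int (c a a') * x ^ a' * y ^ b else 0)"
      by (intro sum.cong) auto
    also have "\<dots> = (\<Sum>a'<n. of_int (c a a') * x ^ a') * y ^ b"
      using ab(3) by (simp add: sum_distrib_right)
    also have "\<dots> = x * (x ^ a * y ^ b)" using c(2)[OF ab(2)] by simp
    finally show "x * (case i of (i, j) \<Rightarrow> x ^ i * y ^ j) = (\<Sum>j\<in>{..<n} \<times> {..<k}.
        of_int ((case i of (i, j) \<Rightarrow> \<lambda>(i', j'). if j' = j then c i i' else 0) j) *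
        (case j of (i, j) \<Rightarrow> x ^ i * y ^ j))"
      by (simp add: ab case_prod_beta sum.cartesian_product cong: if_cong)
    have "(\<Sum>a'<n. \<Sum>b'<k. of_int (if a' = a then e b b' else 0) * (x ^ a' * y ^ b')) =
        (\<Sum>a'<n. if a' = a then \<Sum>b'<k. of_int (e b b') * (x ^ a * y ^ b') else 0)"
      by (intro sum.cong) auto
    also have "\<dots> = x ^ a * (\<Sum>b'<k. of_int (e b b') * y ^ b')"
      using ab(2) by (simp add: sum_distrib_left mult.left_commute)
    also have "\<dots> = y * (x ^ a * y ^ b)" using e(2)[OF ab(3)] by (simp flip: e(2)[OF ab(3)])
    finally show "y * (case i of (i, j) \<Rightarrow> x ^ i * y ^ j) = (\<Sum>j\<in>{..<n} \<times> {..<k}.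
        of_int ((case i of (i, j) \<Rightarrow> \<lambda>(i', j'). if i' = i then e j j' else 0) j) *
        (case j of (i, j) \<Rightarrow> x ^ i * y ^ j))"
      by (simp add: ab case_prod_beta sum.cartesian_product cong: if_cong)
  qed simp
qed

lemma algebraic_int_times:
  fixes x y :: "'a::field_char_0"
  assumes "algebraic_int x" "algebraic_int y"
  shows "algebraic_int (x * y)"
proof -
  obtain I :: "(nat \<times> nat) set" and v c e where *: "finite I" "\<exists>i\<in>I. v i \<noteq> 0"
    "\<And>i. i \<in> I \<Longrightarrow> x * v i = (\<Sum>j\<in>I. of_int (c i j) * v j)"
    "\<And>i. i \<in> I \<Longrightarrow> y * v i = (\<Sum>j\<in>I. of_int (e i j) * v j)"
    using algebraic_int_common_module[OF assms] by blast
  show ?thesis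
  proof (rule algebraic_int_eigenvalue[OF *(1,2), where m = "\<lambda>i j. \<Sum>k\<in>I. e i k * c k j"])
    fix i assume i: "i \<in> I"
    have "x * y * v i = (\<Sum>k\<in>I. of_int (e i k) * (x * v k))"
      using *(4)[OF i] by (simp add: mult.assoc sum_distrib_left mult.left_commute)
    also have "\<dots> = (\<Sum>k\<in>I. \<Sum>j\<in>I. of_int (e i k * c k j) * v j)"
      by (intro sum.cong) (simp_all add: *(3) sum_distrib_left mult.assoc)
    also have "\<dots> = (\<Sum>j\<in>I. \<Sum>k\<in>I. of_int (e i k * c k j) * v j)" by (rule sum.swap)
    finally show "x * y * v i = (\<Sum>j\<in>I. of_int (\<Sum>k\<in>I. e i k * c k j) * v j)"
      by (simp add: sum_distrib_right)
  qed
qed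

lemma algebraic_int_plus:
  fixes x y :: "'a::field_char_0"
  assumes "algebraic_int x" "algebraic_int y"
  shows "algebraic_int (x + y)"
proof -
  obtain I :: "(nat \<times> nat) set" and v c e where *: "finite I" "\<exists>i\<in>I. v i \<noteq> 0"
    "\<And>i. i \<in> I \<Longrightarrow> x * v i = (\<Sum>j\<in>I. of_int (c i j) * v j)"
    "\<And>i. i \<in> I \<Longrightarrow> y * v i = (\<Sum>j\<in>I. of_int (e i j) * v j)"
    using algebraic_int_common_module[OF assms] by blast
  show ?thesis
    by (rule algebraic_int_eigenvalue[OF *(1,2), where m = "\<lambda>i j. c i j + e i j"])
      (simp add: *(3,4) distrib_right sum.distrib)
qed

lemma algebraic_int_diff:
  fixes x y :: "'a::field_char_0"
  assumes "algebraic_int x" "algebraic_int y"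
  shows "algebraic_int (x - y)"
  using algebraic_int_plus[of x "- y"] assms by simp

lemma algebraic_int_power:
  fixes x :: "'a::field_char_0"
  assumes "algebraic_int x"
  shows "algebraic_int (x ^ n)"
  using assms by (induction n) (auto intro: algebraic_int_times)

lemma algebraic_int_sum:
  fixes f :: "'b \<Rightarrow> 'a::field_char_0"
  assumes "\<And>i. i \<in> A \<Longrightarrow> algebraic_int (f i)"
  shows "algebraic_int (sum f A)"
  using assms by (induction A rule: infinite_finite_induct) (auto intro: algebraic_int_plus)

lemma algebraic_int_prod:
  fixes f :: "'b \<Rightarrow> 'a::field_char_0"
  assumes "\<And>i. i \<in> A \<Longrightarrow> algebraic_int (f i)"
  shows "algebraic_int (prod f A)"
  using assms by (induction A rule: infinite_finite_induct) (auto intro: algebraic_int_times)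

section \<open>Trace and norm of a totally real field\<close>

interpretation of_rat_poly_hom: map_poly_idom_hom "of_rat :: rat \<Rightarrow> 'a::field_char_0" ..

section \<open>Rational coordinates and separable polynomials\<close>

text \<open>The coordinate maps are part of the notion because they are the functionals that will be
  expanded in the embeddings.\<close>

definition rational_basis :: "'k::field_char_0 set \<Rightarrow> ('k \<Rightarrow> 'k \<Rightarrow> rat) \<Rightarrow> bool" where
  "rational_basis B co \<longleftrightarrow> finite B \<and> card B = field_degree TYPE('k) \<and>
     (\<forall>x. x = (\<Sum>b\<in>B. of_rat (co b x) * b)) \<and>
     (\<forall>b x y. co b (x + y) = co b x + co b y) \<and> (\<forall>b q x. co b (of_rat q * x) = q * co b x) \<and>
     (\<forall>b\<in>B. \<forall>b'\<in>B. co b b' = (if b = b' then 1 else 0))"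

lemma rational_basisD:
  fixes B :: "'k::field_char_0 set"
  assumes "rational_basis B co"
  shows "finite B" "card B = field_degree TYPE('k)" "x = (\<Sum>b\<in>B. of_rat (co b x) * b)"
    "co b (x + y) = co b x + co b y" "co b (of_rat q * x) = q * co b x"
    "b \<in> B \<Longrightarrow> b' \<in> B \<Longrightarrow> co b b' = (if b = b' then 1 else 0)"
  using assms unfolding rational_basis_def by blast+

lemma ex_rational_basis:
  assumes "number_field TYPE('k::field_char_0)"
  obtains B :: "'k::field_char_0 set" and co where "rational_basis B co"
proof -
  obtain A :: "'k set" where A: "finite A" "rat_space.span A = UNIV"
    using assms unfolding number_field_def by blast
  obtain B where B: "rat_space.independent B" "rat_space.span B = (UNIV :: 'k set)"
    "card B = rat_space.dim (UNIV :: 'k set)"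
    using rat_space.basis_exists[of "UNIV :: 'k set"] by (metis top.extremum_uniqueI)
  have fin: "finite B"
    using rat_space.independent_span_bound[OF A(1) B(1)] A(2) by simp
  have "rational_basis B (\<lambda>b x. rat_space.representation B x b)"
    unfolding rational_basis_def
  proof (intro conjI allI ballI)
    show "x = (\<Sum>b\<in>B. of_rat (rat_space.representation B x b) * b)" for x
      using rat_space.sum_representation_eq[OF B(1) _ fin order.refl, of x] B(2) by simp
    show "rat_space.representation B (x + y) b =
        rat_space.representation B x b + rat_space.representation B y b" for b x y
      using rat_space.representation_add[OF B(1), of y x] B(2) by simp
    show "rat_space.representation B (of_rat q * x) b = q * rat_space.representation B x b" for b q x
      using rat_space.representation_scale[OF B(1), of x q] B(2) by simp
    show "rat_space.representation B b' b = (if b = b' then 1 else 0)" if "b \<in> B" "b' \<in> B" for b b'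
      using rat_space.representation_basis[OF B(1) that(2)] by (auto simp: fun_eq_iff)
  qed (use B fin in \<open>simp_all add: field_degree_def\<close>)
  then show ?thesis by (rule that)
qed

lemma rational_algebraic:
  fixes x :: "'k::field_char_0"
  assumes "number_field TYPE('k)"
  obtains p :: "rat poly" where "p \<noteq> 0" "poly (map_poly of_rat p) x = 0"
proof -
  obtain B :: "'k set" and co where basis: "rational_basis B co"
    using ex_rational_basis[OF assms] .
  note B = rational_basisD[OF basis]
  obtain c where c: "\<exists>i\<in>{..card B}. c i \<noteq> 0"
    "\<forall>b\<in>B. (\<Sum>i\<in>{..card B}. co b (x ^ i) * c i) = 0"
    using homogeneous_system_solution[of B "{..card B}" "\<lambda>b i. co b (x ^ i)"] B(1) by auto
  define p where "p = (\<Sum>i\<le>card B. Polynomial.monom (c i) i)"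
  have cp: "poly.coeff p i = (if i \<le> card B then c i else 0)" for i
    by (simp add: p_def coeff_sum)
  have "poly (map_poly of_rat p) x = (\<Sum>i\<le>card B. of_rat (c i) * x ^ i)"
    by (simp add: p_def of_rat_poly_hom.hom_sum poly_sum poly_monom)
  also have "\<dots> = (\<Sum>i\<le>card B. of_rat (c i) * (\<Sum>b\<in>B. of_rat (co b (x ^ i)) * b))"
    by (simp flip: B(3))
  also have "\<dots> = (\<Sum>i\<le>card B. \<Sum>b\<in>B. of_rat (co b (x ^ i) * c i) * b)"
    by (simp add: sum_distrib_left of_rat_mult algebra_simps)
  also have "\<dots> = (\<Sum>b\<in>B. \<Sum>i\<le>card B. of_rat (co b (x ^ i) * c i) * b)" by (rule sum.swap)
  also have "\<dots> = (\<Sum>b\<in>B. of_rat (\<Sum>i\<le>card B. co b (x ^ i) * c i) * b)"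
    by (simp add: of_rat_sum sum_distrib_right)
  also have "\<dots> = 0" using c(2) by simp
  finally have "poly (map_poly of_rat p) x = 0" .
  moreover have "p \<noteq> 0" using c(1) cp by (metis atMost_iff coeff_0)
  ultimately show ?thesis using that by blast
qed

text \<open>A polynomial of least degree is coprime to its derivative: otherwise the cofactor of the
  gcd would annihilate \<open>x\<close> in smaller degree. The Bezout identity carries over to the
  complex numbers and excludes multiple roots.\<close>

lemma rational_separable:
  fixes x :: "'k::field_char_0"
  assumes "number_field TYPE('k)"
  obtains p :: "rat poly" where "p \<noteq> 0" "poly (map_poly of_rat p) x = 0"
    "rsquarefree (map_poly of_rat p :: complex poly)"
proof -
  define P where "P = (\<lambda>p :: rat poly. p \<noteq> 0 \<and> poly (map_poly of_rat p) x = 0)"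
  have "\<exists>p. P p" using rational_algebraic[OF assms, of x] unfolding P_def by metis
  then obtain p where p: "P p" "\<And>q. P q \<Longrightarrow> degree p \<le> degree q"
    using ex_has_least_nat[of P _ degree] by blast
  from p(1) have p0: "p \<noteq> 0" and px: "poly (map_poly of_rat p) x = 0" by (auto simp: P_def)
  have "degree p \<noteq> 0"
  proof
    assume "degree p = 0"
    then obtain a where "p = [:a:]" by (metis degree_eq_zeroE)
    with p0 px show False by (simp add: map_poly_pCons)
  qed
  then have "pderiv p \<noteq> 0" by (simp add: pderiv_eq_0_iff)
  define g where "g = gcd p (pderiv p)"
  have "g \<noteq> 0" using p0 by (simp add: g_def)
  have dg: "degree g < degree p"
  proof -
    have "degree g \<le> degree (pderiv p)"
      unfolding g_def using \<open>pderiv p \<noteq> 0\<close> by (intro dvd_imp_degree_le) auto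
    also have "\<dots> < degree p" using \<open>degree p \<noteq> 0\<close> by (simp add: degree_pderiv)
    finally show ?thesis .
  qed
  obtain h where h: "p = g * h" unfolding g_def by (meson gcd_dvd1 dvdE)
  have "h \<noteq> 0" using h p0 by auto
  have "poly (map_poly of_rat g) x * poly (map_poly of_rat h) x = 0"
    using px unfolding h by (simp add: of_rat_poly_hom.hom_mult)
  moreover have "poly (map_poly of_rat g) x \<noteq> 0"
    using p(2)[of g] dg \<open>g \<noteq> 0\<close> by (auto simp: P_def)
  ultimately have "degree p \<le> degree h"
    using p(2)[of h] \<open>h \<noteq> 0\<close> by (auto simp: P_def)
  then have "degree g = 0" using h \<open>g \<noteq> 0\<close> \<open>h \<noteq> 0\<close> by (simp add: degree_mult_eq)
  then obtain a where a: "g = [:a:]" by (metis degree_eq_zeroE)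
  obtain u v where uv: "u * p + v * pderiv p = g"
    unfolding g_def using bezout_coefficients[of p "pderiv p"] by (metis surj_pair)
  have "rsquarefree (map_poly of_rat p :: complex poly)"
  proof (unfold rsquarefree_roots, intro allI notI, elim conjE)
    fix z :: complex
    assume z: "poly (map_poly of_rat p) z = 0" "poly (pderiv (map_poly of_rat p)) z = 0"
    have "of_rat a = poly (map_poly of_rat (u * p + v * pderiv p)) z"
      unfolding uv a by (simp add: of_rat_hom.map_poly_pCons_hom)
    also have "\<dots> = 0" using z
      by (simp add: of_rat_poly_hom.hom_mult of_rat_poly_hom.hom_add of_rat_hom.map_poly_pderiv)
    finally show False using \<open>g \<noteq> 0\<close> a by simp
  qed
  with p0 px show ?thesis by (rule that)
qed

section \<open>Rational functionals as combinations of embeddings\<close>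

text \<open>Functionals take complex values so that the annihilating polynomials split into linear
  factors; total realness turns the resulting embeddings into real ones only afterwards.\<close>

definition rat_linear :: "('k::field_char_0 \<Rightarrow> complex) \<Rightarrow> bool" where
  "rat_linear \<phi> \<longleftrightarrow> (\<forall>x y. \<phi> (x + y) = \<phi> x + \<phi> y) \<and> (\<forall>q x. \<phi> (of_rat q * x) = of_rat q * \<phi> x)"

lemma rat_linear_sum:
  assumes "rat_linear \<phi>"
  shows "\<phi> (\<Sum>i\<in>A. of_rat (q i) * f i) = (\<Sum>i\<in>A. of_rat (q i) * \<phi> (f i))"
proof -
  have "\<phi> 0 = 0" using assms unfolding rat_linear_def by (metis mult_zero_left of_rat_0)
  with assms show ?thesis
    by (induction A rule: infinite_finite_induct) (auto simp: rat_linear_def)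
qed

text \<open>
  The operator \<open>\<phi> \<mapsto> (x \<mapsto> \<phi> (\<alpha> * x))\<close> on functionals is annihilated by a product of distinct linear
  factors, so every functional splits into eigenvectors; \<open>V\<close> records the eigenvalue conditions for
  the other operators, which the splitting preserves.
\<close>

lemma split_eigenvectors:
  fixes V :: "('k::field_char_0 \<Rightarrow> complex) set"
  assumes "finite R"
    and V: "\<And>\<phi> \<psi>. \<phi> \<in> V \<Longrightarrow> \<psi> \<in> V \<Longrightarrow> (\<lambda>x. \<phi> x + \<psi> x) \<in> V" "\<And>c \<phi>. \<phi> \<in> V \<Longrightarrow> (\<lambda>x. c * \<phi> x) \<in> V"
      "\<And>\<phi>. \<phi> \<in> V \<Longrightarrow> (\<lambda>x. \<phi> (\<alpha> * x)) \<in> V"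
    and "\<phi> \<in> V" "\<And>x. (\<Sum>i\<le>degree (\<Prod>r\<in>R. [:- r, 1:]). poly.coeff (\<Prod>r\<in>R. [:- r, 1:]) i * \<phi> (\<alpha> ^ i * x)) = 0"
  shows "\<exists>\<psi>. (\<forall>r\<in>R. \<psi> r \<in> V \<and> (\<forall>x. \<psi> r (\<alpha> * x) = r * \<psi> r x)) \<and> (\<forall>x. \<phi> x = (\<Sum>r\<in>R. \<psi> r x))"
  using assms(1,5,6)
proof (induction R arbitrary: \<phi> rule: finite_induct)
  case empty
  then show ?case by simp
next
  case (insert s R)
  define Q where "Q = (\<Prod>r\<in>R. [:- r, 1:])"
  have "Q \<noteq> 0" using insert.hyps by (simp add: Q_def)
  have prod: "(\<Prod>r\<in>insert s R. [:- r, 1:]) = pCons 0 Q - Polynomial.smult s Q"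
    using insert.hyps by (simp add: Q_def)
  have deg: "degree (\<Prod>r\<in>insert s R. [:- r, 1:]) = Suc (degree Q)"
    using insert.hyps \<open>Q \<noteq> 0\<close> by (simp add: degree_mult_eq flip: Q_def del: mult_pCons_left)
  define \<phi>' where "\<phi>' = (\<lambda>x. \<phi> (\<alpha> * x) + (- s) * \<phi> x)"
  have "\<phi>' \<in> V" unfolding \<phi>'_def by (intro V insert.prems)
  moreover have "(\<Sum>i\<le>degree Q. poly.coeff Q i * \<phi>' (\<alpha> ^ i * x)) = 0" for x
  proof -
    have "0 = (\<Sum>i\<le>Suc (degree Q). (poly.coeff (pCons 0 Q) i - s * poly.coeff Q i) * \<phi> (\<alpha> ^ i * x))"
      using insert.prems(2)[of x] unfolding deg by (simp add: prod del: sum.atMost_Suc)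
    also have "\<dots> = (\<Sum>i\<le>Suc (degree Q). poly.coeff (pCons 0 Q) i * \<phi> (\<alpha> ^ i * x)) -
        (\<Sum>i\<le>Suc (degree Q). s * poly.coeff Q i * \<phi> (\<alpha> ^ i * x))"
      by (simp only: left_diff_distrib sum_subtractf)
    also have "(\<Sum>i\<le>Suc (degree Q). poly.coeff (pCons 0 Q) i * \<phi> (\<alpha> ^ i * x)) =
        (\<Sum>i\<le>degree Q. poly.coeff Q i * \<phi> (\<alpha> ^ i * (\<alpha> * x)))"
      by (simp add: sum.atMost_Suc_shift mult.assoc mult.left_commute del: sum.atMost_Suc)
    also have "(\<Sum>i\<le>Suc (degree Q). s * poly.coeff Q i * \<phi> (\<alpha> ^ i * x)) =
        (\<Sum>i\<le>degree Q. s * poly.coeff Q i * \<phi> (\<alpha> ^ i * x))"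
      by (simp add: coeff_eq_0)
    finally show ?thesis
      by (simp add: \<phi>'_def distrib_left right_diff_distrib sum_subtractf mult.assoc mult.left_commute)
  qed
  ultimately obtain \<psi> where \<psi>: "\<And>r. r \<in> R \<Longrightarrow> \<psi> r \<in> V" "\<And>r x. r \<in> R \<Longrightarrow> \<psi> r (\<alpha> * x) = r * \<psi> r x"
    "\<And>x. \<phi>' x = (\<Sum>r\<in>R. \<psi> r x)"
    using insert.IH[of \<phi>'] unfolding Q_def by blast
  \<comment> \<open>The operator minus \<open>s\<close> acts on the eigenvector
    \<open>\<psi> r\<close> as the scalar \<open>r - s\<close>. Dividing by it gives a preimage, and
    what then remains of \<open>\<phi>\<close> is an eigenvector for \<open>s\<close>.\<close>
  define \<chi> where "\<chi> = (\<lambda>r x. inverse (r - s) * \<psi> r x)"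
  define \<rho> where "\<rho> = (\<lambda>x. \<phi> x + (- 1) * (\<Sum>r\<in>R. \<chi> r x))"
  have V0: "(\<lambda>x. 0) \<in> V" using V(2)[OF \<open>\<phi> \<in> V\<close>, of 0] by simp
  have \<chi>V: "\<chi> r \<in> V" if "r \<in> R" for r unfolding \<chi>_def using \<psi>(1)[OF that] by (rule V)
  have sumV: "(\<lambda>x. \<Sum>r\<in>A. \<chi> r x) \<in> V" if "A \<subseteq> R" for A
    using finite_subset[OF that insert.hyps(1)] that
    by (induction A rule: finite_induct) (auto simp: V0 intro!: V(1) \<chi>V)
  have "\<rho> \<in> V" unfolding \<rho>_def by (intro V insert.prems sumV order.refl)
  moreover have "\<rho> (\<alpha> * x) = s * \<rho> x" for x
  proof -
    have "\<chi> r (\<alpha> * x) - s * \<chi> r x = \<psi> r x" if "r \<in> R" for r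
    proof -
      have "r - s \<noteq> 0" using that insert.hyps by auto
      moreover have "\<chi> r (\<alpha> * x) - s * \<chi> r x = inverse (r - s) * (r - s) * \<psi> r x"
        using that by (simp add: \<chi>_def \<psi>(2) algebra_simps)
      ultimately show ?thesis by simp
    qed
    then have "(\<Sum>r\<in>R. \<chi> r (\<alpha> * x)) - s * (\<Sum>r\<in>R. \<chi> r x) = \<phi>' x"
      by (simp add: \<psi>(3) sum_distrib_left flip: sum_subtractf)
    then show ?thesis by (simp add: \<rho>_def \<phi>'_def algebra_simps)
  qed
  moreover have "\<chi> r (\<alpha> * x) = r * \<chi> r x" if "r \<in> R" for r x
    using \<psi>(2)[OF that] by (simp add: \<chi>_def)
  moreover have "(\<Sum>r\<in>insert s R. (\<chi>(s := \<rho>)) r x) = \<phi> x" for x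
  proof -
    have "(\<Sum>r\<in>R. (\<chi>(s := \<rho>)) r x) = (\<Sum>r\<in>R. \<chi> r x)"
      using insert.hyps by (intro sum.cong) auto
    then show ?thesis using insert.hyps by (simp add: \<rho>_def)
  qed
  ultimately show ?case using \<chi>V by (intro exI[of _ "\<chi>(s := \<rho>)"]) (auto; simp)
qed

lemma split_eigenvectors_number_field:
  fixes V :: "('k::field_char_0 \<Rightarrow> complex) set"
  assumes nf: "number_field TYPE('k)"
    and V: "\<And>\<phi> \<psi>. \<phi> \<in> V \<Longrightarrow> \<psi> \<in> V \<Longrightarrow> (\<lambda>x. \<phi> x + \<psi> x) \<in> V" "\<And>c \<phi>. \<phi> \<in> V \<Longrightarrow> (\<lambda>x. c * \<phi> x) \<in> V"
      "\<And>\<phi>. \<phi> \<in> V \<Longrightarrow> (\<lambda>x. \<phi> (\<alpha> * x)) \<in> V" "\<And>\<phi>. \<phi> \<in> V \<Longrightarrow> rat_linear \<phi>"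
    and \<phi>: "\<phi> \<in> V"
  obtains R \<psi> where "finite R" "\<And>r. r \<in> R \<Longrightarrow> \<psi> r \<in> V"
    "\<And>r x. r \<in> R \<Longrightarrow> \<psi> r (\<alpha> * x) = r * \<psi> r x" "\<And>x. \<phi> x = (\<Sum>r\<in>R. \<psi> r x)"
proof -
  obtain p :: "rat poly" where p: "p \<noteq> 0" "poly (map_poly of_rat p) \<alpha> = 0"
    "rsquarefree (map_poly of_rat p :: complex poly)"
    using rational_separable[OF nf] .
  define P :: "complex poly" where "P = map_poly of_rat p"
  define R where "R = {z. poly P z = 0}"
  have "P \<noteq> 0" using p(1) by (simp add: P_def)
  then have "finite R" by (simp add: R_def poly_roots_finite)
  have P: "Polynomial.smult (lead_coeff P) (\<Prod>r\<in>R. [:- r, 1:]) = P"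
    unfolding R_def using complex_poly_decompose_rsquarefree p(3) unfolding P_def by blast
  have cP: "poly.coeff P i = of_rat (poly.coeff p i)" for i by (simp add: P_def)
  have "(\<Sum>i\<le>degree (\<Prod>r\<in>R. [:- r, 1:]). poly.coeff (\<Prod>r\<in>R. [:- r, 1:]) i * \<phi> (\<alpha> ^ i * x)) = 0" for x
  proof -
    let ?Q = "\<Prod>r\<in>R. [:- r, 1:]"
    have deg: "degree ?Q = degree p"
      using P \<open>P \<noteq> 0\<close> by (metis P_def degree_smult_eq leading_coeff_0_iff of_rat_hom.degree_map_poly_hom)
    have "lead_coeff P * (\<Sum>i\<le>degree ?Q. poly.coeff ?Q i * \<phi> (\<alpha> ^ i * x)) =
        (\<Sum>i\<le>degree p. poly.coeff (Polynomial.smult (lead_coeff P) ?Q) i * \<phi> (\<alpha> ^ i * x))"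
      unfolding deg by (simp add: sum_distrib_left mult.assoc)
    also have "\<dots> = (\<Sum>i\<le>degree p. of_rat (poly.coeff p i) * \<phi> (\<alpha> ^ i * x))"
      by (subst P) (simp add: cP)
    also have "\<dots> = \<phi> (\<Sum>i\<le>degree p. of_rat (poly.coeff p i) * (\<alpha> ^ i * x))"
      by (rule rat_linear_sum[OF V(4)[OF \<phi>], symmetric])
    also have "(\<Sum>i\<le>degree p. of_rat (poly.coeff p i) * (\<alpha> ^ i * x)) = poly (map_poly of_rat p) \<alpha> * x"
      by (simp add: poly_altdef sum_distrib_right mult.assoc)
    also have "\<phi> \<dots> = 0"
      using V(4)[OF \<phi>] p(2) unfolding rat_linear_def by (metis mult_zero_left of_rat_0)
    finally show ?thesis using \<open>P \<noteq> 0\<close> by simp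
  qed
  with split_eigenvectors[OF \<open>finite R\<close> V(1-3) \<phi>] obtain \<psi> where
    "\<forall>r\<in>R. \<psi> r \<in> V \<and> (\<forall>x. \<psi> r (\<alpha> * x) = r * \<psi> r x)" "\<forall>x. \<phi> x = (\<Sum>r\<in>R. \<psi> r x)" by blast
  with \<open>finite R\<close> show ?thesis by (intro that[of R \<psi>]) auto
qed

text \<open>
  In the span of the embeddings: a simultaneous eigenvector \<open>\<psi>\<close> of all multiplication operators
  is the multiple \<open>\<psi> 1\<close> of the embedding that maps each element to its eigenvalue.
\<close>

lemma rat_linear_sum_embeddings:
  fixes \<phi> :: "'k::field_char_0 \<Rightarrow> complex"
  assumes nf: "number_field TYPE('k)" and \<phi>: "rat_linear \<phi>"
  shows "\<exists>cs. (\<forall>(c, \<sigma>)\<in>set cs. field_embedding \<sigma>) \<and> (\<forall>x. \<phi> x = (\<Sum>(c, \<sigma>)\<leftarrow>cs. c * \<sigma> x))"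
proof -
  obtain B :: "'k set" and co where basis: "rational_basis B co"
    using ex_rational_basis[OF nf] .
  note B = rational_basisD[OF basis]
  \<comment> \<open>Diagonalising one element of \<open>A\<close> after the other; the pieces form a
    list, so that equal pieces are counted with multiplicity.\<close>
  have split: "\<exists>\<psi>s. (\<forall>\<psi>\<in>set \<psi>s. rat_linear \<psi> \<and> (\<forall>a\<in>A. \<exists>r. \<forall>x. \<psi> (a * x) = r * \<psi> x)) \<and>
      (\<forall>x. \<phi> x = (\<Sum>\<psi>\<leftarrow>\<psi>s. \<psi> x))" if "finite A" for A :: "'k set"
    using that
  proof (induction A rule: finite_induct)
    case empty
    show ?case using \<phi> by (intro exI[of _ "[\<phi>]"]) auto
  next
    case (insert a A)
    then obtain \<psi>s where \<psi>s: "\<forall>\<psi>\<in>set \<psi>s. rat_linear \<psi> \<and> (\<forall>a\<in>A. \<exists>r. \<forall>x. \<psi> (a * x) = r * \<psi> x)"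
      "\<forall>x. \<phi> x = (\<Sum>\<psi>\<leftarrow>\<psi>s. \<psi> x)" by blast
    have one: "\<exists>\<chi>s. (\<forall>\<chi>\<in>set \<chi>s. rat_linear \<chi> \<and> (\<forall>a\<in>insert a A. \<exists>r. \<forall>x. \<chi> (a * x) = r * \<chi> x)) \<and>
        (\<forall>x. \<psi> x = (\<Sum>\<chi>\<leftarrow>\<chi>s. \<chi> x))"
      if \<psi>: "rat_linear \<psi>" "\<forall>a\<in>A. \<exists>r. \<forall>x. \<psi> (a * x) = r * \<psi> x" for \<psi>
    proof -
      obtain \<rho> where \<rho>: "\<And>b x. b \<in> A \<Longrightarrow> \<psi> (b * x) = \<rho> b * \<psi> x" using \<psi>(2) by metis
      \<comment> \<open>Freezing the eigenvalues already obtained; multiplication by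
        \<open>a\<close> preserves this space because the multiplications commute.\<close>
      define V where "V = {\<chi>. rat_linear \<chi> \<and> (\<forall>b\<in>A. \<forall>x. \<chi> (b * x) = \<rho> b * \<chi> x)}"
      obtain R \<chi> where R: "finite R" "\<And>r. r \<in> R \<Longrightarrow> \<chi> r \<in> V"
        "\<And>r x. r \<in> R \<Longrightarrow> \<chi> r (a * x) = r * \<chi> r x" "\<And>x. \<psi> x = (\<Sum>r\<in>R. \<chi> r x)"
      proof (rule split_eigenvectors_number_field[OF nf, of V a \<psi>])
        show "(\<lambda>x. \<chi> (a * x)) \<in> V" if "\<chi> \<in> V" for \<chi>
        proof -
          have "\<chi> (a * (of_rat q * x)) = \<chi> (of_rat q * (a * x))"
            "\<chi> (a * (b * x)) = \<chi> (b * (a * x))" for q b x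
            by (simp_all only: mult.left_commute)
          with that show ?thesis by (simp add: V_def rat_linear_def distrib_left)
        qed
        show "\<psi> \<in> V" using \<psi> \<rho> by (simp add: V_def)
      qed (auto simp: V_def rat_linear_def algebra_simps)
      obtain rs where rs: "set rs = R" "distinct rs" using finite_distinct_list[OF R(1)] by blast
      have "\<psi> x = (\<Sum>\<chi>\<leftarrow>map \<chi> rs. \<chi> x)" for x
        using R(4) rs by (simp add: o_def sum_list_distinct_conv_sum_set)
      moreover have "\<forall>\<chi>\<in>set (map \<chi> rs). rat_linear \<chi> \<and> (\<forall>a\<in>insert a A. \<exists>r. \<forall>x. \<chi> (a * x) = r * \<chi> x)"
        using R(2,3) rs(1) unfolding V_def by auto
      ultimately show ?thesis by blast
    qed
    have "\<exists>\<chi>s. (\<forall>\<chi>\<in>set \<chi>s. rat_linear \<chi> \<and> (\<forall>a\<in>insert a A. \<exists>r. \<forall>x. \<chi> (a * x) = r * \<chi> x)) \<and>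
        (\<forall>x. (\<Sum>\<psi>\<leftarrow>\<psi>s. \<psi> x) = (\<Sum>\<chi>\<leftarrow>\<chi>s. \<chi> x))"
      using \<psi>s(1)
    proof (induction \<psi>s)
      case Nil
      show ?case by (intro exI[of _ "[]"]) simp
    next
      case (Cons \<psi> \<psi>s)
      from Cons obtain \<chi>s where \<chi>s: "\<forall>\<chi>\<in>set \<chi>s. rat_linear \<chi> \<and> (\<forall>a\<in>insert a A. \<exists>r. \<forall>x. \<chi> (a * x) = r * \<chi> x)"
        "\<forall>x. (\<Sum>\<psi>\<leftarrow>\<psi>s. \<psi> x) = (\<Sum>\<chi>\<leftarrow>\<chi>s. \<chi> x)" by auto
      from one[of \<psi>] Cons.prems obtain \<chi>s' where
        "\<forall>\<chi>\<in>set \<chi>s'. rat_linear \<chi> \<and> (\<forall>a\<in>insert a A. \<exists>r. \<forall>x. \<chi> (a * x) = r * \<chi> x)"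
        "\<forall>x. \<psi> x = (\<Sum>\<chi>\<leftarrow>\<chi>s'. \<chi> x)" by auto
      with \<chi>s show ?case by (intro exI[of _ "\<chi>s' @ \<chi>s"]) auto
    qed
    with \<psi>s(2) show ?case by simp
  qed
  obtain \<psi>s where \<psi>s: "\<forall>\<psi>\<in>set \<psi>s. rat_linear \<psi> \<and> (\<forall>b\<in>B. \<exists>r. \<forall>x. \<psi> (b * x) = r * \<psi> x)"
    "\<forall>x. \<phi> x = (\<Sum>\<psi>\<leftarrow>\<psi>s. \<psi> x)"
    using split[OF B(1)] by blast
  have multiple: "\<exists>c \<sigma>. field_embedding \<sigma> \<and> (\<forall>x. \<psi> x = c * \<sigma> x)"
    if lin: "rat_linear \<psi>" and ev: "\<forall>b\<in>B. \<exists>r. \<forall>x. \<psi> (b * x) = r * \<psi> x" and nz: "\<psi> z \<noteq> 0" for \<psi> z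
  proof -
    obtain \<rho> where \<rho>: "\<And>b x. b \<in> B \<Longrightarrow> \<psi> (b * x) = \<rho> b * \<psi> x" using ev by metis
    \<comment> \<open>The eigenvalues on the basis extend linearly to a map giving the eigenvalue of
      every element, and eigenvalues are multiplicative.\<close>
    define \<sigma> where "\<sigma> = (\<lambda>y. \<Sum>b\<in>B. of_rat (co b y) * \<rho> b)"
    have mult: "\<psi> (y * x) = \<sigma> y * \<psi> x" for x y
    proof -
      have "\<psi> (y * x) = \<psi> (\<Sum>b\<in>B. of_rat (co b y) * (b * x))"
        by (subst B(3)[of y]) (simp add: sum_distrib_right mult.assoc)
      also have "\<dots> = (\<Sum>b\<in>B. of_rat (co b y) * \<psi> (b * x))" by (rule rat_linear_sum[OF lin])
      also have "\<dots> = \<sigma> y * \<psi> x" by (simp add: \<rho> \<sigma>_def sum_distrib_right mult.assoc)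
      finally show ?thesis .
    qed
    have eq: "\<psi> x = \<psi> 1 * \<sigma> x" for x using mult[of x 1] by simp
    have nz1: "\<psi> 1 \<noteq> 0" using nz eq[of z] by auto
    have \<sigma>: "\<sigma> x = \<psi> x / \<psi> 1" for x using eq[of x] nz1 by simp
    have "field_embedding \<sigma>"
      unfolding field_embedding_def
    proof (intro conjI allI)
      show "\<sigma> 1 = 1" using nz1 by (simp add: \<sigma>)
      show "\<sigma> (x + y) = \<sigma> x + \<sigma> y" for x y
        using lin by (simp add: \<sigma> rat_linear_def add_divide_distrib)
      show "\<sigma> (x * y) = \<sigma> x * \<sigma> y" for x y
        using mult[of x y] by (simp add: \<sigma>[of "x * y"] \<sigma>[of y])
    qed
    with eq show ?thesis by blast
  qed
  have "\<exists>cs. (\<forall>(c, \<sigma>)\<in>set cs. field_embedding \<sigma>) \<and> (\<forall>x. (\<Sum>\<psi>\<leftarrow>\<psi>s. \<psi> x) = (\<Sum>(c, \<sigma>)\<leftarrow>cs. c * \<sigma> x))"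
    using \<psi>s(1)
  proof (induction \<psi>s)
    case Nil
    show ?case by (intro exI[of _ "[]"]) simp
  next
    case (Cons \<psi> \<psi>s)
    from Cons obtain cs where cs: "\<forall>(c, \<sigma>)\<in>set cs. field_embedding \<sigma>"
      "\<forall>x. (\<Sum>\<psi>\<leftarrow>\<psi>s. \<psi> x) = (\<Sum>(c, \<sigma>)\<leftarrow>cs. c * \<sigma> x)" by auto
    show ?case
    proof (cases "\<forall>x. \<psi> x = 0")
      case True
      with cs show ?thesis by (intro exI[of _ cs]) auto
    next
      case False
      then obtain z where "\<psi> z \<noteq> 0" by blast
      with multiple[of \<psi> z] Cons.prems obtain c \<sigma> where "field_embedding \<sigma>" "\<forall>x. \<psi> x = c * \<sigma> x"
        by (metis list.set_intros(1))
      with cs show ?thesis by (intro exI[of _ "(c, \<sigma>) # cs"]) auto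
    qed
  qed
  with \<psi>s(2) show ?thesis by simp
qed

definition real_embeddings :: "('k::field_char_0 \<Rightarrow> real) set" where
  "real_embeddings = {\<sigma>. field_embedding \<sigma>}"

section \<open>Number of real embeddings, trace and norm\<close>

locale totally_real_field =
  fixes K :: "'k::field_char_0 itself"
  assumes number_field: "number_field TYPE('k)"
    and totally_real: "totally_real TYPE('k)"
begin

abbreviation E :: "('k \<Rightarrow> real) set" where "E \<equiv> real_embeddings"

lemma E_embedding: "\<sigma> \<in> E \<Longrightarrow> field_embedding \<sigma>"
  by (simp add: real_embeddings_def)

text \<open>With more embeddings than basis elements, some nontrivial combination vanishes on the
  basis, hence everywhere, against their independence.\<close>

lemma card_real_embeddings_le: "finite S \<Longrightarrow> S \<subseteq> E \<Longrightarrow> card S \<le> field_degree TYPE('k)"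
proof (rule ccontr)
  assume S: "finite S" "S \<subseteq> E" "\<not> card S \<le> field_degree TYPE('k)"
  obtain B :: "'k set" and co where basis: "rational_basis B co"
    using ex_rational_basis[OF number_field] .
  note B = rational_basisD[OF basis]
  obtain c where c: "\<exists>\<sigma>\<in>S. c \<sigma> \<noteq> 0" "\<forall>b\<in>B. (\<Sum>\<sigma>\<in>S. \<sigma> b * c \<sigma>) = 0"
    using homogeneous_system_solution[OF B(1) S(1), of "\<lambda>b \<sigma>. \<sigma> b"] S(3) B(2) by auto
  have "(\<Sum>\<sigma>\<in>S. c \<sigma> * \<sigma> x) = 0" for x
  proof -
    have "(\<Sum>\<sigma>\<in>S. c \<sigma> * \<sigma> x) = (\<Sum>\<sigma>\<in>S. c \<sigma> * (\<Sum>b\<in>B. of_rat (co b x) * \<sigma> b))"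
      using S(2) by (subst B(3)[of x], intro sum.cong)
        (auto simp: real_embeddings_def emb_sum emb_mult emb_of_rat)
    also have "\<dots> = (\<Sum>\<sigma>\<in>S. \<Sum>b\<in>B. of_rat (co b x) * (\<sigma> b * c \<sigma>))"
      by (simp add: sum_distrib_left algebra_simps)
    also have "\<dots> = (\<Sum>b\<in>B. of_rat (co b x) * (\<Sum>\<sigma>\<in>S. \<sigma> b * c \<sigma>))"
      by (subst sum.swap) (simp add: sum_distrib_left)
    also have "\<dots> = 0" using c(2) by simp
    finally show ?thesis .
  qed
  with embeddings_independent[OF S(1), of c] S(2) c(1) show False
    by (auto simp: real_embeddings_def)
qed

lemma finite_E: "finite E"
proof (rule ccontr)
  assume "infinite E"
  then obtain S where "S \<subseteq> E" "finite S" "card S = Suc (field_degree TYPE('k))"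
    using infinite_arbitrarily_large by metis
  with card_real_embeddings_le[of S] show False by simp
qed

lemma complex_embedding_real:
  fixes \<sigma> :: "'k \<Rightarrow> complex"
  assumes "field_embedding \<sigma>"
  shows "(\<lambda>x. Re (\<sigma> x)) \<in> E" "\<sigma> x = of_real (Re (\<sigma> x))"
proof -
  have *: "\<sigma> x = of_real (Re (\<sigma> x))" for x
    using totally_real assms unfolding totally_real_def
    by (metis of_real_Re rangeI subset_iff)
  show "\<sigma> x = of_real (Re (\<sigma> x))" by (rule *)
  have im: "Im (\<sigma> x) = 0" for x using * by (metis Im_complex_of_real)
  show "(\<lambda>x. Re (\<sigma> x)) \<in> E"
    using assms by (simp add: real_embeddings_def field_embedding_def im)
qed

text \<open>The real embeddings span the rational functionals, by taking real parts of the complex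
  expansion. The number of embeddings and the rationality of trace and norm all rest on this,
  without a primitive element.\<close>

lemma functional_sum_embeddings:
  fixes q :: "'k \<Rightarrow> rat"
  assumes "\<And>x y. q (x + y) = q x + q y" "\<And>r x. q (of_rat r * x) = r * q x"
  shows "\<exists>c. \<forall>x. of_rat (q x) = (\<Sum>\<sigma>\<in>E. c \<sigma> * \<sigma> x)"
proof -
  have "rat_linear (\<lambda>x. of_rat (q x))"
    using assms by (simp add: rat_linear_def of_rat_add of_rat_mult)
  then obtain cs :: "(complex \<times> ('k \<Rightarrow> complex)) list" where cs: "\<forall>(c, \<sigma>)\<in>set cs. field_embedding \<sigma>"
    "\<forall>x. of_rat (q x) = (\<Sum>(c, \<sigma>)\<leftarrow>cs. c * \<sigma> x)"
    using rat_linear_sum_embeddings[OF number_field] by blast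
  from cs(1) have "\<exists>c. \<forall>x. Re (\<Sum>(c, \<sigma>)\<leftarrow>cs. c * \<sigma> x) = (\<Sum>\<sigma>\<in>E. c \<sigma> * \<sigma> x)"
  proof (induction cs)
    case Nil
    show ?case by (intro exI[of _ "\<lambda>_. 0"]) simp
  next
    case (Cons p cs)
    obtain a \<tau> where p: "p = (a, \<tau>)" by force
    with Cons obtain c where c: "\<forall>x. Re (\<Sum>(c, \<sigma>)\<leftarrow>cs. c * \<sigma> x) = (\<Sum>\<sigma>\<in>E. c \<sigma> * \<sigma> x)" by auto
    define \<rho> where "\<rho> = (\<lambda>x. Re (\<tau> x))"
    have \<tau>: "field_embedding \<tau>" using Cons.prems p by simp
    have \<rho>: "\<rho> \<in> E" "\<And>x. \<tau> x = of_real (\<rho> x)"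
      using complex_embedding_real[OF \<tau>] by (simp_all add: \<rho>_def)
    define c' where "c' = (\<lambda>\<sigma>. c \<sigma> + (if \<sigma> = \<rho> then Re a else 0))"
    have "(\<Sum>\<sigma>\<in>E. c' \<sigma> * \<sigma> x) = (\<Sum>\<sigma>\<in>E. c \<sigma> * \<sigma> x) + (\<Sum>\<sigma>\<in>E. if \<sigma> = \<rho> then Re a * \<rho> x else 0)" for x
      unfolding sum.distrib[symmetric] by (intro sum.cong) (auto simp: c'_def distrib_right)
    also have "(\<Sum>\<sigma>\<in>E. c \<sigma> * \<sigma> x) + (\<Sum>\<sigma>\<in>E. if \<sigma> = \<rho> then Re a * \<rho> x else 0) =
        Re (\<Sum>(c, \<sigma>)\<leftarrow>p # cs. c * \<sigma> x)" for x
      using c \<rho> finite_E by (simp add: p)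
    finally have "\<forall>x. Re (\<Sum>(c, \<sigma>)\<leftarrow>p # cs. c * \<sigma> x) = (\<Sum>\<sigma>\<in>E. c' \<sigma> * \<sigma> x)" by simp
    then show ?case by blast
  qed
  then obtain c where c: "\<And>x. Re (\<Sum>(c, \<sigma>)\<leftarrow>cs. c * \<sigma> x) = (\<Sum>\<sigma>\<in>E. c \<sigma> * \<sigma> x)" by auto
  have "of_rat (q x) = Re (of_rat (q x))" for x
    by (cases "q x") (simp add: of_rat_rat)
  also have "Re (of_rat (q x)) = (\<Sum>\<sigma>\<in>E. c \<sigma> * \<sigma> x)" for x
    by (simp only: cs(2) c)
  finally show ?thesis by blast
qed

text \<open>If there were fewer embeddings than basis elements, a nonzero real vector
  \<open>y\<close> would be annihilated by all of them, hence by the coordinate functionals they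
  span, so each entry of \<open>y\<close> would be 0.\<close>

lemma card_E: "card E = field_degree TYPE('k)"
proof (rule antisym)
  show "card E \<le> field_degree TYPE('k)" by (rule card_real_embeddings_le[OF finite_E order.refl])
  show "field_degree TYPE('k) \<le> card E"
  proof (rule ccontr)
    assume less: "\<not> field_degree TYPE('k) \<le> card E"
    obtain B :: "'k set" and co where basis: "rational_basis B co"
    using ex_rational_basis[OF number_field] .
  note B = rational_basisD[OF basis]
    obtain y where y: "\<exists>b\<in>B. y b \<noteq> 0" "\<forall>\<sigma>\<in>E. (\<Sum>b\<in>B. \<sigma> b * y b) = 0"
      using homogeneous_system_solution[OF finite_E B(1), of "\<lambda>\<sigma> b. \<sigma> b"] less B(2) by auto
    then obtain b where b: "b \<in> B" "y b \<noteq> 0" by blast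
    obtain c where c: "\<And>x. of_rat (co b x) = (\<Sum>\<sigma>\<in>E. c \<sigma> * \<sigma> x)"
      using functional_sum_embeddings[of "co b"] B(4,5) by blast
    have "y b = (\<Sum>b'\<in>B. of_rat (co b b') * y b')"
    proof -
      have "(\<Sum>b'\<in>B. of_rat (co b b') * y b') = (\<Sum>b'\<in>B. if b' = b then y b' else 0)"
        using B(6) b(1) by (intro sum.cong) auto
      then show ?thesis using B(1) b(1) by simp
    qed
    also have "\<dots> = (\<Sum>b'\<in>B. \<Sum>\<sigma>\<in>E. c \<sigma> * (\<sigma> b' * y b'))"
      by (simp add: c sum_distrib_right mult.assoc)
    also have "\<dots> = (\<Sum>\<sigma>\<in>E. c \<sigma> * (\<Sum>b'\<in>B. \<sigma> b' * y b'))"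
      by (subst sum.swap) (simp add: sum_distrib_left)
    also have "\<dots> = 0" using y(2) by simp
    finally show False using b(2) by simp
  qed
qed

lemma card_E_pos: "card E > 0"
proof -
  obtain B :: "'k set" and co where basis: "rational_basis B co"
    using ex_rational_basis[OF number_field] .
  note B = rational_basisD[OF basis]
  have "B \<noteq> {}" using B(3)[of 1] by auto
  with B card_E show ?thesis by (metis card_gt_0_iff)
qed

lemma E_nonempty: "E \<noteq> {}"
  using card_E_pos by auto

text \<open>The sum of the conjugates is the trace of the rational matrix of multiplication by
  \<open>\<alpha>\<close>: the coefficients \<open>c b \<sigma>\<close> of the coordinate
  functionals form the inverse of the matrix of the values \<open>\<sigma> b\<close>.\<close>

lemma trace_rational: "(\<Sum>\<sigma>\<in>E. \<sigma> \<alpha>) \<in> \<rat>"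
proof -
  obtain B :: "'k set" and co where basis: "rational_basis B co"
    using ex_rational_basis[OF number_field] .
  note B = rational_basisD[OF basis]
  have "\<forall>b. \<exists>c. \<forall>x. of_rat (co b x) = (\<Sum>\<sigma>\<in>E. c \<sigma> * \<sigma> x)"
    by (intro allI functional_sum_embeddings B(4,5))
  then obtain c where c: "\<And>b x. of_rat (co b x) = (\<Sum>\<sigma>\<in>E. c b \<sigma> * \<sigma> x)" by metis
  \<comment> \<open>Writing \<open>\<tau>\<close> through the coordinates expresses it by all
    embeddings; independence permits comparing the coefficients of \<open>\<tau>\<close>
    itself.\<close>
  have one: "(\<Sum>b\<in>B. c b \<tau> * \<tau> b) = 1" if "\<tau> \<in> E" for \<tau>
  proof -
    define e where "e = (\<lambda>\<sigma>. (\<Sum>b\<in>B. c b \<sigma> * \<tau> b) - (if \<sigma> = \<tau> then 1 else 0))"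
    have "(\<Sum>\<sigma>\<in>E. e \<sigma> * \<sigma> x) = 0" for x
    proof -
      have "\<tau> x = (\<Sum>b\<in>B. of_rat (co b x) * \<tau> b)"
        using arg_cong[OF B(3), of \<tau> x]
        by (simp only: emb_sum[OF E_embedding[OF that]] emb_mult[OF E_embedding[OF that]]
            emb_of_rat[OF E_embedding[OF that]])
      also have "\<dots> = (\<Sum>b\<in>B. \<Sum>\<sigma>\<in>E. c b \<sigma> * \<tau> b * \<sigma> x)"
        by (simp only: c sum_distrib_right mult.assoc mult.commute[of "\<tau> _"])
      also have "\<dots> = (\<Sum>\<sigma>\<in>E. (\<Sum>b\<in>B. c b \<sigma> * \<tau> b) * \<sigma> x)"
        by (subst sum.swap) (simp add: sum_distrib_right)
      finally have "\<tau> x = (\<Sum>\<sigma>\<in>E. (\<Sum>b\<in>B. c b \<sigma> * \<tau> b) * \<sigma> x)" .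
      moreover have "(\<Sum>\<sigma>\<in>E. (if \<sigma> = \<tau> then 1 else 0) * \<sigma> x) = (\<Sum>\<sigma>\<in>E. if \<sigma> = \<tau> then \<tau> x else 0)"
        by (intro sum.cong) auto
      moreover have "(\<Sum>\<sigma>\<in>E. if \<sigma> = \<tau> then \<tau> x else 0) = \<tau> x" using that finite_E by simp
      moreover have "(\<Sum>\<sigma>\<in>E. e \<sigma> * \<sigma> x) = (\<Sum>\<sigma>\<in>E. (\<Sum>b\<in>B. c b \<sigma> * \<tau> b) * \<sigma> x) -
          (\<Sum>\<sigma>\<in>E. (if \<sigma> = \<tau> then 1 else 0) * \<sigma> x)"
        by (simp only: e_def left_diff_distrib sum_subtractf)
      ultimately show ?thesis by linarith
    qed
    from embeddings_independent[OF finite_E _ this that] have "e \<tau> = 0"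
      using E_embedding by blast
    then show ?thesis by (simp add: e_def)
  qed
  have "(\<Sum>b\<in>B. of_rat (co b (\<alpha> * b))) = (\<Sum>b\<in>B. \<Sum>\<sigma>\<in>E. c b \<sigma> * (\<sigma> \<alpha> * \<sigma> b))"
    unfolding c by (intro sum.cong refl arg_cong2[of _ _ _ _ "(*)"] emb_mult E_embedding)
  also have "\<dots> = (\<Sum>\<sigma>\<in>E. \<sigma> \<alpha> * (\<Sum>b\<in>B. c b \<sigma> * \<sigma> b))"
    by (subst sum.swap) (simp add: sum_distrib_left algebra_simps)
  also have "\<dots> = (\<Sum>\<sigma>\<in>E. \<sigma> \<alpha>)" using one by simp
  finally have "(\<Sum>\<sigma>\<in>E. \<sigma> \<alpha>) = (\<Sum>b\<in>B. of_rat (co b (\<alpha> * b)))" by simp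
  also have "\<dots> \<in> \<rat>" by (intro Rats_sum) simp
  finally show ?thesis .
qed

lemma field_norm_alt: "field_norm (\<alpha>::'k) = (\<Prod>\<sigma>\<in>E. \<sigma> \<alpha>)"
  by (simp add: field_norm_def real_embeddings_def)

text \<open>
  The norm is the determinant of multiplication by \<open>\<alpha>\<close>: with \<open>S = (\<sigma> b)\<close> and \<open>D\<close> the diagonal
  matrix of the conjugates of \<open>\<alpha>\<close>, the matrix \<open>M\<close> of multiplication satisfies \<open>S M = D S\<close>.
\<close>

lemma field_norm_rational: "field_norm (\<alpha>::'k) \<in> \<rat>"
proof -
  obtain B :: "'k set" and co where basis: "rational_basis B co"
    using ex_rational_basis[OF number_field] .
  note B = rational_basisD[OF basis]
  define n where "n = field_degree TYPE('k)"
  obtain h where h: "bij_betw h {..<n} B"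
    using ex_bij_betw_nat_finite[OF B(1)] B(2) by (auto simp: n_def atLeast0LessThan)
  obtain s where s: "bij_betw s {..<n} E"
    using ex_bij_betw_nat_finite[OF finite_E] card_E by (auto simp: n_def atLeast0LessThan)
  have hB: "h i \<in> B" if "i < n" for i using h that by (auto simp: bij_betw_def)
  have sE: "field_embedding (s i)" if "i < n" for i
    using s that E_embedding by (auto simp: bij_betw_def)
  define M where "M = mat n n (\<lambda>(i, j). co (h i) (\<alpha> * h j))"
  define R :: "real mat" where "R = map_mat of_rat M"
  define S where "S = mat n n (\<lambda>(i, j). s i (h j))"
  define D where "D = mat n n (\<lambda>(i, j). if i = j then s i \<alpha> else 0)"
  have carrier: "M \<in> carrier_mat n n" "R \<in> carrier_mat n n" "S \<in> carrier_mat n n" "D \<in> carrier_mat n n"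
    by (simp_all add: M_def R_def S_def D_def)
  have co_sum: "x = (\<Sum>i<n. of_rat (co (h i) x) * h i)" for x
    by (rule trans[OF B(3) sum.reindex_bij_betw[OF h, symmetric]])
  have "S * R = D * S"
  proof (rule eq_matI)
    fix i j assume "i < dim_row (D * S)" "j < dim_col (D * S)"
    then have ij: "i < n" "j < n" using carrier by auto
    have "(S * R) $$ (i, j) = (\<Sum>k<n. s i (h k) * of_rat (co (h k) (\<alpha> * h j)))"
      using ij by (simp add: S_def R_def M_def scalar_prod_def atLeast0LessThan)
    also have "\<dots> = s i (\<alpha> * h j)"
      using arg_cong[OF co_sum, of "s i" "\<alpha> * h j"]
      by (simp add: emb_sum[OF sE] emb_mult[OF sE] emb_of_rat[OF sE] ij mult.commute del: mult_cancel_left mult_cancel_right)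
    also have "\<dots> = (\<Sum>k<n. if k = i then s i \<alpha> * s k (h j) else 0)"
      using ij by (simp add: emb_mult sE)
    also have "\<dots> = (D * S) $$ (i, j)"
      using ij by (simp add: S_def D_def scalar_prod_def atLeast0LessThan if_distrib[of "\<lambda>t. t * _"] cong: if_cong)
    finally show "(S * R) $$ (i, j) = (D * S) $$ (i, j)" .
  qed (use carrier in auto)
  then have "det S * det R = det D * det S" using det_mult[OF carrier(3,2)] det_mult[OF carrier(4,3)] by metis
  \<comment> \<open>As in \<open>card_E\<close>, a kernel vector is annihilated by all embeddings
    and therefore by every coordinate functional.\<close>
  moreover have "det S \<noteq> 0"
  proof
    assume "det S = 0"
    then obtain v where v: "v \<in> carrier_vec n" "v \<noteq> 0\<^sub>v n" "S *\<^sub>v v = 0\<^sub>v n"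
      using det_0_iff_vec_prod_zero_field[OF carrier(3)] by blast
    have z: "(\<Sum>j<n. s i (h j) * v $ j) = 0" if "i < n" for i
    proof -
      have "(\<Sum>j<n. s i (h j) * v $ j) = (S *\<^sub>v v) $ i"
        using that v(1) by (simp add: S_def scalar_prod_def atLeast0LessThan)
      then show ?thesis using that v(3) by simp
    qed
    obtain k where k: "k < n" "v $ k \<noteq> 0" using v(1,2) by (metis carrier_vecD eq_vecI index_zero_vec)
    obtain c where c: "\<And>x. of_rat (co (h k) x) = (\<Sum>\<sigma>\<in>E. c \<sigma> * \<sigma> x)"
      using functional_sum_embeddings[of "co (h k)"] B(4,5) by blast
    have inj: "h k = h j \<longleftrightarrow> j = k" if "j < n" for j
      using h that k(1) by (auto simp: bij_betw_def inj_on_def)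
    have "v $ k = (\<Sum>j<n. of_rat (co (h k) (h j)) * v $ j)"
    proof -
      have "(\<Sum>j<n. of_rat (co (h k) (h j)) * v $ j) = (\<Sum>j<n. if j = k then v $ j else 0)"
        using inj by (intro sum.cong) (auto simp: B(6)[OF hB hB] k(1))
      then show ?thesis using k(1) by simp
    qed
    also have "\<dots> = (\<Sum>j<n. \<Sum>i<n. c (s i) * (s i (h j) * v $ j))"
      unfolding c sum.reindex_bij_betw[OF s, symmetric] by (simp add: sum_distrib_right mult.assoc)
    also have "\<dots> = (\<Sum>i<n. c (s i) * (\<Sum>j<n. s i (h j) * v $ j))"
      by (subst sum.swap) (simp add: sum_distrib_left)
    also have "\<dots> = 0" using z by simp
    finally show False using k(2) by simp
  qed
  ultimately have "det R = det D" by simp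
  also have "det D = prod_list (diag_mat D)"
    by (rule det_upper_triangular[OF _ carrier(4)]) (auto simp: D_def)
  also have "\<dots> = (\<Prod>i<n. s i \<alpha>)"
    using carrier(4) by (simp add: diag_mat_def D_def prod.list_conv_set_nth atLeast0LessThan)
  also have "\<dots> = field_norm \<alpha>"
    unfolding field_norm_alt by (rule prod.reindex_bij_betw[OF s])
  finally have "field_norm \<alpha> = of_rat (det M)"
    unfolding R_def by (simp add: of_rat_hom.hom_det)
  then show ?thesis by simp
qed

end

section \<open>Integers of the field: denominators, norms and units\<close>

lemma algebraic_int_monic_relation:
  fixes x :: "'a::field_char_0"
  assumes "x ^ n = (\<Sum>i<n. of_int (c i) * x ^ i)"
  shows "algebraic_int x"
proof -
  define p where "p = Polynomial.monom 1 n - (\<Sum>i<n. Polynomial.monom (c i) i)"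
  have coeff: "poly.coeff p i = (if i = n then 1 else if i < n then - c i else 0)" for i
    by (simp add: p_def coeff_sum)
  have "degree p \<le> n" by (rule degree_le) (simp add: coeff)
  moreover have "n \<le> degree p" by (rule le_degree) (simp add: coeff)
  ultimately have "lead_coeff p = 1" by (simp add: coeff)
  moreover have "poly (map_poly of_int p) x = 0"
    using assms by (simp add: p_def of_int_poly_hom.hom_minus of_int_poly_hom.hom_sum poly_sum poly_monom)
  ultimately show ?thesis unfolding algebraic_int_altdef_ipoly by blast
qed

text \<open>The leading coefficient \<open>a\<close> clears the denominator: multiplying the
  equation of \<open>x\<close> by \<open>a ^ (n - 1)\<close> makes it monic in
  \<open>a * x\<close>.\<close>

lemma algebraic_int_multiple:
  fixes x :: "'a::field_char_0"
  assumes "algebraic x"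
  obtains m :: nat where "m > 0" "algebraic_int (of_nat m * x)"
proof -
  obtain p :: "int poly" where p: "poly (map_poly of_int p) x = 0" "p \<noteq> 0"
    using algebraicE'[OF assms] by blast
  define n where "n = degree p"
  define a where "a = lead_coeff p"
  have "a \<noteq> 0" using p(2) by (simp add: a_def)
  have "n > 0"
  proof (rule ccontr)
    assume "\<not> n > 0"
    then obtain b where "p = [:b:]" unfolding n_def by (metis degree_eq_zeroE gr0I)
    with p show False by simp
  qed
  have "0 = (\<Sum>i\<le>n. of_int (poly.coeff p i) * x ^ i)"
    using p(1) by (simp add: poly_altdef n_def)
  then have rel: "of_int a * x ^ n = - (\<Sum>i<n. of_int (poly.coeff p i) * x ^ i)"
    by (simp add: a_def n_def eq_neg_iff_add_eq_0 add.commute flip: lessThan_Suc_atMost)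
  have "(of_int a * x) ^ n = of_int a ^ (n - 1) * (of_int a * x ^ n)"
    using \<open>n > 0\<close> by (cases n) (simp_all add: power_mult_distrib algebra_simps)
  also have "\<dots> = (\<Sum>i<n. of_int (- poly.coeff p i) * (of_int a ^ (n - 1) * x ^ i))"
    unfolding rel by (simp add: sum_distrib_left sum_negf algebra_simps)
  also have "\<dots> = (\<Sum>i<n. of_int (- poly.coeff p i * a ^ (n - 1 - i)) * (of_int a * x) ^ i)"
  proof (rule sum.cong)
    fix i assume "i \<in> {..<n}"
    then have "of_int a ^ (n - 1) = (of_int a :: 'a) ^ (n - 1 - i) * of_int a ^ i"
      by (simp flip: power_add)
    then show "of_int (- poly.coeff p i) * (of_int a ^ (n - 1) * x ^ i) =
        of_int (- poly.coeff p i * a ^ (n - 1 - i)) * (of_int a * x) ^ i"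
      by (simp add: power_mult_distrib algebra_simps)
  qed simp
  finally have *: "algebraic_int (of_int a * x)" by (rule algebraic_int_monic_relation)
  show ?thesis
  proof (rule that[of "nat \<bar>a\<bar>"])
    show "algebraic_int (of_nat (nat \<bar>a\<bar>) * x)"
    proof (cases "a \<ge> 0")
      case False
      then have "of_nat (nat \<bar>a\<bar>) * x = - (of_int a * x)" by simp
      with * show ?thesis by (simp only: algebraic_int_minus_iff)
    qed (use * in simp)
  qed (use \<open>a \<noteq> 0\<close> in simp)
qed

context totally_real_field
begin

lemma totally_positive_alt: "totally_positive \<alpha> \<longleftrightarrow> (\<forall>\<sigma>\<in>E. \<sigma> (\<alpha>::'k) > 0)"
  by (simp add: totally_positive_def real_embeddings_def)

lemma E_eq_0_iff: "\<sigma> \<in> E \<Longrightarrow> \<sigma> x = 0 \<longleftrightarrow> x = 0"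
  using emb_eq_0_iff[OF E_embedding] .

lemma norm_mult: "field_norm (x * y :: 'k) = field_norm x * field_norm y"
  unfolding field_norm_alt by (simp add: emb_mult[OF E_embedding] flip: prod.distrib)

lemma norm_1: "field_norm (1 :: 'k) = 1"
  unfolding field_norm_alt by (intro prod.neutral ballI emb_1 E_embedding)

lemma norm_of_int: "field_norm (of_int n :: 'k) = of_int n ^ card E"
proof -
  have "field_norm (of_int n :: 'k) = (\<Prod>\<sigma>\<in>E. of_int n)"
    unfolding field_norm_alt by (intro prod.cong refl emb_of_int E_embedding)
  then show ?thesis by simp
qed

lemma norm_eq_0_iff: "field_norm (x :: 'k) = 0 \<longleftrightarrow> x = 0"
  unfolding field_norm_alt using finite_E E_nonempty E_eq_0_iff by auto

lemma norm_pos: "totally_positive (x :: 'k) \<Longrightarrow> field_norm x > 0"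
  unfolding field_norm_alt totally_positive_alt by (intro prod_pos) auto

lemma norm_int:
  assumes "algebraic_int (x :: 'k)"
  obtains n :: int where "field_norm x = of_int n"
proof -
  have "algebraic_int (field_norm x)"
    unfolding field_norm_alt using assms
    by (intro algebraic_int_prod) (simp add: algebraic_int_emb_iff E_embedding)
  with field_norm_rational[of x] have "field_norm x \<in> \<int>"
    by (intro rational_algebraic_int_is_int)
  then show ?thesis using that by (auto elim: Ints_cases)
qed

lemma norm_ge_1:
  assumes "algebraic_int (x :: 'k)" "x \<noteq> 0"
  shows "\<bar>field_norm x\<bar> \<ge> 1"
proof -
  obtain n :: int where n: "field_norm x = of_int n" using norm_int[OF assms(1)] .
  with assms(2) have "n \<noteq> 0" using norm_eq_0_iff[of x] by auto
  then show ?thesis unfolding n by (simp flip: of_int_abs)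
qed

text \<open>Otherwise the norm would be a nonzero integer below 1 in absolute value. A strict
  inequality at a single embedding is enough.\<close>

lemma conjugates_small_imp_0:
  assumes "algebraic_int (x :: 'k)" "\<And>\<sigma>. \<sigma> \<in> E \<Longrightarrow> \<bar>\<sigma> x\<bar> \<le> 1" "\<tau> \<in> E" "\<bar>\<tau> x\<bar> < 1"
  shows "x = 0"
proof (rule ccontr)
  assume "x \<noteq> 0"
  have "\<bar>field_norm x\<bar> = (\<Prod>\<sigma>\<in>E. \<bar>\<sigma> x\<bar>)" by (simp add: field_norm_alt abs_prod)
  also have "\<dots> = \<bar>\<tau> x\<bar> * (\<Prod>\<sigma>\<in>E - {\<tau>}. \<bar>\<sigma> x\<bar>)" using finite_E assms(3) by (simp add: prod.remove)
  also have "\<dots> \<le> \<bar>\<tau> x\<bar> * 1"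
    using assms(2) by (intro mult_left_mono prod_le_1) auto
  also have "\<dots> < 1" using assms(4) by simp
  finally show False using norm_ge_1[OF assms(1) \<open>x \<noteq> 0\<close>] by simp
qed

text \<open>Two integers in the same cell of a grid on the conjugates differ by an integer whose
  conjugates are all below 1, that is by 0; only finitely many cells meet the bounded
  region.\<close>

lemma finite_bounded_conjugates: "finite {x :: 'k. algebraic_int x \<and> (\<forall>\<sigma>\<in>E. \<bar>\<sigma> x\<bar> \<le> H)}" (is "finite ?X")
proof (rule inj_on_finite)
  let ?f = "\<lambda>x. \<lambda>\<sigma>\<in>E. \<lfloor>2 * \<sigma> x\<rfloor>"
  show "inj_on ?f ?X"
  proof (rule inj_onI)
    fix x y assume xy: "x \<in> ?X" "y \<in> ?X" "?f x = ?f y"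
    have *: "\<bar>\<sigma> (x - y)\<bar> < 1" if "\<sigma> \<in> E" for \<sigma>
    proof -
      have "\<lfloor>2 * \<sigma> x\<rfloor> = \<lfloor>2 * \<sigma> y\<rfloor>" using fun_cong[OF xy(3), of \<sigma>] that by simp
      then have "\<bar>2 * \<sigma> x - 2 * \<sigma> y\<bar> < 1" by linarith
      then show ?thesis by (simp add: emb_diff[OF E_embedding[OF that]])
    qed
    obtain \<tau> where "\<tau> \<in> E" using E_nonempty by blast
    then have "x - y = 0"
      using xy(1,2) * by (intro conjugates_small_imp_0[of "x - y" \<tau>] algebraic_int_diff less_imp_le) auto
    then show "x = y" by simp
  qed
  show "?f ` ?X \<subseteq> (\<Pi>\<^sub>E \<sigma>\<in>E. {\<lfloor>- 2 * H\<rfloor>..\<lfloor>2 * H\<rfloor>})"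
  proof (rule image_subsetI)
    fix x assume x: "x \<in> ?X"
    have "\<lfloor>2 * \<sigma> x\<rfloor> \<in> {\<lfloor>- 2 * H\<rfloor>..\<lfloor>2 * H\<rfloor>}" if "\<sigma> \<in> E" for \<sigma>
    proof -
      have "\<bar>\<sigma> x\<bar> \<le> H" using x that by auto
      then show ?thesis by (auto intro!: floor_mono)
    qed
    then show "?f x \<in> (\<Pi>\<^sub>E \<sigma>\<in>E. {\<lfloor>- 2 * H\<rfloor>..\<lfloor>2 * H\<rfloor>})" by (simp only: restrict_PiE_iff) blast
  qed
  show "finite (\<Pi>\<^sub>E \<sigma>\<in>E. {\<lfloor>- 2 * H\<rfloor>..\<lfloor>2 * H\<rfloor>})" using finite_E by (intro finite_PiE) auto
qed

text \<open>The quotient of the norm by \<open>x\<close> lies in the field, and an embedding sends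
  it to the product of the other conjugates of \<open>x\<close>, which is integral.\<close>

lemma cofactor:
  assumes "algebraic_int (x :: 'k)" "field_norm x = of_int n"
  obtains y where "algebraic_int y" "x * y = of_int n"
proof (cases "x = 0")
  case True
  with assms(2) norm_eq_0_iff[of x] have "n = 0" by auto
  with True show ?thesis by (intro that[of 0]) auto
next
  case False
  define y where "y = of_int n / x"
  have "algebraic_int y"
  proof -
    obtain \<sigma> where \<sigma>: "\<sigma> \<in> E" using E_nonempty by blast
    have "\<sigma> y = (\<Prod>\<tau>\<in>E. \<tau> x) / \<sigma> x"
      using assms(2) by (simp add: y_def field_norm_alt emb_divide[OF E_embedding[OF \<sigma>]] emb_of_int[OF E_embedding[OF \<sigma>]])
    also have "\<dots> = (\<Prod>\<tau>\<in>E - {\<sigma>}. \<tau> x)"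
      using \<sigma> finite_E False by (simp add: prod.remove E_eq_0_iff)
    finally have "\<sigma> y = \<dots>" .
    moreover have "algebraic_int (\<Prod>\<tau>\<in>E - {\<sigma>}. \<tau> x)"
      using assms(1) by (intro algebraic_int_prod) (auto simp: algebraic_int_emb_iff E_embedding)
    ultimately show ?thesis using algebraic_int_emb_iff[OF E_embedding[OF \<sigma>], of y] by simp
  qed
  with False show ?thesis by (intro that[of y]) (auto simp: y_def)
qed

text \<open>An elementwise form of membership in \<open>Units ring_of_integers\<close>; the two are
  identified in \<open>Units_ring_of_integers\<close>.\<close>

definition int_unit :: "'k \<Rightarrow> bool" where
  "int_unit u \<longleftrightarrow> u \<noteq> 0 \<and> algebraic_int u \<and> algebraic_int (inverse u)"

lemma int_unit_mult: "int_unit u \<Longrightarrow> int_unit v \<Longrightarrow> int_unit (u * v)"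
  by (auto simp: int_unit_def intro: algebraic_int_times)

lemma int_unit_inverse: "int_unit u \<Longrightarrow> int_unit (inverse u)"
  by (auto simp: int_unit_def)

lemma int_unit_1: "int_unit 1"
  by (simp add: int_unit_def)

lemma int_unit_minus: "int_unit u \<Longrightarrow> int_unit (- u)"
  by (simp add: int_unit_def)

lemma int_unit_divide: "int_unit u \<Longrightarrow> int_unit v \<Longrightarrow> int_unit (u / v)"
  by (simp add: divide_inverse int_unit_mult int_unit_inverse)

lemma int_unit_prod: "(\<And>i. i \<in> A \<Longrightarrow> int_unit (f i)) \<Longrightarrow> int_unit (prod f A)"
  by (induction A rule: infinite_finite_induct) (auto simp: int_unit_1 int_unit_mult)

lemma int_unit_iff_norm:
  "int_unit u \<longleftrightarrow> algebraic_int u \<and> \<bar>field_norm u\<bar> = 1"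
proof (safe)
  assume u: "int_unit u"
  then show "algebraic_int u" by (simp add: int_unit_def)
  have "\<bar>field_norm u\<bar> \<ge> 1" "\<bar>field_norm (inverse u)\<bar> \<ge> 1"
    using u by (auto simp: int_unit_def intro!: norm_ge_1)
  moreover have "\<bar>field_norm u\<bar> * \<bar>field_norm (inverse u)\<bar> = 1"
    using u by (simp add: int_unit_def norm_1 flip: abs_mult norm_mult)
  ultimately show "\<bar>field_norm u\<bar> = 1"
    by (metis antisym mult.commute mult_cancel_right1 mult_left_mono abs_ge_zero mult_1_right)
next
  assume u: "algebraic_int u" "\<bar>field_norm u\<bar> = 1"
  obtain n :: int where n: "field_norm u = of_int n" using norm_int[OF u(1)] .
  obtain y where y: "algebraic_int y" "u * y = of_int n" using cofactor[OF u(1) n] .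
  from u(2) n have "\<bar>n\<bar> = 1" by (metis of_int_abs of_int_eq_1_iff)
  then have "n * n = 1" by (metis abs_mult_self_eq mult_1)
  then have "u * (of_int n * y) = 1" using y(2)
    by (metis mult.left_commute of_int_1 of_int_mult)
  then have "inverse u = of_int n * y" by (rule inverse_unique)
  moreover have "algebraic_int (of_int n * y)" using y(1) by (intro algebraic_int_times) auto
  moreover have "u \<noteq> 0" using u(2) norm_eq_0_iff[of u] by auto
  ultimately show "int_unit u" using u(1) by (simp add: int_unit_def)
qed

text \<open>Not a basis of the ring of integers: clearing denominators in a rational basis gives
  independent integers in the right number, which suffices for counting.\<close>

lemma integral_basis:
  obtains B :: "'k set" and w :: "'k \<Rightarrow> 'k" where "finite B" "card B = card E" "\<And>b. b \<in> B \<Longrightarrow> algebraic_int (w b)"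
    "\<And>f :: 'k \<Rightarrow> int. (\<Sum>b\<in>B. of_int (f b) * w b) = 0 \<Longrightarrow> \<forall>b\<in>B. f b = 0"
proof -
  obtain B :: "'k set" and co where basis: "rational_basis B co"
    using ex_rational_basis[OF number_field] .
  note B = rational_basisD[OF basis]
  have "\<exists>m::nat. m > 0 \<and> algebraic_int (of_nat m * b)" for b :: 'k
  proof -
    obtain p :: "rat poly" where "p \<noteq> 0" "poly (map_poly of_rat p) b = 0"
      using rational_algebraic[OF number_field] .
    then have "algebraic b"
      unfolding algebraic_altdef by (intro exI[of _ "map_poly of_rat p"]) auto
    then show ?thesis using algebraic_int_multiple by metis
  qed
  then obtain m :: "'k \<Rightarrow> nat" where m: "\<And>b. m b > 0" "\<And>b. algebraic_int (of_nat (m b) * b)" by metis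
  show ?thesis
  proof (rule that[of B "\<lambda>b. of_nat (m b) * b"])
    fix f :: "'k \<Rightarrow> int" assume f: "(\<Sum>b\<in>B. of_int (f b) * (of_nat (m b) * b)) = 0"
    show "\<forall>b\<in>B. f b = 0"
    proof
      fix a assume a: "a \<in> B"
      have co0: "co a 0 = 0" using B(4)[of a 0 0] by simp
      have co_sum: "co a (\<Sum>b\<in>A. g b) = (\<Sum>b\<in>A. co a (g b))" if "finite A" for A and g :: "'k \<Rightarrow> 'k"
        using that by (induction A rule: finite_induct) (simp_all add: B(4) co0)
      have "0 = co a (\<Sum>b\<in>B. of_rat (of_int (f b) * of_nat (m b)) * b)"
        using f co0 by (simp add: of_rat_mult mult.assoc)
      also have "\<dots> = (\<Sum>b\<in>B. co a (of_rat (of_int (f b) * of_nat (m b)) * b))"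
        by (rule co_sum[OF B(1)])
      also have "\<dots> = (\<Sum>b\<in>B. if b = a then of_int (f b) * of_nat (m b) else 0)"
        unfolding B(5) using B(6)[OF a] by (intro sum.cong) auto
      also have "\<dots> = of_int (f a) * of_nat (m a)" using a B(1) by simp
      finally show "f a = 0" using m(1)[of a] by simp
    qed
  qed (use B(1,2) card_E m(2) in auto)
qed

end

section \<open>Units and their signatures\<close>

context totally_real_field
begin

text \<open>
  Pigeonhole in place of Minkowski's theorem: the integral combinations with coefficients in
  \<open>{0..M}\<close> outnumber the boxes of shape \<open>l\<close> needed to cover their conjugates.
\<close>

lemma small_conjugates:
  fixes B :: "'k set" and w :: "'k \<Rightarrow> 'k"
  assumes B: "finite B" "card B = card E"
    and indep: "\<And>f :: 'k \<Rightarrow> int. (\<Sum>b\<in>B. of_int (f b) * w b) = 0 \<Longrightarrow> \<forall>b\<in>B. f b = 0"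
  obtains C :: real where "C > 0" "\<And>l. (\<And>\<sigma>. \<sigma> \<in> E \<Longrightarrow> l \<sigma> > 0) \<Longrightarrow> (\<Prod>\<sigma>\<in>E. l \<sigma>) \<ge> C \<Longrightarrow>
    \<exists>f :: 'k \<Rightarrow> int. (\<Sum>b\<in>B. of_int (f b) * w b) \<noteq> 0 \<and> (\<forall>\<sigma>\<in>E. \<bar>\<sigma> (\<Sum>b\<in>B. of_int (f b) * w b)\<bar> < l \<sigma>)"
proof -
  define x where "x = (\<lambda>f :: 'k \<Rightarrow> int. \<Sum>b\<in>B. of_int (f b) * w b)"
  define R where "R = 1 + (\<Sum>\<sigma>\<in>E. \<Sum>b\<in>B. \<bar>\<sigma> (w b)\<bar>)"
  have R: "R > 0" unfolding R_def by (intro add_pos_nonneg sum_nonneg) auto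
  have R_bound: "(\<Sum>b\<in>B. \<bar>\<sigma> (w b)\<bar>) \<le> R" if "\<sigma> \<in> E" for \<sigma>
  proof -
    have "(\<Sum>b\<in>B. \<bar>\<sigma> (w b)\<bar>) \<le> (\<Sum>\<sigma>\<in>E. \<Sum>b\<in>B. \<bar>\<sigma> (w b)\<bar>)"
      using member_le_sum[OF that, of "\<lambda>\<sigma>. \<Sum>b\<in>B. \<bar>\<sigma> (w b)\<bar>"] finite_E by (simp add: sum_nonneg)
    then show ?thesis by (simp add: R_def)
  qed
  have x_bound: "\<bar>\<sigma> (x f)\<bar> \<le> R * M" if "\<sigma> \<in> E" "\<forall>b\<in>B. \<bar>f b\<bar> \<le> M" "M \<ge> 0" for \<sigma> f and M :: int
  proof -
    have "\<sigma> (x f) = (\<Sum>b\<in>B. of_int (f b) * \<sigma> (w b))"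
      using E_embedding[OF that(1)] by (simp only: x_def emb_sum emb_mult emb_of_int)
    also have "\<bar>\<dots>\<bar> \<le> (\<Sum>b\<in>B. \<bar>of_int (f b) * \<sigma> (w b)\<bar>)" by (rule sum_abs)
    also have "\<dots> \<le> (\<Sum>b\<in>B. of_int M * \<bar>\<sigma> (w b)\<bar>)"
      using that(2) by (intro sum_mono) (auto simp: abs_mult intro!: mult_right_mono simp flip: of_int_abs)
    also have "\<dots> = of_int M * (\<Sum>b\<in>B. \<bar>\<sigma> (w b)\<bar>)" by (simp add: sum_distrib_left)
    also have "\<dots> \<le> of_int M * R" using R_bound[OF that(1)] that(3) by (intro mult_left_mono) auto
    finally show ?thesis by (simp add: mult.commute)
  qed
  have x_diff: "x f - x g = x (\<lambda>b. f b - g b)" for f g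
    by (simp add: x_def sum_subtractf left_diff_distrib)
  \<comment> \<open>A conjugate lies in an interval of length \<open>2 * R * M\<close>. With
    \<open>t = R * M / l \<sigma> \<ge> 1\<close> it falls into at most
    \<open>2 * t + 2 \<le> 4 * t\<close> cells, so for product of the \<open>l \<sigma>\<close> at
    least \<open>C\<close> there are at most \<open>M ^ card E\<close> boxes for
    \<open>(M + 1) ^ card E\<close> combinations.\<close>
  define C where "C = (4 * R) ^ card E"
  show ?thesis
  proof (rule that)
    show "C > 0" using R by (simp add: C_def)
    fix l :: "('k \<Rightarrow> real) \<Rightarrow> real"
    assume l: "\<And>\<sigma>. \<sigma> \<in> E \<Longrightarrow> l \<sigma> > 0" "(\<Prod>\<sigma>\<in>E. l \<sigma>) \<ge> C"
    obtain M :: nat where M: "real M \<ge> 1 + (\<Sum>\<sigma>\<in>E. l \<sigma> / R)" using real_arch_simple by blast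
    have sum0: "(\<Sum>\<sigma>\<in>E. l \<sigma> / R) \<ge> 0" using l(1) R by (intro sum_nonneg) (simp add: less_imp_le)
    with M have M1: "M \<ge> 1" by linarith
    have M_ge: "R * M / l \<sigma> \<ge> 1" if "\<sigma> \<in> E" for \<sigma>
    proof -
      have "l \<sigma> / R \<le> (\<Sum>\<sigma>\<in>E. l \<sigma> / R)"
        using member_le_sum[OF that, of "\<lambda>\<sigma>. l \<sigma> / R"] finite_E l(1) R by (simp add: less_imp_le)
      with M have "l \<sigma> / R \<le> M" by linarith
      then show ?thesis using l(1)[OF that] R by (simp add: field_simps)
    qed
    define F where "F = (\<Pi>\<^sub>E b\<in>B. {0..int M})"
    define box where "box = (\<lambda>\<sigma>. {\<lfloor>- (R * M / l \<sigma>)\<rfloor>..\<lfloor>R * M / l \<sigma>\<rfloor>})"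
    define cell where "cell = (\<lambda>f. \<lambda>\<sigma>\<in>E. \<lfloor>\<sigma> (x f) / l \<sigma>\<rfloor>)"
    have "cell f \<in> (\<Pi>\<^sub>E \<sigma>\<in>E. box \<sigma>)" if "f \<in> F" for f
    proof -
      have "\<lfloor>\<sigma> (x f) / l \<sigma>\<rfloor> \<in> box \<sigma>" if "\<sigma> \<in> E" for \<sigma>
      proof -
        have "\<bar>\<sigma> (x f)\<bar> \<le> R * int M"
          using \<open>f \<in> F\<close> by (intro x_bound that) (auto simp: F_def PiE_iff)
        then have "\<sigma> (x f) / l \<sigma> \<le> R * M / l \<sigma>" "- (R * M / l \<sigma>) \<le> \<sigma> (x f) / l \<sigma>"
          using l(1)[OF that] by (auto simp: field_simps)
        then show ?thesis by (auto simp: box_def intro!: floor_mono)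
      qed
      then show ?thesis unfolding cell_def by (simp only: restrict_PiE_iff) blast
    qed
    then have into: "cell ` F \<subseteq> (\<Pi>\<^sub>E \<sigma>\<in>E. box \<sigma>)" by blast
    have "real (card (\<Pi>\<^sub>E \<sigma>\<in>E. box \<sigma>)) = (\<Prod>\<sigma>\<in>E. real (card (box \<sigma>)))"
      using finite_E by (simp add: card_PiE)
    also have "\<dots> \<le> (\<Prod>\<sigma>\<in>E. 4 * (R * M / l \<sigma>))"
    proof (intro prod_mono conjI)
      fix \<sigma> assume "\<sigma> \<in> E"
      have "real (card (box \<sigma>)) = real (nat (\<lfloor>R * M / l \<sigma>\<rfloor> - \<lfloor>- (R * M / l \<sigma>)\<rfloor> + 1))"
        by (simp add: box_def)
      then show "real (card (box \<sigma>)) \<le> 4 * (R * M / l \<sigma>)" using M_ge[OF \<open>\<sigma> \<in> E\<close>] by linarith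
    qed simp
    also have "\<dots> = (4 * R * M) ^ card E / (\<Prod>\<sigma>\<in>E. l \<sigma>)" by (simp add: prod_dividef mult.assoc)
    also have "\<dots> \<le> (4 * R * M) ^ card E / C"
      using l(2) R \<open>C > 0\<close> by (intro divide_left_mono mult_pos_pos zero_le_power) auto
    also have "\<dots> = real (M ^ card E)" using R by (simp add: C_def power_mult_distrib)
    finally have "card (\<Pi>\<^sub>E \<sigma>\<in>E. box \<sigma>) \<le> M ^ card E" by linarith
    also have "\<dots> < (M + 1) ^ card E" using card_E_pos by (intro power_strict_mono) auto
    also have "\<dots> = card F" using B by (simp add: F_def card_PiE nat_add_distrib)
    finally have less: "card (\<Pi>\<^sub>E \<sigma>\<in>E. box \<sigma>) < card F" .
    moreover have "finite (\<Pi>\<^sub>E \<sigma>\<in>E. box \<sigma>)" using finite_E by (intro finite_PiE) (auto simp: box_def)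
    ultimately have "\<not> inj_on cell F" using into by (meson card_inj_on_le not_less)
    then obtain f g where fg: "f \<in> F" "g \<in> F" "f \<noteq> g" "cell f = cell g" by (auto simp: inj_on_def)
    define h where "h = (\<lambda>b. f b - g b)"
    have "x h \<noteq> 0"
    proof
      assume "x h = 0"
      then have "\<forall>b\<in>B. h b = 0" using indep[of h] by (simp add: x_def)
      then have "f = g" using fg(1,2) unfolding F_def h_def by (intro PiE_ext) auto
      with fg(3) show False by simp
    qed
    moreover have "\<bar>\<sigma> (x h)\<bar> < l \<sigma>" if "\<sigma> \<in> E" for \<sigma>
    proof -
      have "\<lfloor>\<sigma> (x f) / l \<sigma>\<rfloor> = \<lfloor>\<sigma> (x g) / l \<sigma>\<rfloor>"
        using fun_cong[OF fg(4), of \<sigma>] that by (simp add: cell_def)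
      then have "\<bar>\<sigma> (x f) / l \<sigma> - \<sigma> (x g) / l \<sigma>\<bar> < 1" by linarith
      then have "\<bar>\<sigma> (x f) - \<sigma> (x g)\<bar> < l \<sigma>"
        using l(1)[OF that] by (simp flip: diff_divide_distrib add: abs_divide)
      then show ?thesis unfolding h_def x_diff[symmetric] emb_diff[OF E_embedding[OF that]] .
    qed
    ultimately show "\<exists>f :: 'k \<Rightarrow> int. (\<Sum>b\<in>B. of_int (f b) * w b) \<noteq> 0 \<and>
        (\<forall>\<sigma>\<in>E. \<bar>\<sigma> (\<Sum>b\<in>B. of_int (f b) * w b)\<bar> < l \<sigma>)"
      unfolding x_def by blast
  qed
qed

text \<open>
  Of infinitely many elements of bounded norm with shrinking conjugates away from \<open>s\<close>, two are
  congruent modulo a multiple of both norms; their quotient is the unit.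
\<close>

lemma unit_small_away_from:
  assumes s: "s \<in> E"
  obtains u where "int_unit u" "\<And>\<sigma>. \<sigma> \<in> E \<Longrightarrow> \<sigma> \<noteq> s \<Longrightarrow> \<bar>\<sigma> u\<bar> < 1"
proof -
  obtain B :: "'k set" and w :: "'k \<Rightarrow> 'k" where B: "finite B" "card B = card E" "\<And>b. b \<in> B \<Longrightarrow> algebraic_int (w b)"
    "\<And>f :: 'k \<Rightarrow> int. (\<Sum>b\<in>B. of_int (f b) * w b) = 0 \<Longrightarrow> \<forall>b\<in>B. f b = 0"
    using integral_basis by blast
  define x where "x = (\<lambda>f :: 'k \<Rightarrow> int. \<Sum>b\<in>B. of_int (f b) * w b)"
  have x_int: "algebraic_int (x f)" for f
    unfolding x_def using B(3) by (intro algebraic_int_sum algebraic_int_times) auto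
  obtain C where C: "C > 0" "\<And>l. (\<And>\<sigma>. \<sigma> \<in> E \<Longrightarrow> l \<sigma> > 0) \<Longrightarrow> (\<Prod>\<sigma>\<in>E. l \<sigma>) \<ge> C \<Longrightarrow>
    \<exists>f. x f \<noteq> 0 \<and> (\<forall>\<sigma>\<in>E. \<bar>\<sigma> (x f)\<bar> < l \<sigma>)"
    using small_conjugates[OF B(1,2,4)] unfolding x_def by blast
  have step: "\<exists>f. x f \<noteq> 0 \<and> (\<forall>\<sigma>\<in>E - {s}. \<bar>\<sigma> (x f)\<bar> < t) \<and> \<bar>field_norm (x f)\<bar> \<le> C" if "t > 0" for t
  proof -
    \<comment> \<open>Prescribed size \<open>t\<close> away from \<open>s\<close>; the size at
      \<open>s\<close> is chosen to make the product exactly \<open>C\<close>, which also bounds the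
      norm.\<close>
    define l where "l = (\<lambda>\<sigma>. if \<sigma> = s then C / t ^ (card E - 1) else t)"
    have lpos: "l \<sigma> > 0" for \<sigma> using that C(1) by (simp add: l_def)
    have "(\<Prod>\<sigma>\<in>E. l \<sigma>) = l s * (\<Prod>\<sigma>\<in>E - {s}. l \<sigma>)" using s finite_E by (simp add: prod.remove)
    also have "(\<Prod>\<sigma>\<in>E - {s}. l \<sigma>) = (\<Prod>\<sigma>\<in>E - {s}. t)" by (intro prod.cong) (auto simp: l_def)
    also have "l s * \<dots> = C" using that s finite_E by (simp add: l_def)
    finally have prod_l: "(\<Prod>\<sigma>\<in>E. l \<sigma>) = C" .
    then obtain f where f: "x f \<noteq> 0" "\<forall>\<sigma>\<in>E. \<bar>\<sigma> (x f)\<bar> < l \<sigma>" using C(2)[of l] lpos by auto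
    have "\<bar>field_norm (x f)\<bar> = (\<Prod>\<sigma>\<in>E. \<bar>\<sigma> (x f)\<bar>)" by (simp add: field_norm_alt abs_prod)
    also have "\<dots> \<le> (\<Prod>\<sigma>\<in>E. l \<sigma>)" using f(2) by (intro prod_mono) (auto intro: less_imp_le)
    finally have "\<bar>field_norm (x f)\<bar> \<le> C" using prod_l by simp
    moreover have "\<forall>\<sigma>\<in>E - {s}. \<bar>\<sigma> (x f)\<bar> < t" using f(2) by (auto simp: l_def split: if_splits)
    ultimately show ?thesis using f(1) by blast
  qed
  define good where "good = (\<lambda>f. x f \<noteq> 0 \<and> \<bar>field_norm (x f)\<bar> \<le> C)"
  have next_ex: "\<exists>g. good g \<and> (\<forall>\<sigma>\<in>E - {s}. \<bar>\<sigma> (x g)\<bar> < \<bar>\<sigma> (x f)\<bar>)" if "good f" for f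
  proof -
    \<comment> \<open>Below this bound every conjugate away from \<open>s\<close> strictly
      decreases; the extra 1 keeps the set nonempty when \<open>s\<close> is the only
      embedding.\<close>
    define t where "t = Min (insert 1 ((\<lambda>\<sigma>. \<bar>\<sigma> (x f)\<bar>) ` (E - {s})))"
    have "t > 0" unfolding t_def
      using finite_E that by (subst Min_gr_iff) (auto simp: good_def E_eq_0_iff)
    moreover have "t \<le> \<bar>\<sigma> (x f)\<bar>" if "\<sigma> \<in> E - {s}" for \<sigma>
      unfolding t_def using finite_E that by (intro Min_le) auto
    ultimately show ?thesis using step[of t] unfolding good_def by (meson less_le_trans)
  qed
  have "\<exists>f. good f" using step[of 1] by (auto simp: good_def)
  then obtain f where f: "\<And>n. good (f n)" "\<And>n. \<forall>\<sigma>\<in>E - {s}. \<bar>\<sigma> (x (f (Suc n)))\<bar> < \<bar>\<sigma> (x (f n))\<bar>"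
    using dependent_nat_choice[of "\<lambda>_. good" "\<lambda>_ f g. \<forall>\<sigma>\<in>E - {s}. \<bar>\<sigma> (x g)\<bar> < \<bar>\<sigma> (x f)\<bar>"] next_ex
    by blast
  have decr: "\<bar>\<sigma> (x (f j))\<bar> < \<bar>\<sigma> (x (f i))\<bar>" if "i < j" "\<sigma> \<in> E" "\<sigma> \<noteq> s" for i j \<sigma>
  proof -
    have "- \<bar>\<sigma> (x (f i))\<bar> < - \<bar>\<sigma> (x (f j))\<bar>"
      by (rule lift_Suc_mono_less[of "\<lambda>n. - \<bar>\<sigma> (x (f n))\<bar>", OF _ that(1)]) (use f(2) that in simp)
    then show ?thesis by simp
  qed
  \<comment> \<open>A common multiple of all nonzero integers of absolute value at most
    \<open>C\<close>, in particular of all norms in the sequence.\<close>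
  define m where "m = (fact (nat \<lceil>C\<rceil>) :: int)"
  have m: "m > 0" by (simp add: m_def)
  have m_dvd: "n dvd m" if "\<bar>of_int n\<bar> \<le> C" "n \<noteq> 0" for n :: int
  proof -
    have "nat \<bar>n\<bar> dvd fact (nat \<lceil>C\<rceil>)"
    proof (rule dvd_fact)
      show "1 \<le> nat \<bar>n\<bar>" using that(2) by simp
      have "of_int \<bar>n\<bar> \<le> C" using that(1) by simp
      then have "\<bar>n\<bar> \<le> \<lceil>C\<rceil>" by linarith
      then show "nat \<bar>n\<bar> \<le> nat \<lceil>C\<rceil>" by simp
    qed
    then have "int (nat \<bar>n\<bar>) dvd int (fact (nat \<lceil>C\<rceil>))" by (simp only: of_nat_dvd_iff)
    then show ?thesis by (simp add: m_def)
  qed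
  define res where "res = (\<lambda>n. \<lambda>b\<in>B. f n b mod m)"
  have "range res \<subseteq> (\<Pi>\<^sub>E b\<in>B. {0..<m})"
    using m by (auto simp: res_def)
  moreover have "finite (\<Pi>\<^sub>E b\<in>B. {0..<m})" using B(1) by (intro finite_PiE) auto
  ultimately have "finite (range res)" by (rule finite_subset)
  then have "\<not> inj res" using infinite_UNIV_nat finite_imageD by blast
  then obtain i j where ij: "i < j" "res i = res j" unfolding inj_def by (metis linorder_neqE_nat)
  have nz: "x (f n) \<noteq> 0" for n using f(1) by (simp add: good_def)
  define g where "g = (\<lambda>b. (f j b - f i b) div m)"
  have "x (f j) - x (f i) = of_int m * x g"
  proof -
    have "f j b - f i b = m * g b" if "b \<in> B" for b
    proof -
      have "f i b mod m = f j b mod m" using fun_cong[OF ij(2), of b] that by (simp add: res_def)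
      then have "m dvd f j b - f i b" by (metis mod_eq_dvd_iff)
      then show ?thesis by (simp add: g_def)
    qed
    then have "(\<Sum>b\<in>B. of_int (f j b - f i b) * w b) = (\<Sum>b\<in>B. of_int (m * g b) * w b)" by simp
    then show ?thesis by (simp add: x_def left_diff_distrib sum_subtractf sum_distrib_left mult.assoc)
  qed
  then have diff: "x (f j) = x (f i) + of_int m * x g" by (simp add: algebra_simps)
  have quot: "algebraic_int (of_int m / x (f n))" for n
  proof -
    obtain k :: int where k: "field_norm (x (f n)) = of_int k" using norm_int[OF x_int] .
    obtain y where y: "algebraic_int y" "x (f n) * y = of_int k" using cofactor[OF x_int k] .
    have "k dvd m" using f(1)[of n] k norm_eq_0_iff[of "x (f n)"] by (intro m_dvd) (auto simp: good_def)
    then obtain q where q: "m = k * q" by blast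
    have "of_int m / x (f n) = of_int q * y" using y(2) nz[of n] by (simp add: q field_simps flip: y(2))
    then show ?thesis using y(1) by (simp add: algebraic_int_times)
  qed
  \<comment> \<open>Since \<open>x (f j)\<close> and \<open>x (f i)\<close> differ by a multiple of
    \<open>m\<close>, and both divide \<open>m\<close>, each quotient of the two is 1 plus an
    integer.\<close>
  define u where "u = x (f j) / x (f i)"
  have u: "u = 1 + (of_int m / x (f i)) * x g" using nz[of i] by (simp add: u_def diff field_simps)
  have v: "inverse u = 1 - (of_int m / x (f j)) * x g" using nz[of j] by (simp add: u_def diff field_simps)
  have "algebraic_int u" "algebraic_int (inverse u)"
    unfolding v unfolding u by (intro algebraic_int_plus algebraic_int_diff algebraic_int_times quot x_int; simp)+
  then have "int_unit u" using nz by (simp add: int_unit_def u_def)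
  moreover have "\<bar>\<sigma> u\<bar> < 1" if "\<sigma> \<in> E" "\<sigma> \<noteq> s" for \<sigma>
    using decr[OF ij(1) that] nz[of i] that
    by (simp add: u_def emb_divide[OF E_embedding] abs_divide E_eq_0_iff)
  ultimately show ?thesis by (rule that)
qed

lemma unit_ln_sum: "int_unit u \<Longrightarrow> (\<Sum>\<sigma>\<in>E. ln \<bar>\<sigma> u\<bar>) = 0"
proof -
  assume u: "int_unit u"
  then have "u \<noteq> 0" by (simp add: int_unit_def)
  then have "(\<Sum>\<sigma>\<in>E. ln \<bar>\<sigma> u\<bar>) = ln (\<Prod>\<sigma>\<in>E. \<bar>\<sigma> u\<bar>)"
    using finite_E by (subst ln_prod) (auto simp: E_eq_0_iff)
  also have "(\<Prod>\<sigma>\<in>E. \<bar>\<sigma> u\<bar>) = 1" using u by (simp add: int_unit_iff_norm field_norm_alt abs_prod)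
  finally show ?thesis by simp
qed

text \<open>Dirichlet's rank argument: where \<open>y\<close> is maximal, at \<open>s\<close>, take
  a unit that is small away from \<open>s\<close>. As its logarithms sum to 0, the numbers
  \<open>(y s - y \<rho>) * - ln \<bar>\<rho> u\<bar>\<close> also sum to 0, and none is negative;
  so all differences vanish.\<close>

lemma log_functional_constant:
  assumes "\<And>u. int_unit u \<Longrightarrow> (\<Sum>\<sigma>\<in>E. y \<sigma> * ln \<bar>\<sigma> u\<bar>) = 0" "\<sigma> \<in> E" "\<tau> \<in> E"
  shows "y \<sigma> = y \<tau>"
proof -
  have "Max (y ` E) \<in> y ` E" using finite_E E_nonempty by (intro Max_in) auto
  then obtain s where s: "s \<in> E" "y s = Max (y ` E)" by auto
  then have max: "y \<rho> \<le> y s" if "\<rho> \<in> E" for \<rho> using that finite_E by simp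
  obtain u where u: "int_unit u" "\<And>\<rho>. \<rho> \<in> E \<Longrightarrow> \<rho> \<noteq> s \<Longrightarrow> \<bar>\<rho> u\<bar> < 1"
    using unit_small_away_from[OF s(1)] by blast
  have "u \<noteq> 0" using u(1) by (simp add: int_unit_def)
  have neg: "ln \<bar>\<rho> u\<bar> < 0" if "\<rho> \<in> E" "\<rho> \<noteq> s" for \<rho>
    using u(2)[OF that] that \<open>u \<noteq> 0\<close> by (intro ln_less_zero) (auto simp: E_eq_0_iff)
  have "(\<Sum>\<rho>\<in>E. (y s - y \<rho>) * - ln \<bar>\<rho> u\<bar>) = - (y s * (\<Sum>\<rho>\<in>E. ln \<bar>\<rho> u\<bar>)) + (\<Sum>\<rho>\<in>E. y \<rho> * ln \<bar>\<rho> u\<bar>)"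
    unfolding sum_distrib_left sum_negf[symmetric] sum.distrib[symmetric]
    by (intro sum.cong) (auto simp: algebra_simps)
  also have "\<dots> = 0" using unit_ln_sum[OF u(1)] assms(1)[OF u(1)] by simp
  finally have "(\<Sum>\<rho>\<in>E. (y s - y \<rho>) * - ln \<bar>\<rho> u\<bar>) = 0" .
  moreover have "(y s - y \<rho>) * - ln \<bar>\<rho> u\<bar> \<ge> 0" if "\<rho> \<in> E" for \<rho>
  proof (cases "\<rho> = s")
    case False
    with max[OF that] neg[OF that False] show ?thesis by (intro mult_nonneg_nonneg) auto
  qed simp
  ultimately have "\<forall>\<rho>\<in>E. (y s - y \<rho>) * - ln \<bar>\<rho> u\<bar> = 0"
    by (subst (asm) sum_nonneg_eq_0_iff[OF finite_E]) blast+
  then have "y \<rho> = y s" if "\<rho> \<in> E" for \<rho>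
  proof (cases "\<rho> = s")
    case False
    with that neg[OF that False] \<open>\<forall>\<rho>\<in>E. _\<close> show ?thesis by auto
  qed simp
  with assms(2,3) show ?thesis by simp
qed

end

section \<open>Signatures of units and independence modulo squares\<close>

context totally_real_field
begin

text \<open>A set of embeddings in place of a vector of signs, so that multiplication becomes
  symmetric difference and counting takes place in \<open>Pow E\<close>.\<close>

definition signature :: "'k \<Rightarrow> ('k \<Rightarrow> real) set" where
  "signature x = {\<sigma> \<in> E. \<sigma> x < 0}"

text \<open>For nonzero \<open>x\<close>: some unit has the same signature as
  \<open>x\<close>.\<close>

definition pos_associate :: "'k \<Rightarrow> bool" where
  "pos_associate x \<longleftrightarrow> (\<exists>u. int_unit u \<and> totally_positive (u * x))"

lemma signature_mult: "x \<noteq> 0 \<Longrightarrow> y \<noteq> 0 \<Longrightarrow> signature (x * y) = sym_diff (signature x) (signature y)"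
proof -
  assume *: "x \<noteq> 0" "y \<noteq> 0"
  have "\<sigma> (x * y) < 0 \<longleftrightarrow> (\<sigma> x < 0) \<noteq> (\<sigma> y < 0)" if "\<sigma> \<in> E" for \<sigma>
    using * E_eq_0_iff[OF that, of x] E_eq_0_iff[OF that, of y]
    by (simp add: emb_mult[OF E_embedding[OF that]] mult_less_0_iff) linarith
  then show ?thesis by (auto simp: signature_def)
qed

lemma signature_empty_iff: "x \<noteq> 0 \<Longrightarrow> signature x = {} \<longleftrightarrow> totally_positive x"
proof -
  assume "x \<noteq> 0"
  then have "\<sigma> x < 0 \<longleftrightarrow> \<not> 0 < \<sigma> x" if "\<sigma> \<in> E" for \<sigma>
    using E_eq_0_iff[OF that, of x] by linarith
  then show ?thesis unfolding signature_def totally_positive_alt by blast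
qed

lemma signature_eq_iff:
  "x \<noteq> 0 \<Longrightarrow> y \<noteq> 0 \<Longrightarrow> signature x = signature y \<longleftrightarrow> totally_positive (x * y)"
  by (subst signature_empty_iff[symmetric]) (auto simp: signature_mult)

lemma int_unit_nonzero: "int_unit u \<Longrightarrow> u \<noteq> 0"
  by (simp add: int_unit_def)

text \<open>The unit signatures form a subgroup under symmetric difference, and 1, \<open>x\<close>,
  \<open>y\<close>, \<open>x * y\<close> lie in four different cosets of it.\<close>

lemma card_unit_signatures:
  assumes "x \<noteq> 0" "y \<noteq> 0" "\<not> pos_associate x" "\<not> pos_associate y" "\<not> pos_associate (x * y)"
  shows "4 * card (signature ` Collect int_unit) \<le> 2 ^ card E"
proof -
  define G where "G = signature ` Collect int_unit"
  define T where "T = {{}, signature x, signature y, signature (x * y)}"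
  have G_sub: "G \<subseteq> Pow E" by (auto simp: G_def signature_def)
  then have finG: "finite G" using finite_E finite_subset by blast
  have G_diff: "sym_diff H H' \<in> G" if "H \<in> G" "H' \<in> G" for H H'
  proof -
    from that obtain u v where "int_unit u" "H = signature u" "int_unit v" "H' = signature v"
      by (auto simp: G_def)
    then have "sym_diff H H' = signature (u * v)" "int_unit (u * v)"
      using signature_mult[of u v] int_unit_nonzero int_unit_mult by blast+
    then show ?thesis unfolding G_def by blast
  qed
  have notG: "signature z \<notin> G" if "z \<noteq> 0" "\<not> pos_associate z" for z
  proof
    assume "signature z \<in> G"
    then obtain u where "int_unit u" "signature u = signature z" by (auto simp: G_def)
    with that show False by (simp add: signature_eq_iff int_unit_nonzero pos_associate_def)
  qed
  have notG': "signature x \<notin> G" "signature y \<notin> G" "signature (x * y) \<notin> G"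
    using assms by (simp_all only: notG mult_eq_0_iff simp_thms)
  have "{} \<in> G"
  proof -
    have "totally_positive (1 :: 'k)"
      unfolding totally_positive_alt by (intro ballI) (simp add: emb_1[OF E_embedding])
    then have "signature 1 = {}" by (subst signature_empty_iff) auto
    then show ?thesis using int_unit_1 unfolding G_def by blast
  qed
  have xy: "signature (x * y) = sym_diff (signature x) (signature y)"
    using assms(1,2) by (rule signature_mult)
  have T_diff: "sym_diff t t' \<notin> G" if "t \<in> T" "t' \<in> T" "t \<noteq> t'" for t t'
  proof -
    have xy': "sym_diff (signature x) (signature (x * y)) = signature y"
      "sym_diff (signature y) (signature (x * y)) = signature x" unfolding xy by blast+
    have *: "sym_diff a b = sym_diff b a" "sym_diff {} a = a" for a b :: "('k \<Rightarrow> real) set" by blast+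
    from that show ?thesis unfolding T_def
      by (elim insertE emptyE)
        (use notG' xy' xy *(1)[of "signature (x * y)"] *(1)[of "signature y"] *(1)[of _ "{}"] *(2) in metis)+
  qed
  have "card T = 4"
  proof -
    have "signature x \<noteq> {}" "signature y \<noteq> {}" "signature (x * y) \<noteq> {}" using notG' \<open>{} \<in> G\<close> by auto
    moreover have "signature x \<noteq> signature y" using xy \<open>signature (x * y) \<noteq> {}\<close> by auto
    moreover have "signature x \<noteq> signature (x * y)" "signature y \<noteq> signature (x * y)"
      using xy \<open>signature y \<noteq> {}\<close> \<open>signature x \<noteq> {}\<close> by blast+
    ultimately show ?thesis by (simp add: T_def)
  qed
  have "inj_on (\<lambda>(t, H). sym_diff t H) (T \<times> G)"
  proof (rule inj_onI, clarify)
    fix t H t' H' assume *: "t \<in> T" "t' \<in> T" "H \<in> G" "H' \<in> G" "sym_diff t H = sym_diff t' H'"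
    then have "sym_diff t t' = sym_diff H H'" by blast
    with G_diff[OF *(3,4)] have "sym_diff t t' \<in> G" by (simp only:)
    with T_diff[OF *(1,2)] have "t = t'" by blast
    with *(5) show "t = t' \<and> H = H'" by blast
  qed
  moreover have "(\<lambda>(t, H). sym_diff t H) ` (T \<times> G) \<subseteq> Pow E"
    using G_sub by (auto simp: T_def signature_def)
  ultimately have "card (T \<times> G) \<le> card (Pow E)" using finite_E by (intro card_inj_on_le) auto
  then show ?thesis using \<open>card T = 4\<close> finite_E by (simp add: card_cartesian_product card_Pow G_def)
qed

text \<open>Linear independence over the field with two elements in the units modulo squares and
  \<open>- 1\<close>; a subset \<open>A\<close> plays the role of an exponent vector.\<close>

definition units_independent :: "'k set \<Rightarrow> bool" where
  "units_independent S \<longleftrightarrow> finite S \<and> (\<forall>u\<in>S. int_unit u) \<and>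
     (\<forall>A. A \<subseteq> S \<and> A \<noteq> {} \<longrightarrow> \<not> (\<exists>t. int_unit t \<and> (\<Prod>A = t\<^sup>2 \<or> \<Prod>A = - (t\<^sup>2))))"

text \<open>Up to a square, the two products multiply to the product over the symmetric difference,
  which independence forces to be empty.\<close>

lemma units_independent_unique:
  assumes S: "units_independent S" and A: "A \<subseteq> S" "A' \<subseteq> S"
    and t: "int_unit t" "\<Prod>A * \<Prod>A' = t\<^sup>2 \<or> \<Prod>A * \<Prod>A' = - (t\<^sup>2)"
  shows "A = A'"
proof (rule ccontr)
  assume "A \<noteq> A'"
  have fin: "finite A" "finite A'" using S A finite_subset by (auto simp: units_independent_def)
  have units: "int_unit (\<Prod>C)" if "C \<subseteq> S" for C
    using S that unfolding units_independent_def by (intro int_unit_prod) auto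
  define D where "D = sym_diff A A'"
  have "\<Prod>A * \<Prod>A' = (\<Prod>(A - A') * \<Prod>(A \<inter> A')) * (\<Prod>(A' - A) * \<Prod>(A \<inter> A'))"
    using fin prod.Int_Diff[of A id A'] prod.Int_Diff[of A' id A] by (simp add: Int_commute mult.commute)
  also have "\<dots> = \<Prod>D * (\<Prod>(A \<inter> A'))\<^sup>2"
    unfolding D_def using fin by (subst prod.union_disjoint) (auto simp: power2_eq_square algebra_simps)
  finally have eq: "\<Prod>A * \<Prod>A' = \<Prod>D * (\<Prod>(A \<inter> A'))\<^sup>2" .
  define r where "r = t / \<Prod>(A \<inter> A')"
  have nz: "\<Prod>(A \<inter> A') \<noteq> 0" using A by (intro int_unit_nonzero units) auto
  have "int_unit r" unfolding r_def using A t(1) by (intro int_unit_divide units) auto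
  moreover have "\<Prod>D = r\<^sup>2 \<or> \<Prod>D = - (r\<^sup>2)"
    using t(2) nz unfolding eq r_def by (simp add: power_divide field_simps) 
  moreover have "D \<subseteq> S" "D \<noteq> {}" using A \<open>A \<noteq> A'\<close> by (auto simp: D_def)
  ultimately show False using S unfolding units_independent_def by blast
qed

text \<open>The elements of \<open>S\<close> and the sign give \<open>2 * 2 ^ card S\<close> units,
  at most two with any given signature: units sharing a signature have a totally positive product,
  which is \<epsilon> times a square, and multiplying two such products among three units would make
  the third product a square.\<close>

lemma units_independent_card:
  assumes S: "units_independent S"
    and sq: "\<And>u. int_unit u \<Longrightarrow> totally_positive u \<Longrightarrow> \<exists>t. int_unit t \<and> (u = t\<^sup>2 \<or> u = \<epsilon> * t\<^sup>2)"
    and \<epsilon>: "int_unit \<epsilon>"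
  shows "2 ^ card S \<le> card (signature ` Collect int_unit)"
proof -
  have fin: "finite S" using S by (simp add: units_independent_def)
  define X where "X = Pow S \<times> {1, - 1 :: 'k}"
  define val where "val = (\<lambda>(A, s :: 'k). s * \<Prod>A)"
  have val_unit: "int_unit (val p)" if pX: "p \<in> X" for p
  proof -
    obtain A s where p: "p = (A, s)" "A \<subseteq> S" "s = 1 \<or> s = - 1" using pX by (cases p) (auto simp: X_def)
    have "int_unit (\<Prod>A)" using S p(2) unfolding units_independent_def by (intro int_unit_prod) blast
    with p(3) show ?thesis unfolding val_def p(1) by (auto intro: int_unit_minus)
  qed
  have finX: "finite X" using fin by (simp add: X_def)
  have fiber: "card {p \<in> X. signature (val p) = g} \<le> 2" for g
  proof (rule ccontr)
    assume "\<not> ?thesis"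
    then have "3 \<le> card {p \<in> X. signature (val p) = g}" by simp
    then obtain Y where Y: "Y \<subseteq> {p \<in> X. signature (val p) = g}" "card Y = 3"
      by (rule obtain_subset_with_card_n) (erule (1) that)
    obtain p q r where pqr: "Y = {p, q, r}" "p \<noteq> q" "q \<noteq> r" "p \<noteq> r"
      using card_3_iff[THEN iffD1, OF Y(2)] by blast
    have sq_ne: "\<not> (\<exists>t. int_unit t \<and> val a * val b = t\<^sup>2)"
      if ab: "a \<in> X" "b \<in> X" "a \<noteq> b" "signature (val a) = signature (val b)" for a b
    proof
      assume "\<exists>t. int_unit t \<and> val a * val b = t\<^sup>2"
      then obtain t where t: "int_unit t" "val a * val b = t\<^sup>2" by blast
      obtain A s A' s' where A: "a = (A, s)" "b = (A', s')" "A \<subseteq> S" "A' \<subseteq> S" "s \<in> {1, - 1}" "s' \<in> {1, - 1}"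
        using ab(1,2) by (auto simp: X_def)
      then have "\<Prod>A * \<Prod>A' = t\<^sup>2 \<or> \<Prod>A * \<Prod>A' = - (t\<^sup>2)" using t(2) by (auto simp: val_def minus_equation_iff[of _ "t\<^sup>2"])
      then have "A = A'" using units_independent_unique[OF S A(3,4) t(1)] by blast
      with ab(3) A have "val b = - val a" by (auto simp: val_def)
      then have "totally_positive (- (val a)\<^sup>2)"
        using ab(1,2,4) val_unit by (simp add: signature_eq_iff int_unit_nonzero power2_eq_square)
      moreover obtain \<sigma> where "\<sigma> \<in> E" using E_nonempty by blast
      ultimately have "\<sigma> (- (val a)\<^sup>2) > 0" by (simp add: totally_positive_alt)
      then show False
        by (simp add: emb_minus[OF E_embedding[OF \<open>\<sigma> \<in> E\<close>]] emb_power[OF E_embedding[OF \<open>\<sigma> \<in> E\<close>]])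
    qed
    have prod: "\<exists>t. int_unit t \<and> val a * val b = \<epsilon> * t\<^sup>2"
      if ab: "a \<in> X" "b \<in> X" "a \<noteq> b" "signature (val a) = signature (val b)" for a b
    proof -
      have "totally_positive (val a * val b)" using ab val_unit by (simp add: signature_eq_iff int_unit_nonzero)
      then show ?thesis using sq[of "val a * val b"] sq_ne[OF ab] val_unit ab int_unit_mult by metis
    qed
    have mem: "p \<in> X" "q \<in> X" "r \<in> X" and sg: "signature (val p) = g" "signature (val q) = g" "signature (val r) = g"
      using Y(1) pqr(1) by auto
    obtain t where t: "int_unit t" "val p * val q = \<epsilon> * t\<^sup>2" using prod[of p q] mem sg pqr by auto
    obtain t' where t': "int_unit t'" "val p * val r = \<epsilon> * t'\<^sup>2" using prod[of p r] mem sg pqr by auto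
    have "val p \<noteq> 0" using val_unit[OF mem(1)] by (rule int_unit_nonzero)
    have "val q * val r = (\<epsilon> * t * t' / val p)\<^sup>2"
    proof -
      have "(val p)\<^sup>2 * (val q * val r) = (val p * val q) * (val p * val r)" by (simp add: power2_eq_square)
      also have "\<dots> = (\<epsilon> * t * t')\<^sup>2" unfolding t(2) t'(2) by (simp add: power2_eq_square)
      finally show ?thesis using \<open>val p \<noteq> 0\<close> by (simp add: power_divide field_simps)
    qed
    moreover have "int_unit (\<epsilon> * t * t' / val p)"
      using \<epsilon> t(1) t'(1) val_unit[OF mem(1)] by (intro int_unit_divide int_unit_mult)
    ultimately show False using sq_ne[of q r] mem sg pqr(3) by auto
  qed
  define G where "G = (\<lambda>p. signature (val p)) ` X"
  have "card X = (\<Sum>g\<in>G. card {p \<in> X. signature (val p) = g})"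
    using sum.image_gen[OF finX, of "\<lambda>_. 1 :: nat" "\<lambda>p. signature (val p)"] by (simp add: G_def)
  moreover have "(\<Sum>g\<in>G. card {p \<in> X. signature (val p) = g}) \<le> card G * 2"
    using sum_bounded_above[of G "\<lambda>g. card {p \<in> X. signature (val p) = g}" 2] fiber by simp
  moreover have "card X = 2 * 2 ^ card S" using fin by (simp add: X_def card_cartesian_product card_Pow)
  moreover have "card G \<le> card (signature ` Collect int_unit)"
  proof (rule card_mono)
    show "finite (signature ` Collect int_unit)"
      by (rule finite_subset[of _ "Pow E"]) (use finite_E in \<open>auto simp: signature_def\<close>)
    show "G \<subseteq> signature ` Collect int_unit" using val_unit by (auto simp: G_def)
  qed
  ultimately show ?thesis by linarith
qed

text \<open>
  The half of Dirichlet's unit theorem that is needed: if the units had at most a quarter of all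
  signatures, they would be generated up to squares by \<open>- 1\<close> and at most \<open>card E - 2\<close> units, and some
  nonconstant combination of the logarithms of the conjugates would vanish on these generators, hence
  (by iterated extraction of square roots, which keeps the conjugates bounded) on all units.
\<close>

lemma pos_associate_mult:
  assumes sq: "\<And>u. int_unit u \<Longrightarrow> totally_positive u \<Longrightarrow> \<exists>t. int_unit t \<and> (u = t\<^sup>2 \<or> u = \<epsilon> * t\<^sup>2)"
    and \<epsilon>: "int_unit \<epsilon>" and xy: "x \<noteq> 0" "y \<noteq> 0" "\<not> pos_associate x" "\<not> pos_associate y"
  shows "pos_associate (x * y)"
proof (rule ccontr)
  assume "\<not> pos_associate (x * y)"
  with xy have le: "4 * card (signature ` Collect int_unit) \<le> 2 ^ card E" by (intro card_unit_signatures)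
  have bound: "card S + 2 \<le> card E" if "units_independent S" for S
  proof -
    have "(2 :: nat) ^ (card S + 2) \<le> 2 ^ card E"
      using units_independent_card[OF that sq \<epsilon>] le by simp
    then show ?thesis by (rule power_le_imp_le_exp[rotated]) simp
  qed
  have "units_independent {}" by (simp add: units_independent_def)
  moreover have "\<forall>S. units_independent S \<longrightarrow> card S < card E"
    by (intro allI impI less_le_trans[OF _ bound]) auto
  ultimately obtain S where S: "units_independent S" "\<And>S'. units_independent S' \<Longrightarrow> card S' \<le> card S"
    using ex_has_greatest_nat[of units_independent "{}" card "card E"] by metis
  have finS: "finite S" and unitS: "\<And>v. v \<in> S \<Longrightarrow> int_unit v"
    using S(1) unfolding units_independent_def by blast+
  obtain s0 where s0: "s0 \<in> E" using E_nonempty by blast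
  \<comment> \<open>As 0 is not a unit, it is free to index one more equation. That equation
    prescribes \<open>z s0 = 0\<close>, which leaves no nonzero constant solution.\<close>
  define a where "a = (\<lambda>v \<sigma>. if v = 0 then (if \<sigma> = s0 then 1 else 0) else ln \<bar>\<sigma> v\<bar> :: real)"
  have "card (insert 0 S) < card E" using bound[OF S(1)] finS by (simp add: card_insert_if)
  then obtain z where z: "\<exists>\<sigma>\<in>E. z \<sigma> \<noteq> 0" "\<forall>v\<in>insert 0 S. (\<Sum>\<sigma>\<in>E. a v \<sigma> * z \<sigma>) = 0"
    using homogeneous_system_solution[of "insert 0 S" E a] finS finite_E by auto
  have "(\<Sum>\<sigma>\<in>E. a 0 \<sigma> * z \<sigma>) = (\<Sum>\<sigma>\<in>E. if \<sigma> = s0 then z \<sigma> else 0)"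
    by (intro sum.cong) (auto simp: a_def)
  then have "z s0 = 0" using z(2) s0 finite_E by simp
  define l where "l = (\<lambda>u. \<Sum>\<sigma>\<in>E. z \<sigma> * ln \<bar>\<sigma> u\<bar>)"
  have lS: "l v = 0" if "v \<in> S" for v
    using z(2) that int_unit_nonzero[OF unitS[OF that]] by (auto simp: a_def l_def mult.commute)
  \<comment> \<open>By maximality of \<open>S\<close>, the unit \<open>u\<close> times a product
    over a subset of \<open>S\<close> is a square up to sign.\<close>
  have halve: "\<exists>t A. int_unit t \<and> A \<subseteq> S \<and> (\<forall>\<sigma>\<in>E. ln \<bar>\<sigma> u\<bar> = 2 * ln \<bar>\<sigma> t\<bar> - (\<Sum>v\<in>A. ln \<bar>\<sigma> v\<bar>))"
    if u: "int_unit u" for u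
  proof (cases "u \<in> S")
    case True
    with u show ?thesis by (intro exI[of _ u] exI[of _ "{u}"]) auto
  next
    case False
    then have "\<not> units_independent (insert u S)" using S(2)[of "insert u S"] finS by auto
    moreover have "finite (insert u S) \<and> (\<forall>v\<in>insert u S. int_unit v)" using finS u unitS by simp
    ultimately obtain A where A: "A \<subseteq> insert u S" "A \<noteq> {}"
      and "\<exists>t. int_unit t \<and> (\<Prod>A = t\<^sup>2 \<or> \<Prod>A = - (t\<^sup>2))"
      unfolding units_independent_def by meson
    then obtain t where t: "int_unit t" "\<Prod>A = t\<^sup>2 \<or> \<Prod>A = - (t\<^sup>2)" by blast
    note A = A t
    have "u \<in> A"
    proof (rule ccontr)
      assume "u \<notin> A"
      with A(1) have "A \<subseteq> S" by blast
      with A(2) t S(1) show False unfolding units_independent_def by meson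
    qed
    define A' where "A' = A - {u}"
    have A': "A' \<subseteq> S" using A(1) by (auto simp: A'_def)
    have finA: "finite A" using A(1) finS finite_subset by blast
    have prodA: "\<Prod>A = u * \<Prod>A'" using \<open>u \<in> A\<close> finA unfolding A'_def by (simp add: prod.remove)
    have "ln \<bar>\<sigma> u\<bar> = 2 * ln \<bar>\<sigma> t\<bar> - (\<Sum>v\<in>A'. ln \<bar>\<sigma> v\<bar>)" if \<sigma>: "\<sigma> \<in> E" for \<sigma>
    proof -
      note e = E_embedding[OF \<sigma>]
      have nzt: "\<sigma> t \<noteq> 0" and nzu: "\<sigma> u \<noteq> 0"
        using int_unit_nonzero[OF u] int_unit_nonzero[OF A(3)] E_eq_0_iff[OF \<sigma>] by auto
      have nzA: "\<sigma> v \<noteq> 0" if "v \<in> A'" for v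
        using that A' unitS int_unit_nonzero E_eq_0_iff[OF \<sigma>] by blast
      have "\<sigma> u * (\<Prod>v\<in>A'. \<sigma> v) = \<sigma> (\<Prod>A)" by (simp add: prodA emb_mult[OF e] emb_prod[OF e])
      then have "\<bar>\<sigma> u * (\<Prod>v\<in>A'. \<sigma> v)\<bar> = \<bar>\<sigma> (\<Prod>A)\<bar>" by simp
      then have "\<bar>\<sigma> u\<bar> * (\<Prod>v\<in>A'. \<bar>\<sigma> v\<bar>) = \<bar>\<sigma> (\<Prod>A)\<bar>" by (simp add: abs_mult abs_prod)
      also have "\<dots> = \<bar>\<sigma> t\<bar>\<^sup>2" using A(4) by (auto simp: emb_minus[OF e] emb_power[OF e])
      finally have "ln (\<bar>\<sigma> u\<bar> * (\<Prod>v\<in>A'. \<bar>\<sigma> v\<bar>)) = ln (\<bar>\<sigma> t\<bar>\<^sup>2)" by simp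
      moreover have "ln (\<bar>\<sigma> u\<bar> * (\<Prod>v\<in>A'. \<bar>\<sigma> v\<bar>)) = ln \<bar>\<sigma> u\<bar> + (\<Sum>v\<in>A'. ln \<bar>\<sigma> v\<bar>)"
      proof -
        have "(\<Prod>v\<in>A'. \<bar>\<sigma> v\<bar>) > 0" using nzA by (intro prod_pos) auto
        moreover have "ln (\<Prod>v\<in>A'. \<bar>\<sigma> v\<bar>) = (\<Sum>v\<in>A'. ln \<bar>\<sigma> v\<bar>)"
          using nzA finA by (intro ln_prod) (auto simp: A'_def)
        ultimately show ?thesis using nzu by (simp add: ln_mult)
      qed
      moreover have "ln (\<bar>\<sigma> t\<bar>\<^sup>2) = 2 * ln \<bar>\<sigma> t\<bar>" using nzt by (subst ln_realpow) auto
      ultimately show ?thesis by simp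
    qed
    with A(3) A' show ?thesis by blast
  qed
  have "l u = 0" if u: "int_unit u" for u
  proof (rule ccontr)
    assume "l u \<noteq> 0"
    from halve have "\<forall>v. \<exists>t. int_unit v \<longrightarrow> int_unit t \<and>
        (\<exists>A\<subseteq>S. \<forall>\<sigma>\<in>E. ln \<bar>\<sigma> v\<bar> = 2 * ln \<bar>\<sigma> t\<bar> - (\<Sum>w\<in>A. ln \<bar>\<sigma> w\<bar>))"
      by meson
    from choice[OF this] obtain nxt where nxt: "\<And>v. int_unit v \<Longrightarrow> int_unit (nxt v)"
      "\<And>v. int_unit v \<Longrightarrow> \<exists>A\<subseteq>S. \<forall>\<sigma>\<in>E. ln \<bar>\<sigma> v\<bar> = 2 * ln \<bar>\<sigma> (nxt v)\<bar> - (\<Sum>w\<in>A. ln \<bar>\<sigma> w\<bar>)"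
      by blast
    define t where "t = (\<lambda>n. (nxt ^^ n) u)"
    have t: "int_unit (t n)" "t 0 = u" for n by (induction n) (use u nxt(1) in \<open>auto simp: t_def\<close>)
    have t3: "\<exists>A\<subseteq>S. \<forall>\<sigma>\<in>E. ln \<bar>\<sigma> (t n)\<bar> = 2 * ln \<bar>\<sigma> (t (Suc n))\<bar> - (\<Sum>v\<in>A. ln \<bar>\<sigma> v\<bar>)" for n
      using nxt(2)[OF t(1), of n] by (simp add: t_def)
    have l_half: "l (t n) = 2 * l (t (Suc n))" for n
    proof -
      obtain A where A: "A \<subseteq> S" "\<forall>\<sigma>\<in>E. ln \<bar>\<sigma> (t n)\<bar> = 2 * ln \<bar>\<sigma> (t (Suc n))\<bar> - (\<Sum>v\<in>A. ln \<bar>\<sigma> v\<bar>)"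
        using t3 by blast
      have "l (t n) = (\<Sum>\<sigma>\<in>E. 2 * (z \<sigma> * ln \<bar>\<sigma> (t (Suc n))\<bar>) - (\<Sum>v\<in>A. z \<sigma> * ln \<bar>\<sigma> v\<bar>))"
        unfolding l_def using A(2) by (intro sum.cong) (auto simp: right_diff_distrib sum_distrib_left)
      also have "\<dots> = 2 * l (t (Suc n)) - (\<Sum>v\<in>A. l v)"
        by (simp add: sum_subtractf l_def sum_distrib_left) (rule sum.swap)
      also have "(\<Sum>v\<in>A. l v) = 0" using lS A(1) by (intro sum.neutral) auto
      finally show ?thesis by simp
    qed
    \<comment> \<open>The bound is stable under halving: each new logarithm is half the sum of an
      old one and a sum over \<open>S\<close>, both at most \<open>H\<close> in absolute
      value.\<close>
    define H where "H = (\<Sum>\<sigma>\<in>E. \<bar>ln \<bar>\<sigma> u\<bar>\<bar>) + (\<Sum>\<sigma>\<in>E. \<Sum>v\<in>S. \<bar>ln \<bar>\<sigma> v\<bar>\<bar>)"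
    have S_le: "(\<Sum>v\<in>S. \<bar>ln \<bar>\<sigma> v\<bar>\<bar>) \<le> H" and u_le: "\<bar>ln \<bar>\<sigma> u\<bar>\<bar> \<le> H" if "\<sigma> \<in> E" for \<sigma>
    proof -
      have "(\<Sum>v\<in>S. \<bar>ln \<bar>\<sigma> v\<bar>\<bar>) \<le> (\<Sum>\<sigma>\<in>E. \<Sum>v\<in>S. \<bar>ln \<bar>\<sigma> v\<bar>\<bar>)"
        using member_le_sum[OF that, of "\<lambda>\<sigma>. \<Sum>v\<in>S. \<bar>ln \<bar>\<sigma> v\<bar>\<bar>"] finite_E by (simp add: sum_nonneg)
      moreover have "\<bar>ln \<bar>\<sigma> u\<bar>\<bar> \<le> (\<Sum>\<sigma>\<in>E. \<bar>ln \<bar>\<sigma> u\<bar>\<bar>)"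
        using member_le_sum[OF that, of "\<lambda>\<sigma>. \<bar>ln \<bar>\<sigma> u\<bar>\<bar>"] finite_E by simp
      moreover have "(\<Sum>\<sigma>\<in>E. \<bar>ln \<bar>\<sigma> u\<bar>\<bar>) \<ge> 0" "(\<Sum>\<sigma>\<in>E. \<Sum>v\<in>S. \<bar>ln \<bar>\<sigma> v\<bar>\<bar>) \<ge> 0"
        by (intro sum_nonneg; simp)+
      ultimately show "(\<Sum>v\<in>S. \<bar>ln \<bar>\<sigma> v\<bar>\<bar>) \<le> H" "\<bar>ln \<bar>\<sigma> u\<bar>\<bar> \<le> H" by (auto simp: H_def)
    qed
    have t_le: "\<bar>ln \<bar>\<sigma> (t n)\<bar>\<bar> \<le> H" if \<sigma>: "\<sigma> \<in> E" for \<sigma> n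
    proof (induction n)
      case 0
      then show ?case using u_le[OF \<sigma>] t(2) by simp
    next
      case (Suc n)
      obtain A where A: "A \<subseteq> S" "\<forall>\<sigma>\<in>E. ln \<bar>\<sigma> (t n)\<bar> = 2 * ln \<bar>\<sigma> (t (Suc n))\<bar> - (\<Sum>v\<in>A. ln \<bar>\<sigma> v\<bar>)"
        using t3 by blast
      have "\<bar>\<Sum>v\<in>A. ln \<bar>\<sigma> v\<bar>\<bar> \<le> (\<Sum>v\<in>A. \<bar>ln \<bar>\<sigma> v\<bar>\<bar>)" by (rule sum_abs)
      also have "\<dots> \<le> (\<Sum>v\<in>S. \<bar>ln \<bar>\<sigma> v\<bar>\<bar>)" using finS A(1) by (intro sum_mono2) auto
      also have "\<dots> \<le> H" by (rule S_le[OF \<sigma>])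
      finally have "\<bar>\<Sum>v\<in>A. ln \<bar>\<sigma> v\<bar>\<bar> \<le> H" .
      moreover have "ln \<bar>\<sigma> (t n)\<bar> = 2 * ln \<bar>\<sigma> (t (Suc n))\<bar> - (\<Sum>v\<in>A. ln \<bar>\<sigma> v\<bar>)" using A(2) \<sigma> by blast
      ultimately show ?case using Suc by linarith
    qed
    have "range t \<subseteq> {x. algebraic_int x \<and> (\<forall>\<sigma>\<in>E. \<bar>\<sigma> x\<bar> \<le> exp H)}"
    proof (clarify, intro conjI ballI)
      fix n \<sigma> assume \<sigma>: "\<sigma> \<in> E"
      have "\<bar>\<sigma> (t n)\<bar> > 0" using int_unit_nonzero[OF t(1)] E_eq_0_iff[OF \<sigma>] by simp
      then have "\<bar>\<sigma> (t n)\<bar> = exp (ln \<bar>\<sigma> (t n)\<bar>)" by simp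
      also have "\<dots> \<le> exp H" using t_le[OF \<sigma>, of n] by (intro exp_mono) linarith
      finally show "\<bar>\<sigma> (t n)\<bar> \<le> exp H" .
    qed (use t(1) in \<open>auto simp: int_unit_def\<close>)
    then have fin: "finite (range t)" using finite_bounded_conjugates finite_subset by blast
    have "l u = 2 ^ n * l (t n)" for n
    proof (induction n)
      case (Suc n)
      then show ?case using l_half[of n] by (simp only: power_Suc mult.assoc mult.left_commute)
    qed (simp add: t(2))
    \<comment> \<open>The value of \<open>l\<close> halves at every step and is not 0, so the roots
      are pairwise distinct, whereas the bound on their conjugates leaves finitely many.\<close>
    then have "inj t"
    proof (intro injI)
      fix m n assume *: "\<And>n. l u = 2 ^ n * l (t n)" "t m = t n"
      have "l (t m) \<noteq> 0" using *(1)[of m] \<open>l u \<noteq> 0\<close> by auto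
      moreover have "2 ^ m * l (t m) = 2 ^ n * l (t m)" using *(1)[of m] *(1)[of n] *(2) by metis
      ultimately have "(2 :: real) ^ m = 2 ^ n" by (metis mult_right_cancel)
      then show "m = n" by (simp only: power_inject_exp)
    qed
    with fin show False using finite_imageD by auto
  qed
  then have "z \<sigma> = z s0" if "\<sigma> \<in> E" for \<sigma>
    using log_functional_constant[of z \<sigma> s0] that s0 by (simp add: l_def)
  with z(1) \<open>z s0 = 0\<close> show False by auto
qed

end

section \<open>Elements of small norm\<close>

lemma power_of_two_nat:
  assumes "n > 0" "\<And>p. prime p \<Longrightarrow> p dvd n \<Longrightarrow> p = (2 :: nat)"
  shows "\<exists>m. n = 2 ^ m"
proof -
  have "n = (\<Prod>p\<in>prime_factors n. p ^ multiplicity p n)"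
    using prod_prime_factors[of n] assms(1) by simp
  also have "\<dots> = (\<Prod>p\<in>prime_factors n. 2 ^ multiplicity p n)"
    using assms(2) by (intro prod.cong refl) (metis in_prime_factors_iff)
  also have "\<dots> = 2 ^ (\<Sum>p\<in>prime_factors n. multiplicity p n)" by (simp add: power_sum)
  finally show ?thesis by blast
qed

lemma square_eq_prime_power_nat:
  assumes "prime p" "n\<^sup>2 = (p :: nat) ^ j"
  obtains i where "n = p ^ i" "j = 2 * i"
proof -
  have "n dvd p ^ j" using assms(2) by (metis dvd_triv_left power2_eq_square)
  then obtain i where i: "n = p ^ i" using divides_primepow_nat[OF assms(1)] by blast
  with assms have "p ^ (2 * i) = p ^ j" by (simp add: power_mult[symmetric] mult.commute)
  then have "j = 2 * i" using prime_gt_1_nat[OF assms(1)] by (simp add: power_inject_exp)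
  with i show ?thesis by (rule that)
qed

context totally_real_field
begin

lemma pos_integers_alt: "\<alpha> \<in> pos_integers \<longleftrightarrow> algebraic_int \<alpha> \<and> totally_positive (\<alpha> :: 'k)"
  by (simp add: pos_integers_def ring_of_integers_def)

lemma integer_square_alt: "integer_square \<alpha> \<longleftrightarrow> (\<exists>x :: 'k. algebraic_int x \<and> \<alpha> = x\<^sup>2)"
  by (auto simp: integer_square_def ring_of_integers_def)

lemma algebraic_int_square_root: "algebraic_int (x\<^sup>2) \<Longrightarrow> algebraic_int (x :: 'k)"
  by (rule algebraic_int_root[where p = "Polynomial.monom 1 2" and y = "x\<^sup>2"])
    (auto simp: poly_monom degree_monom_eq coeff_monom)

lemma totally_positive_add: "totally_positive \<alpha> \<Longrightarrow> totally_positive \<beta> \<Longrightarrow> totally_positive (\<alpha> + \<beta> :: 'k)"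
  unfolding totally_positive_alt by (intro ballI) (simp add: emb_add[OF E_embedding] add_pos_pos)

lemma totally_positive_mult: "totally_positive \<alpha> \<Longrightarrow> totally_positive \<beta> \<Longrightarrow> totally_positive (\<alpha> * \<beta> :: 'k)"
  unfolding totally_positive_alt by (intro ballI) (simp add: emb_mult[OF E_embedding])

lemma totally_positive_square: "x \<noteq> 0 \<Longrightarrow> totally_positive (x\<^sup>2 :: 'k)"
  unfolding totally_positive_alt by (intro ballI) (simp add: emb_power[OF E_embedding] E_eq_0_iff)

lemma totally_positive_nonzero: "totally_positive \<alpha> \<Longrightarrow> \<alpha> \<noteq> (0 :: 'k)"
proof
  assume *: "totally_positive \<alpha>" "\<alpha> = 0"
  obtain \<sigma> where \<sigma>: "\<sigma> \<in> E" using E_nonempty by blast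
  with * have "\<sigma> 0 > 0" unfolding totally_positive_alt by blast
  then show False by (simp add: emb_0[OF E_embedding[OF \<sigma>]])
qed

lemma totally_positive_divide: "totally_positive \<alpha> \<Longrightarrow> totally_positive \<beta> \<Longrightarrow> totally_positive (\<alpha> / \<beta> :: 'k)"
  unfolding totally_positive_alt by (intro ballI) (simp add: emb_divide[OF E_embedding])

lemma totally_positive_of_nat: "n > 0 \<Longrightarrow> totally_positive (of_nat n :: 'k)"
  unfolding totally_positive_alt by (intro ballI) (simp add: emb_of_nat[OF E_embedding])

lemma pos_integers_add: "\<alpha> \<in> pos_integers \<Longrightarrow> \<beta> \<in> pos_integers \<Longrightarrow> \<alpha> + \<beta> \<in> (pos_integers :: 'k set)"
  by (auto simp: pos_integers_alt intro: algebraic_int_plus totally_positive_add)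

lemma norm_add_ge:
  assumes "\<alpha> \<in> pos_integers" "\<beta> \<in> (pos_integers :: 'k set)"
  shows "field_norm (\<alpha> + \<beta>) \<ge> 2 ^ card E"
proof -
  have pos: "\<sigma> \<alpha> > 0" "\<sigma> \<beta> > 0" if "\<sigma> \<in> E" for \<sigma>
    using assms that by (auto simp: pos_integers_alt totally_positive_alt)
  have N: "field_norm \<alpha> \<ge> 1" "field_norm \<beta> \<ge> 1"
    using norm_ge_1[of \<alpha>] norm_ge_1[of \<beta>] norm_pos[of \<alpha>] norm_pos[of \<beta>] assms
    by (auto simp: pos_integers_alt totally_positive_nonzero)
  have "(2 ^ card E)\<^sup>2 = (4 :: real) ^ card E" by (simp add: power2_eq_square flip: power_mult_distrib)
  also have "\<dots> \<le> 4 ^ card E * (field_norm \<alpha> * field_norm \<beta>)"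
  proof -
    have "1 * 1 \<le> field_norm \<alpha> * field_norm \<beta>" by (intro mult_mono) (use N in auto)
    then show ?thesis by simp
  qed
  also have "\<dots> = (\<Prod>\<sigma>\<in>E. 4 * (\<sigma> \<alpha> * \<sigma> \<beta>))" by (simp add: field_norm_alt prod.distrib)
  also have "\<dots> \<le> (\<Prod>\<sigma>\<in>E. (\<sigma> (\<alpha> + \<beta>))\<^sup>2)"
  proof (intro prod_mono conjI)
    fix \<sigma> assume \<sigma>: "\<sigma> \<in> E"
    show "0 \<le> 4 * (\<sigma> \<alpha> * \<sigma> \<beta>)" using pos[OF \<sigma>] by simp
    have "0 \<le> (\<sigma> \<alpha> - \<sigma> \<beta>)\<^sup>2" by simp
    then show "4 * (\<sigma> \<alpha> * \<sigma> \<beta>) \<le> (\<sigma> (\<alpha> + \<beta>))\<^sup>2"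
      by (simp add: emb_add[OF E_embedding[OF \<sigma>]] power2_eq_square algebra_simps)
  qed
  also have "\<dots> = (field_norm (\<alpha> + \<beta>))\<^sup>2" by (simp add: field_norm_alt prod_power_distrib)
  finally have "2 ^ card E \<le> \<bar>field_norm (\<alpha> + \<beta>)\<bar>"
    by (metis abs_le_square_iff abs_of_nonneg zero_le_numeral zero_le_power)
  then show ?thesis
    using norm_pos[of "\<alpha> + \<beta>"] pos_integers_add[OF assms] by (simp add: pos_integers_alt)
qed

lemma small_norm_indecomposable:
  assumes "\<alpha> \<in> (pos_integers :: 'k set)" "field_norm \<alpha> < 2 ^ card E"
  shows "indecomposable \<alpha>"
proof -
  have "\<alpha> \<noteq> \<beta> + \<gamma>" if "\<beta> \<in> pos_integers" "\<gamma> \<in> pos_integers" for \<beta> \<gamma>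
    using norm_add_ge[OF that] assms(2) by auto
  then show ?thesis using assms(1) unfolding indecomposable_def by blast
qed

text \<open>The absolute norm as a natural number, to make multiplicities of primes available; the
  rounding is exact on integers.\<close>

definition nat_norm :: "'k \<Rightarrow> nat" where
  "nat_norm x = nat \<lfloor>\<bar>field_norm x\<bar>\<rfloor>"

lemma nat_norm: "algebraic_int x \<Longrightarrow> real (nat_norm x) = \<bar>field_norm x\<bar>"
  by (erule norm_int) (simp add: nat_norm_def)

lemma nat_norm_mult: "algebraic_int x \<Longrightarrow> algebraic_int y \<Longrightarrow> nat_norm (x * y) = nat_norm x * nat_norm y"
  using nat_norm[of x] nat_norm[of y] nat_norm[OF algebraic_int_times, of x y]
  by (metis abs_mult norm_mult of_nat_eq_iff of_nat_mult)

lemma nat_norm_square: "algebraic_int x \<Longrightarrow> nat_norm (x\<^sup>2) = (nat_norm x)\<^sup>2"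
  by (simp add: power2_eq_square nat_norm_mult)

lemma nat_norm_pos: "algebraic_int x \<Longrightarrow> x \<noteq> 0 \<Longrightarrow> nat_norm x > 0"
  using norm_ge_1[of x] nat_norm[of x] by linarith

lemma nat_norm_unit: "int_unit u \<Longrightarrow> nat_norm u = 1"
  by (simp add: int_unit_iff_norm nat_norm_def)

lemma nat_norm_of_nat: "nat_norm (of_nat n) = n ^ card E"
  using norm_of_int[of "int n"] by (simp add: nat_norm_def) (metis nat_int of_int_of_nat_eq floor_of_int of_nat_power)

lemma nat_norm_totally_positive:
  "algebraic_int \<alpha> \<Longrightarrow> totally_positive \<alpha> \<Longrightarrow> real (nat_norm \<alpha>) = field_norm \<alpha>"
  using nat_norm[of \<alpha>] norm_pos[of \<alpha>] by simp

lemma int_unitI: "algebraic_int u \<Longrightarrow> algebraic_int v \<Longrightarrow> u * v = 1 \<Longrightarrow> int_unit u"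
  unfolding int_unit_def using inverse_unique[of u v] by auto

section \<open>Decompositions into totally positive integers\<close>

text \<open>Every conjugate of a summand is smaller than that of the sum, so the norm drops and
  splitting terminates.\<close>

lemma sum_of_indecomposables:
  assumes "\<alpha> \<in> (pos_integers :: 'k set)"
  shows "\<exists>ls. (\<forall>l\<in>set ls. indecomposable l) \<and> \<alpha> = sum_list ls"
  using assms
proof (induction "nat_norm \<alpha>" arbitrary: \<alpha> rule: less_induct)
  case less
  have smaller: "nat_norm \<beta> < nat_norm (\<beta> + \<gamma>)" if "\<beta> \<in> pos_integers" "\<gamma> \<in> pos_integers" for \<beta> \<gamma>
  proof -
    have "(\<Prod>\<sigma>\<in>E. \<sigma> \<beta>) < (\<Prod>\<sigma>\<in>E. \<sigma> (\<beta> + \<gamma>))"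
    proof -
      have pos: "0 < \<sigma> \<beta>" "\<sigma> \<beta> < \<sigma> (\<beta> + \<gamma>)" if "\<sigma> \<in> E" for \<sigma>
        using \<open>\<beta> \<in> pos_integers\<close> \<open>\<gamma> \<in> pos_integers\<close> that
        by (auto simp: pos_integers_alt totally_positive_alt emb_add[OF E_embedding[OF that]])
      obtain \<tau> where \<tau>: "\<tau> \<in> E" using E_nonempty by blast
      show ?thesis
        by (rule prod_mono_strict[where f = "\<lambda>\<sigma>. \<sigma> \<beta>" and g = "\<lambda>\<sigma>. \<sigma> (\<beta> + \<gamma>)", OF \<tau> pos(2)[OF \<tau>] finite_E])
          (use pos in \<open>force intro: less_imp_le less_trans\<close>)+
    qed
    then have "real (nat_norm \<beta>) < real (nat_norm (\<beta> + \<gamma>))"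
      using nat_norm_totally_positive[of \<beta>] nat_norm_totally_positive[of "\<beta> + \<gamma>"]
        that pos_integers_add[OF that] by (simp add: pos_integers_alt field_norm_alt)
    then show ?thesis by simp
  qed
  show ?case
  proof (cases "indecomposable \<alpha>")
    case True
    then show ?thesis by (intro exI[of _ "[\<alpha>]"]) simp
  next
    case False
    then obtain \<beta> \<gamma> where \<beta>\<gamma>: "\<beta> \<in> pos_integers" "\<gamma> \<in> pos_integers" "\<alpha> = \<beta> + \<gamma>"
      using less.prems unfolding indecomposable_def by blast
    obtain ls where ls: "\<forall>l\<in>set ls. indecomposable l" "\<beta> = sum_list ls"
      using less.hyps[OF _ \<beta>\<gamma>(1)] smaller[OF \<beta>\<gamma>(1,2)] \<beta>\<gamma>(3) by blast
    obtain ls' where ls': "\<forall>l\<in>set ls'. indecomposable l" "\<gamma> = sum_list ls'"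
      using less.hyps[OF _ \<beta>\<gamma>(2)] smaller[OF \<beta>\<gamma>(2,1)] \<beta>\<gamma>(3) by (metis add.commute)
    show ?thesis
      by (rule exI[of _ "ls @ ls'"]) (use ls ls' \<beta>\<gamma>(3) in auto)
  qed
qed

text \<open>
  In a decomposition \<open>n = \<alpha> + \<beta>\<close> the conjugates of \<open>\<mu> = \<alpha> * \<beta>\<close> lie in \<open>(0, n^2/4]\<close>, where the
  polynomials below are smaller than 1 in absolute value.
\<close>

lemma two_decomposition:
  assumes "\<alpha> \<in> pos_integers" "\<beta> \<in> pos_integers" "\<alpha> + \<beta> = (2 :: 'k)"
  shows "\<alpha> = 1"
proof -
  have \<beta>: "\<beta> = 2 - \<alpha>" using assms(3) by (simp add: algebra_simps)
  define \<mu> where "\<mu> = \<alpha> * \<beta>"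
  have small: "\<bar>\<sigma> (\<mu> * (1 - \<mu>))\<bar> < 1" if \<sigma>: "\<sigma> \<in> E" for \<sigma>
  proof -
    note e = emb_simps[OF E_embedding[OF \<sigma>]]
    have "\<sigma> \<alpha> > 0" "\<sigma> \<beta> > 0" using assms(1,2) \<sigma> by (auto simp: pos_integers_alt totally_positive_alt)
    then have "\<sigma> \<mu> > 0" by (simp add: \<mu>_def e)
    moreover have "1 - \<sigma> \<mu> = (\<sigma> \<alpha> - 1)\<^sup>2" by (simp add: \<mu>_def \<beta> e power2_eq_square algebra_simps)
    then have "\<sigma> \<mu> \<le> 1" by (metis diff_ge_0_iff_ge zero_le_power2)
    ultimately have "0 \<le> \<sigma> \<mu> * (1 - \<sigma> \<mu>)" by simp
    moreover have "\<sigma> \<mu> * (1 - \<sigma> \<mu>) \<le> 1 / 4"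
      using zero_le_power2[of "\<sigma> \<mu> - 1 / 2"] by (simp add: power2_eq_square algebra_simps)
    ultimately have "\<bar>\<sigma> \<mu> * (1 - \<sigma> \<mu>)\<bar> < 1" by linarith
    then show ?thesis by (simp add: e)
  qed
  obtain \<tau> where \<tau>: "\<tau> \<in> E" using E_nonempty by blast
  have "algebraic_int (\<mu> * (1 - \<mu>))"
    using assms(1,2) by (auto simp: \<mu>_def pos_integers_alt intro!: algebraic_int_times algebraic_int_diff)
  then have "\<mu> * (1 - \<mu>) = 0"
    using small \<tau> by (intro conjugates_small_imp_0[of _ \<tau>]) (auto intro: less_imp_le)
  moreover have "\<mu> \<noteq> 0" using assms(1,2) by (auto simp: \<mu>_def pos_integers_alt dest: totally_positive_nonzero)
  ultimately have "\<mu> = 1" by simp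
  then have "(\<alpha> - 1)\<^sup>2 = 0" by (simp add: \<mu>_def \<beta> power2_eq_square algebra_simps)
  then show ?thesis by simp
qed

lemma three_decomposition:
  assumes "\<alpha> \<in> pos_integers" "\<beta> \<in> pos_integers" "\<alpha> + \<beta> = (3 :: 'k)"
  shows "\<alpha> = 1 \<or> \<alpha> = 2 \<or> \<alpha> = (\<alpha> - 1)\<^sup>2"
proof -
  have \<beta>: "\<beta> = 3 - \<alpha>" using assms(3) by (simp add: algebra_simps)
  define \<mu> where "\<mu> = \<alpha> * \<beta>"
  have small: "\<bar>\<sigma> (\<mu> * ((\<mu> - 1) * (\<mu> - 2)))\<bar> < 1" if \<sigma>: "\<sigma> \<in> E" for \<sigma>
  proof -
    note e = emb_simps[OF E_embedding[OF \<sigma>]]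
    define m where "m = \<sigma> \<mu>"
    have "\<sigma> \<alpha> > 0" "\<sigma> \<beta> > 0" using assms(1,2) \<sigma> by (auto simp: pos_integers_alt totally_positive_alt)
    then have m0: "m > 0" by (simp add: m_def \<mu>_def e)
    have "9 / 4 - m = (\<sigma> \<alpha> - 3 / 2)\<^sup>2" by (simp add: m_def \<mu>_def \<beta> e power2_eq_square algebra_simps)
    then have m1: "m \<le> 9 / 4" by (metis diff_ge_0_iff_ge zero_le_power2)
    \<comment> \<open>Completing the square around 3/2. For \<open>m\<close> in [1, 9/4] the product
      is then at most 9/4 * 5/16 = 45/64; below 1 the separate bounds 1/4 for
      \<open>m * (1 - m)\<close> and 2 for the remaining factor give at most 1/2.\<close>
    have a: "\<bar>(m - 1) * (m - 2)\<bar> \<le> 1 \<and> (m \<ge> 1 \<longrightarrow> \<bar>(m - 1) * (m - 2)\<bar> \<le> 5 / 16)" if "m \<ge> 1 / 2"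
    proof -
      have eq: "(m - 1) * (m - 2) = (m - 3 / 2)\<^sup>2 - 1 / 4" by (simp add: power2_eq_square algebra_simps)
      have "0 \<le> (m - 1 / 2) * (5 / 2 - m)" using that m1 by (intro mult_nonneg_nonneg) auto
      also have "\<dots> = 1 - (m - 3 / 2)\<^sup>2" by (simp add: power2_eq_square field_simps)
      finally have q1: "(m - 3 / 2)\<^sup>2 \<le> 1" by simp
      have q2: "(m - 3 / 2)\<^sup>2 \<le> 9 / 16" if "m \<ge> 1"
      proof -
        have "0 \<le> (m - 3 / 4) * (9 / 4 - m)" using that m1 by (intro mult_nonneg_nonneg) auto
        also have "\<dots> = 9 / 16 - (m - 3 / 2)\<^sup>2" by (simp add: power2_eq_square field_simps)
        finally show ?thesis by simp
      qed
      have q0: "(m - 3 / 2)\<^sup>2 \<ge> 0" by simp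
      show ?thesis unfolding eq
      proof (intro conjI impI)
        show "\<bar>(m - 3 / 2)\<^sup>2 - 1 / 4\<bar> \<le> 1" using q0 q1 by linarith
        show "\<bar>(m - 3 / 2)\<^sup>2 - 1 / 4\<bar> \<le> 5 / 16" if "m \<ge> 1" using q0 q2[OF that] by linarith
      qed
    qed
    have "\<bar>m * ((m - 1) * (m - 2))\<bar> < 1"
    proof (cases "m \<ge> 1")
      case True
      then have "\<bar>m\<bar> * \<bar>(m - 1) * (m - 2)\<bar> \<le> 9 / 4 * (5 / 16)" using a m1 by (intro mult_mono) auto
      then show ?thesis by (simp add: abs_mult)
    next
      case False
      have "0 < m * (1 - m)" using m0 False by simp
      moreover have "m * (1 - m) \<le> 1 / 4"
        using zero_le_power2[of "m - 1 / 2"] by (simp add: power2_eq_square algebra_simps)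
      ultimately have "\<bar>m * (1 - m)\<bar> * \<bar>m - 2\<bar> \<le> 1 / 4 * 2" using m0 False by (intro mult_mono) auto
      moreover have "\<bar>m * (1 - m)\<bar> * \<bar>m - 2\<bar> = \<bar>m * ((m - 1) * (m - 2))\<bar>"
        by (simp add: abs_mult abs_minus_commute)
      ultimately show ?thesis by simp
    qed
    then show ?thesis by (simp add: e m_def)
  qed
  obtain \<tau> where \<tau>: "\<tau> \<in> E" using E_nonempty by blast
  have "algebraic_int (\<mu> * ((\<mu> - 1) * (\<mu> - 2)))"
    using assms(1,2) by (auto simp: \<mu>_def pos_integers_alt intro!: algebraic_int_times algebraic_int_diff)
  then have "\<mu> * ((\<mu> - 1) * (\<mu> - 2)) = 0"
    using small \<tau> by (intro conjugates_small_imp_0[of _ \<tau>]) (auto intro: less_imp_le)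
  moreover have "\<mu> \<noteq> 0" using assms(1,2) by (auto simp: \<mu>_def pos_integers_alt dest: totally_positive_nonzero)
  ultimately have "\<mu> = 1 \<or> \<mu> = 2" by simp
  \<comment> \<open>The value 1 of \<mu> gives
    \<open>\<alpha>\<^sup>2 - 3 * \<alpha> + 1 = 0\<close>, which is
    \<open>\<alpha> = (\<alpha> - 1)\<^sup>2\<close>; the value 2 gives the decomposition into 1 and
    2.\<close>
  then show ?thesis
  proof
    assume "\<mu> = 1"
    then have "\<alpha> = (\<alpha> - 1)\<^sup>2" by (simp add: \<mu>_def \<beta> power2_eq_square algebra_simps)
    then show ?thesis by blast
  next
    assume "\<mu> = 2"
    then have "(\<alpha> - 1) * (\<alpha> - 2) = 0" by (simp add: \<mu>_def \<beta> algebra_simps)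
    then show ?thesis by auto
  qed
qed

end

text \<open>
  The form \<open>\<langle>1, \<epsilon>\<rangle> \<perp> L_u\<close>, of which only the set \<open>Q\<close> of values of the unary summand matters:
  any two of these values have a square product.
\<close>

locale universal_unary_sum = totally_real_field K for K :: "'k::field_char_0 itself" +
  fixes \<epsilon> :: 'k and Q :: "'k set"
  assumes unit_eps: "int_unit \<epsilon>"
    and pos_eps: "totally_positive \<epsilon>"
    and eps_nonsquare: "int_unit t \<Longrightarrow> \<epsilon> \<noteq> t\<^sup>2"
    and unit_classes: "int_unit u \<Longrightarrow> totally_positive u \<Longrightarrow> \<exists>t. int_unit t \<and> (u = t\<^sup>2 \<or> u = \<epsilon> * t\<^sup>2)"
    and Q_pos: "q \<in> Q \<Longrightarrow> q = 0 \<or> q \<in> pos_integers"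
    and Q_square: "q \<in> Q \<Longrightarrow> q' \<in> Q \<Longrightarrow> \<exists>b. q * q' = b\<^sup>2"
    and universal: "\<alpha> \<in> pos_integers \<Longrightarrow>
      \<exists>x y q. algebraic_int x \<and> algebraic_int y \<and> q \<in> Q \<and> \<alpha> = x\<^sup>2 + \<epsilon> * y\<^sup>2 + q"
begin

lemma eps_int: "algebraic_int \<epsilon>" and eps_nonzero: "\<epsilon> \<noteq> 0" and eps_inverse_int: "algebraic_int (inverse \<epsilon>)"
  using unit_eps by (auto simp: int_unit_def)

lemma divide_eps_int: "algebraic_int x \<Longrightarrow> algebraic_int (x / \<epsilon>)"
  by (simp add: divide_inverse algebraic_int_times eps_inverse_int)

lemma eps_not_square: "\<epsilon> \<noteq> t\<^sup>2"
proof
  assume t: "\<epsilon> = t\<^sup>2"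
  have "algebraic_int t" using eps_int unfolding t by (rule algebraic_int_square_root)
  moreover have "algebraic_int (inverse t)"
    using eps_inverse_int unfolding t power_inverse[symmetric] by (rule algebraic_int_square_root)
  moreover have "t \<noteq> 0" using t eps_nonzero by auto
  ultimately have "int_unit t" by (simp add: int_unit_def)
  with eps_nonsquare t show False by blast
qed

lemma eps_square_ratio: "\<epsilon> * a\<^sup>2 = b\<^sup>2 \<Longrightarrow> a = 0"
proof (rule ccontr)
  assume *: "\<epsilon> * a\<^sup>2 = b\<^sup>2" "a \<noteq> 0"
  then have "\<epsilon> = (b / a)\<^sup>2" by (simp add: power_divide eq_divide_eq)
  then show False using eps_not_square by blast
qed

lemma term_pos:
  assumes "algebraic_int x"
  shows "x\<^sup>2 = 0 \<or> x\<^sup>2 \<in> pos_integers" "\<epsilon> * x\<^sup>2 = 0 \<or> \<epsilon> * x\<^sup>2 \<in> pos_integers"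
  using assms totally_positive_square[of x] totally_positive_mult[OF pos_eps, of "x\<^sup>2"] eps_int
  by (auto simp: pos_integers_alt intro: algebraic_int_power algebraic_int_times)

lemma pos_integers_divide_eps: "\<alpha> \<in> pos_integers \<Longrightarrow> \<alpha> / \<epsilon> \<in> pos_integers"
  using pos_eps by (auto simp: pos_integers_alt divide_eps_int totally_positive_divide)

lemma pos_integers_mult_eps: "\<alpha> \<in> pos_integers \<Longrightarrow> \<epsilon> * \<alpha> \<in> pos_integers"
  using pos_eps eps_int by (auto simp: pos_integers_alt algebraic_int_times totally_positive_mult)

lemma indecomposable_mult_eps:
  assumes "indecomposable \<mu>"
  shows "indecomposable (\<epsilon> * \<mu>)"
  unfolding indecomposable_def
proof (intro conjI notI)
  show "\<epsilon> * \<mu> \<in> pos_integers" using assms by (simp add: indecomposable_def pos_integers_mult_eps)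
  assume "\<exists>\<alpha>\<in>pos_integers. \<exists>\<beta>\<in>pos_integers. \<epsilon> * \<mu> = \<alpha> + \<beta>"
  then obtain \<alpha> \<beta> where ab: "\<alpha> \<in> pos_integers" "\<beta> \<in> pos_integers" "\<epsilon> * \<mu> = \<alpha> + \<beta>" by blast
  from ab(3) have "\<mu> = \<alpha> / \<epsilon> + \<beta> / \<epsilon>" using eps_nonzero by (simp add: field_simps)
  with assms ab(1,2) show False unfolding indecomposable_def by (metis pos_integers_divide_eps)
qed

lemma indecomposable_sum3:
  assumes "indecomposable (\<mu> :: 'k)" "\<mu> = a + b + c"
    "a = 0 \<or> a \<in> pos_integers" "b = 0 \<or> b \<in> pos_integers" "c = 0 \<or> c \<in> pos_integers"
  shows "\<mu> = a \<or> \<mu> = b \<or> \<mu> = c"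
proof -
  have ind: "\<mu> \<noteq> \<alpha> + \<beta>" if "\<alpha> \<in> pos_integers" "\<beta> \<in> pos_integers" for \<alpha> \<beta>
    using assms(1) that unfolding indecomposable_def by blast
  have "\<not> (a \<in> pos_integers \<and> b \<in> pos_integers \<and> c \<in> pos_integers)"
    using ind[of "a + b" c] pos_integers_add assms(2) by blast
  with assms(2-5) ind[of a b] ind[of a c] ind[of b c] show ?thesis by (auto simp: add.assoc)
qed

lemma indecomposable_representation:
  assumes "indecomposable \<mu>"
  shows "integer_square \<mu> \<or> integer_square (\<epsilon> * \<mu>) \<or> \<mu> \<in> Q"
proof -
  have "\<mu> \<in> pos_integers" using assms by (simp add: indecomposable_def)
  from universal[OF this] obtain x y q where
    r: "algebraic_int x" "algebraic_int y" "q \<in> Q" "\<mu> = x\<^sup>2 + \<epsilon> * y\<^sup>2 + q" by blast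
  from indecomposable_sum3[OF assms r(4) term_pos(1)[OF r(1)] term_pos(2)[OF r(2)] Q_pos[OF r(3)]]
  consider "\<mu> = x\<^sup>2" | "\<mu> = \<epsilon> * y\<^sup>2" | "\<mu> = q" by blast
  then show ?thesis
  proof cases
    case 1
    then show ?thesis using r(1) unfolding integer_square_alt by blast
  next
    case 2
    then have "\<epsilon> * \<mu> = (\<epsilon> * y)\<^sup>2" by (simp add: power2_eq_square)
    then show ?thesis using algebraic_int_times[OF eps_int r(2)] unfolding integer_square_alt by blast
  qed (use r(3) in simp)
qed

lemma integer_square_eps_eps: "integer_square (\<epsilon> * (\<epsilon> * \<mu>)) \<Longrightarrow> integer_square \<mu>"
proof -
  assume "integer_square (\<epsilon> * (\<epsilon> * \<mu>))"
  then obtain x where x: "algebraic_int x" "\<epsilon> * (\<epsilon> * \<mu>) = x\<^sup>2" by (auto simp: integer_square_alt)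
  then have "\<mu> = (x / \<epsilon>)\<^sup>2" using eps_nonzero by (simp add: field_simps power2_eq_square)
  then show ?thesis using divide_eps_int[OF x(1)] unfolding integer_square_alt by blast
qed

theorem indecomposable_square:
  assumes "indecomposable \<mu>"
  shows "integer_square \<mu> \<or> integer_square (\<epsilon> * \<mu>)"
proof (rule ccontr)
  assume no: "\<not> ?thesis"
  have "\<mu> \<in> Q" using indecomposable_representation[OF assms] no by blast
  moreover have "\<epsilon> * \<mu> \<in> Q"
    using indecomposable_representation[OF indecomposable_mult_eps[OF assms]] no integer_square_eps_eps by blast
  ultimately obtain b where "\<epsilon> * \<mu>\<^sup>2 = b\<^sup>2" using Q_square by (metis mult.assoc power2_eq_square)
  then have "\<mu> = 0" by (rule eps_square_ratio)
  then show False using assms totally_positive_nonzero by (auto simp: indecomposable_def pos_integers_alt)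
qed

section \<open>Square roots of elements of small norm, and the descent\<close>

lemma small_norm_square:
  assumes "algebraic_int \<alpha>" "totally_positive \<alpha>" "nat_norm \<alpha> < 2 ^ card E"
  obtains y where "algebraic_int y" "\<alpha> = y\<^sup>2 \<or> \<alpha> = \<epsilon> * y\<^sup>2" "nat_norm \<alpha> = (nat_norm y)\<^sup>2"
proof -
  have "real (nat_norm \<alpha>) < 2 ^ card E" using assms(3) by (metis of_nat_less_iff of_nat_numeral of_nat_power)
  then have "indecomposable \<alpha>"
    using assms by (intro small_norm_indecomposable) (simp_all add: pos_integers_alt nat_norm_totally_positive)
  from indecomposable_square[OF this] show ?thesis
  proof
    assume "integer_square \<alpha>"
    then obtain y where "algebraic_int y" "\<alpha> = y\<^sup>2" by (auto simp: integer_square_alt)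
    then show ?thesis by (intro that[of y]) (auto simp: nat_norm_square)
  next
    assume "integer_square (\<epsilon> * \<alpha>)"
    then obtain x where x: "algebraic_int x" "\<epsilon> * \<alpha> = x\<^sup>2" by (auto simp: integer_square_alt)
    define y where "y = x / \<epsilon>"
    have y: "algebraic_int y" unfolding y_def by (rule divide_eps_int[OF x(1)])
    have "\<alpha> = \<epsilon> * y\<^sup>2" using x(2) eps_nonzero by (simp add: y_def field_simps power2_eq_square)
    moreover from this have "nat_norm \<alpha> = (nat_norm y)\<^sup>2"
      using y eps_int unit_eps by (simp add: nat_norm_mult nat_norm_square nat_norm_unit algebraic_int_power)
    ultimately show ?thesis using y by (intro that[of y]) auto
  qed
qed

lemma pos_associate_square_root:
  assumes "algebraic_int z" "pos_associate z" "nat_norm z < 2 ^ card E"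
  obtains y where "algebraic_int y" "nat_norm z = (nat_norm y)\<^sup>2"
proof -
  obtain u where u: "int_unit u" "totally_positive (u * z)" using assms(2) by (auto simp: pos_associate_def)
  then have "algebraic_int u" by (simp add: int_unit_def)
  then have "nat_norm (u * z) = nat_norm z" using assms(1) nat_norm_unit[OF u(1)] by (simp add: nat_norm_mult)
  with small_norm_square[of "u * z"] u(2) \<open>algebraic_int u\<close> assms that show ?thesis
    by (metis algebraic_int_times)
qed

text \<open>
  Descent: one of \<open>x\<close>, \<open>x * s\<close> has a totally positive associate of small norm, hence is associated to a
  square; passing to the square root halves the odd part of the norm.
\<close>

lemma norm_power_of_two:
  assumes s: "algebraic_int s" "s \<noteq> 0" "\<not> pos_associate s" "nat_norm s = 2 ^ j" "2 * j \<le> card E"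
    and x: "algebraic_int x" "x \<noteq> 0" "nat_norm x * nat_norm s < 2 ^ card E"
  shows "\<exists>m. nat_norm x = 2 ^ m"
proof (rule power_of_two_nat)
  show "nat_norm x > 0" using x by (intro nat_norm_pos)
  fix p :: nat assume p: "prime p" "p dvd nat_norm x"
  show "p = 2"
  proof (rule ccontr)
    assume "p \<noteq> 2"
    have "multiplicity p (nat_norm x) = 0" using x
    proof (induction "multiplicity p (nat_norm x)" arbitrary: x rule: less_induct)
      case less
      note x = less.prems
      define z where "z = (if pos_associate x then x else x * s)"
      have z: "algebraic_int z" "z \<noteq> 0" "pos_associate z"
        using x s pos_associate_mult[OF unit_classes unit_eps, of x s]
        by (auto simp: z_def intro: algebraic_int_times)
      have "nat_norm s \<ge> 1" using s(4) by simp
      then have norm_z: "nat_norm z = nat_norm x \<or> nat_norm z = nat_norm x * nat_norm s"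
        and z_le: "nat_norm z \<le> nat_norm x * nat_norm s"
        using x s(1) by (auto simp: z_def nat_norm_mult)
      have z_less: "nat_norm z < 2 ^ card E" using z_le x(3) by simp
      obtain y where y: "algebraic_int y" "nat_norm z = (nat_norm y)\<^sup>2"
        using pos_associate_square_root[OF z(1,3) z_less] by blast
      have ny: "nat_norm y > 0" using y(2) nat_norm_pos[OF z(1,2)] by (cases "nat_norm y") auto
      then have y0: "y \<noteq> 0" using norm_eq_0_iff[of 0] by (auto simp: nat_norm_def)
      have "multiplicity p (nat_norm z) = multiplicity p (nat_norm x)"
      proof -
        have "multiplicity p (nat_norm x * 2 ^ j) = multiplicity p (nat_norm x) + multiplicity p (2 ^ j)"
          using p(1) nat_norm_pos[OF x(1,2)] by (intro prime_elem_multiplicity_mult_distrib) auto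
        moreover have "multiplicity p ((2 :: nat) ^ j) = 0"
          using p(1) \<open>p \<noteq> 2\<close> by (intro not_dvd_imp_multiplicity_0)
            (metis prime_dvd_power primes_dvd_imp_eq two_is_prime_nat)
        ultimately show ?thesis using norm_z s(4) by auto
      qed
      moreover have "multiplicity p (nat_norm z) = 2 * multiplicity p (nat_norm y)"
        unfolding y(2) using p(1) ny by (simp add: prime_elem_multiplicity_power_distrib)
      ultimately have mult: "multiplicity p (nat_norm x) = 2 * multiplicity p (nat_norm y)" by simp
      \<comment> \<open>The invariant survives because the squared product is
        \<open>nat_norm z * (nat_norm s)\<^sup>2\<close>, with first factor below and second factor
        at most \<open>2 ^ card E\<close>; this is where \<open>2 * j \<le> card E\<close>
        enters.\<close>
      have "nat_norm y * nat_norm s < 2 ^ card E"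
      proof -
        have "(nat_norm s)\<^sup>2 \<le> 2 ^ card E"
          unfolding s(4) power_mult[symmetric] using s(5) by (intro power_increasing) (auto simp: mult.commute)
        moreover have "nat_norm s > 0" using s(4) by simp
        ultimately have "nat_norm z * (nat_norm s)\<^sup>2 < 2 ^ card E * 2 ^ card E"
          using z_less by (intro mult_less_le_imp_less) auto
        then have "(nat_norm y * nat_norm s)\<^sup>2 < (2 ^ card E)\<^sup>2"
          by (simp add: y(2) power2_eq_square mult_ac)
        then show ?thesis by (rule power2_less_imp_less) simp
      qed
      then show ?case using less.hyps[OF _ y(1) y0] mult by (cases "multiplicity p (nat_norm x) = 0") auto
    qed
    moreover have "multiplicity p (nat_norm x) > 0"
      using p nat_norm_pos[OF x(1,2)] by (simp add: prime_multiplicity_gt_zero_iff)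
    ultimately show False by simp
  qed
qed

text \<open>As long as there is a totally positive associate, the norm is a square and a root with
  half the exponent takes over; an odd exponent ends this at the latest. The last clause records
  that a first root was taken, which halves the exponent in the argument against sqrt 2.\<close>

lemma signature_obstruction:
  assumes "algebraic_int g" "nat_norm g = 2 ^ j" "1 \<le> j" "j < card E"
  shows "\<exists>s k. algebraic_int s \<and> s \<noteq> 0 \<and> \<not> pos_associate s \<and> nat_norm s = 2 ^ k \<and> 1 \<le> k \<and> k \<le> j \<and>
    (pos_associate g \<longrightarrow> 2 * k \<le> j)"
  using assms
proof (induction j arbitrary: g rule: less_induct)
  case (less j)
  have "g \<noteq> 0" using less.prems(2) norm_eq_0_iff[of 0] by (auto simp: nat_norm_def)
  show ?case
  proof (cases "pos_associate g")
    case False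
    with less.prems \<open>g \<noteq> 0\<close> show ?thesis by (intro exI[of _ g] exI[of _ j]) auto
  next
    case True
    have "nat_norm g < 2 ^ card E" unfolding less.prems(2) using less.prems(4) by simp
    then obtain y where y: "algebraic_int y" "nat_norm g = (nat_norm y)\<^sup>2"
      using pos_associate_square_root[OF less.prems(1) True] by blast
    then obtain i where i: "nat_norm y = 2 ^ i" "j = 2 * i"
      using square_eq_prime_power_nat[of 2 "nat_norm y" j] less.prems(2) two_is_prime_nat by metis
    have "i < j" "1 \<le> i" "i < card E" using i(2) less.prems by auto
    from less.IH[OF this(1) y(1) i(1) this(2,3)] obtain s k where
      "algebraic_int s" "s \<noteq> 0" "\<not> pos_associate s" "nat_norm s = 2 ^ k" "1 \<le> k" "k \<le> i" by blast
    then show ?thesis using i(2) by (intro exI[of _ s] exI[of _ k]) auto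
  qed
qed

section \<open>Representations of 2, 3 and their multiples by the unit\<close>

text \<open>If neither is a square, the unary summand contributes 1 or 2 to 2, and \<epsilon> or 2
  \<epsilon> to 2 \<epsilon>. The product of the two contributions is \<epsilon>, 2 \<epsilon> or 4
  \<epsilon>, never a square.\<close>

lemma two_or_two_eps_square: "(\<exists>t :: 'k. 2 = t\<^sup>2) \<or> (\<exists>t. 2 * \<epsilon> = t\<^sup>2)"
proof (rule ccontr)
  assume no: "\<not> ?thesis"
  have one_ind: "indecomposable (1 :: 'k)"
    using totally_positive_of_nat[of 1] card_E_pos
    by (intro small_norm_indecomposable) (auto simp: pos_integers_alt norm_1)
  have two: "1 + 1 = (2 :: 'k)" by simp
  have two_pos: "(2 :: 'k) \<in> pos_integers"
    using totally_positive_of_nat[of 2] by (simp add: pos_integers_alt)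
  have parts: "(a = 2 \<or> b = 2 \<or> c = 2) \<or> (a = 1 \<and> b = 1 \<and> c = 0) \<or> (a = 1 \<and> b = 0 \<and> c = 1) \<or> (a = 0 \<and> b = 1 \<and> c = 1)"
    if abc: "a + b + c = 2" "a = 0 \<or> a \<in> pos_integers" "b = 0 \<or> b \<in> pos_integers" "c = 0 \<or> c \<in> pos_integers"
    for a b c :: 'k
  proof -
    have three: "\<not> (a \<in> pos_integers \<and> b \<in> pos_integers \<and> c \<in> pos_integers)"
    proof
      assume *: "a \<in> pos_integers \<and> b \<in> pos_integers \<and> c \<in> pos_integers"
      then have "1 = a + b" using two_decomposition[of "a + b" c] abc(1) pos_integers_add by metis
      then show False using one_ind * unfolding indecomposable_def by blast
    qed
    have pair: "x = 1 \<and> y = 1" if "x \<in> pos_integers" "y \<in> pos_integers" "x + y = 2" for x y :: 'k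
      using two_decomposition[of x y] two_decomposition[of y x] that by (simp add: add.commute)
    show ?thesis
      using three abc(2-4) pair[of a b] pair[of a c] pair[of b c] abc(1) by (elim disjE) simp_all
  qed
  obtain x y q where r: "algebraic_int x" "algebraic_int y" "q \<in> Q" "2 = x\<^sup>2 + \<epsilon> * y\<^sup>2 + q"
    using universal[OF two_pos] by blast
  have "q = 1 \<or> q = 2"
  proof -
    have "2 \<noteq> \<epsilon> * y\<^sup>2" using no by (metis mult.assoc mult.commute power2_eq_square)
    moreover have "\<epsilon> * y\<^sup>2 \<noteq> 1" using eps_square_ratio[of y 1] by auto
    moreover have "2 \<noteq> x\<^sup>2" using no by blast
    ultimately show ?thesis
      using parts[OF r(4)[symmetric] term_pos(1)[OF r(1)] term_pos(2)[OF r(2)] Q_pos[OF r(3)]] by metis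
  qed
  obtain x' y' q' where r': "algebraic_int x'" "algebraic_int y'" "q' \<in> Q" "\<epsilon> * 2 = x'\<^sup>2 + \<epsilon> * y'\<^sup>2 + q'"
    using universal[OF pos_integers_mult_eps[OF two_pos]] by blast
  have "q' = \<epsilon> \<or> q' = \<epsilon> * 2"
  proof -
    have sum: "x'\<^sup>2 / \<epsilon> + y'\<^sup>2 + q' / \<epsilon> = 2" using r'(4) eps_nonzero by (simp add: field_simps)
    have "x'\<^sup>2 / \<epsilon> = 0 \<or> x'\<^sup>2 / \<epsilon> \<in> pos_integers" "q' / \<epsilon> = 0 \<or> q' / \<epsilon> \<in> pos_integers"
      using term_pos(1)[OF r'(1)] Q_pos[OF r'(3)] pos_integers_divide_eps by auto
    note p = parts[OF sum this(1) term_pos(1)[OF r'(2)] this(2)]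
    have "x'\<^sup>2 / \<epsilon> \<noteq> 2" using no eps_nonzero by (metis mult.commute nonzero_eq_divide_eq)
    moreover have "x'\<^sup>2 / \<epsilon> \<noteq> 1" using eps_not_square[of x'] eps_nonzero by auto
    moreover have "2 \<noteq> y'\<^sup>2" using no by blast
    ultimately have "q' / \<epsilon> = 1 \<or> q' / \<epsilon> = 2" using p by metis
    then show ?thesis using eps_nonzero by (auto simp: field_simps)
  qed
  obtain b where b: "q * q' = b\<^sup>2" using Q_square[OF r(3) r'(3)] by blast
  have "\<epsilon> = b\<^sup>2 \<or> 2 * \<epsilon> = b\<^sup>2 \<or> \<epsilon> * 2\<^sup>2 = b\<^sup>2"
    using b \<open>q = 1 \<or> q = 2\<close> \<open>q' = \<epsilon> \<or> q' = \<epsilon> * 2\<close> by (auto simp: mult.commute)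
  then show False using eps_not_square no eps_square_ratio[of 2 b] by auto
qed

text \<open>With sqrt 2 available, every proper part of 3 is a square. Unless the claim holds, the
  unary summand therefore contributes 3 or a nonzero square to 3, and \<epsilon> times such a number
  to 3 \<epsilon>; no product of the two is a square.\<close>

lemma three_or_three_eps_square:
  assumes r: "r\<^sup>2 = (2 :: 'k)"
  shows "\<exists>c. 3 = c\<^sup>2 \<or> 3 = \<epsilon> * c\<^sup>2"
proof (rule ccontr)
  assume no: "\<not> ?thesis"
  have three_pos: "(3 :: 'k) \<in> pos_integers"
    using totally_positive_of_nat[of 3] by (simp add: pos_integers_alt)
  have part: "\<exists>z. z \<noteq> 0 \<and> a = z\<^sup>2"
    if a: "a \<in> pos_integers" "a \<noteq> 3" "b = 0 \<or> b \<in> pos_integers" "c = 0 \<or> c \<in> pos_integers" "a + b + c = 3"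
    for a b c :: 'k
  proof -
    have sum: "a + (b + c) = 3" using a(5) by (simp add: add.assoc)
    have "b + c \<noteq> 0" using a(2) sum by auto
    then have "b + c \<in> pos_integers" using a(3,4) pos_integers_add by auto
    then have "a = 1 \<or> a = 2 \<or> a = (a - 1)\<^sup>2" using three_decomposition[OF a(1) _ sum] by blast
    then have "\<exists>z. a = z\<^sup>2" using r by (metis one_power2)
    moreover have "a \<noteq> 0" using a(1) by (auto simp: pos_integers_alt dest: totally_positive_nonzero)
    ultimately show ?thesis by auto
  qed
  obtain x y q where r: "algebraic_int x" "algebraic_int y" "q \<in> Q" "3 = x\<^sup>2 + \<epsilon> * y\<^sup>2 + q"
    using universal[OF three_pos] by blast
  note t = term_pos(1)[OF r(1)] term_pos(2)[OF r(2)] Q_pos[OF r(3)]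
  have q: "q = 3 \<or> (\<exists>z. z \<noteq> 0 \<and> q = z\<^sup>2)"
  proof -
    have "\<epsilon> * y\<^sup>2 \<notin> pos_integers"
    proof
      assume "\<epsilon> * y\<^sup>2 \<in> pos_integers"
      moreover have "\<epsilon> * y\<^sup>2 \<noteq> 3" using no by metis
      moreover have "\<epsilon> * y\<^sup>2 + x\<^sup>2 + q = 3" using r(4) by (simp add: add.commute)
      ultimately obtain z where "z \<noteq> 0" "\<epsilon> * y\<^sup>2 = z\<^sup>2" using part t(1,3) by blast
      then show False using eps_square_ratio[of y z] by auto
    qed
    then have "\<epsilon> * y\<^sup>2 = 0" using t(2) by blast
    then have sum: "q + x\<^sup>2 + 0 = 3" using r(4) by (metis add.commute add.right_neutral)
    have "q \<noteq> 0" using sum no by auto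
    then have "q \<in> pos_integers" using t(3) by blast
    then show ?thesis using part[OF _ _ t(1) _ sum] by blast
  qed
  obtain x' y' q' where r': "algebraic_int x'" "algebraic_int y'" "q' \<in> Q" "\<epsilon> * 3 = x'\<^sup>2 + \<epsilon> * y'\<^sup>2 + q'"
    using universal[OF pos_integers_mult_eps[OF three_pos]] by blast
  have t': "x'\<^sup>2 / \<epsilon> = 0 \<or> x'\<^sup>2 / \<epsilon> \<in> pos_integers" "y'\<^sup>2 = 0 \<or> y'\<^sup>2 \<in> pos_integers"
    "q' / \<epsilon> = 0 \<or> q' / \<epsilon> \<in> pos_integers"
    using term_pos(1)[OF r'(1)] term_pos(1)[OF r'(2)] Q_pos[OF r'(3)] pos_integers_divide_eps by auto
  have sum': "x'\<^sup>2 / \<epsilon> + y'\<^sup>2 + q' / \<epsilon> = 3" using r'(4) eps_nonzero by (simp add: field_simps)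
  have q': "q' = \<epsilon> * 3 \<or> (\<exists>z. z \<noteq> 0 \<and> q' = \<epsilon> * z\<^sup>2)"
  proof -
    have "x'\<^sup>2 / \<epsilon> \<notin> pos_integers"
    proof
      assume "x'\<^sup>2 / \<epsilon> \<in> pos_integers"
      moreover have "x'\<^sup>2 / \<epsilon> \<noteq> 3"
      proof
        assume "x'\<^sup>2 / \<epsilon> = 3"
        then have "3 = \<epsilon> * (x' / \<epsilon>)\<^sup>2" using eps_nonzero by (simp add: power2_eq_square)
        with no show False by blast
      qed
      ultimately obtain z where "z \<noteq> 0" "x'\<^sup>2 / \<epsilon> = z\<^sup>2" using part t'(2,3) sum' by blast
      then show False using eps_square_ratio[of z x'] eps_nonzero by (auto simp: field_simps)
    qed
    then have "x'\<^sup>2 / \<epsilon> = 0" using t'(1) by blast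
    then have sum: "q' / \<epsilon> + y'\<^sup>2 + 0 = 3" using sum' by (metis add.commute add.right_neutral)
    have "q' / \<epsilon> \<noteq> 0" using sum no by auto
    then have "q' / \<epsilon> \<in> pos_integers" using t'(3) by blast
    then have "q' / \<epsilon> = 3 \<or> (\<exists>z. z \<noteq> 0 \<and> q' / \<epsilon> = z\<^sup>2)" using part[OF _ _ t'(2) _ sum] by blast
    then show ?thesis using eps_nonzero by (auto simp: field_simps)
  qed
  obtain b where b: "q * q' = b\<^sup>2" using Q_square[OF r(3) r'(3)] by blast
  have three_eps: False if "\<epsilon> * 3 * z\<^sup>2 = b\<^sup>2" "z \<noteq> 0" for z b
  proof -
    have "3 = \<epsilon> * (b / (\<epsilon> * z))\<^sup>2"
      using that eps_nonzero by (simp add: power_divide power_mult_distrib power2_eq_square field_simps)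
    with no show False by blast
  qed
  from q q' consider "\<epsilon> * 3\<^sup>2 = b\<^sup>2" | z where "z \<noteq> 0" "\<epsilon> * 3 * z\<^sup>2 = b\<^sup>2" | z where "z \<noteq> 0" "\<epsilon> * z\<^sup>2 = b\<^sup>2"
  proof (elim disjE exE conjE)
    assume "q = 3" "q' = \<epsilon> * 3"
    with b that(1) show ?thesis by (simp add: power2_eq_square algebra_simps)
  next
    fix z assume "q = 3" "z \<noteq> 0" "q' = \<epsilon> * z\<^sup>2"
    with b that(2)[of z] show ?thesis by (simp add: algebra_simps)
  next
    fix z assume "z \<noteq> 0" "q = z\<^sup>2" "q' = \<epsilon> * 3"
    with b that(2)[of z] show ?thesis by (simp add: algebra_simps)
  next
    fix z w assume "z \<noteq> 0" "q = z\<^sup>2" "w \<noteq> 0" "q' = \<epsilon> * w\<^sup>2"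
    with b that(3)[of "z * w"] show ?thesis by (simp add: power_mult_distrib algebra_simps)
  qed
  then show False
    using eps_square_ratio[of 3 b] eps_square_ratio three_eps by cases auto
qed

end

section \<open>Excluding a square root of 2\<close>

lemma sqrt2_irrational: "sqrt 2 \<notin> \<rat>"
proof
  assume "sqrt 2 \<in> \<rat>"
  then have "sqrt 2 \<in> \<int>" by (intro rational_algebraic_int_is_int) auto
  then obtain n where n: "sqrt 2 = of_int n" by (auto elim: Ints_cases)
  have "1 < sqrt 2" "sqrt 2 < 2" by (auto intro: real_less_lsqrt)
  then have "1 < n \<and> n < 2" by (simp add: n)
  then show False by linarith
qed

lemma sqrt2_rational_coefficient:
  assumes "a + b * sqrt 2 \<in> \<rat>" "a \<in> \<rat>" "b \<in> \<rat>"
  shows "b = 0"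
proof (rule ccontr)
  assume "b \<noteq> 0"
  have "(a + b * sqrt 2 - a) / b \<in> \<rat>" using assms by (intro Rats_divide Rats_diff)
  also have "(a + b * sqrt 2 - a) / b = sqrt 2" using \<open>b \<noteq> 0\<close> by simp
  finally show False using sqrt2_irrational by simp
qed

lemma int_square_eq_twice_square:
  assumes "(P :: int)\<^sup>2 = 2 * Q\<^sup>2"
  shows "Q = 0"
proof (rule ccontr)
  assume "Q \<noteq> 0"
  have "sqrt (real_of_int (P\<^sup>2)) = sqrt (real_of_int (2 * Q\<^sup>2))" using assms by simp
  then have "\<bar>real_of_int P\<bar> = sqrt 2 * \<bar>real_of_int Q\<bar>" by (simp add: real_sqrt_mult)
  then have "sqrt 2 = \<bar>real_of_int P\<bar> / \<bar>real_of_int Q\<bar>" using \<open>Q \<noteq> 0\<close> by simp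
  also have "\<dots> \<in> \<rat>" by simp
  finally show False using sqrt2_irrational by simp
qed

lemma odd_prime_power_not_power_of_two:
  assumes "prime (p :: nat)" "p \<noteq> 2" "p ^ f = 2 ^ m" "f > 0"
  shows False
proof -
  have "p dvd 2 ^ m" using assms(3,4) by (metis dvd_power)
  then show False using assms(1,2) by (metis prime_dvd_power primes_dvd_imp_eq two_is_prime_nat)
qed

context totally_real_field
begin

text \<open>
  The conjugates of \<open>b = sqrt (3 * (2 + sqrt 2))\<close> are equally distributed, because the traces of
  \<open>sqrt 2\<close> and \<open>b\<close> are rational.
\<close>

lemma norm_seven:
  assumes r: "r\<^sup>2 = (2 :: 'k)" and b: "b\<^sup>2 = 3 * (2 + r)" and f: "card E = 4 * f"
  shows "field_norm (3 + r + b) = 7 ^ f"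
proof -
  define b1 where "b1 = sqrt (6 + 3 * sqrt 2)"
  define b2 where "b2 = sqrt (6 - 3 * sqrt 2)"
  have sqrt2: "sqrt 2 < 2" "sqrt 2 > 0" by (auto intro: real_less_lsqrt)
  have b1: "b1\<^sup>2 = 6 + 3 * sqrt 2" "b1 > 0" and b2: "b2\<^sup>2 = 6 - 3 * sqrt 2" "b2 > 0"
    using sqrt2 by (auto simp: b1_def b2_def intro: add_pos_nonneg)
  have b12: "b1 * b2 = 3 * sqrt 2"
  proof -
    have "(b1 * b2)\<^sup>2 = (3 * sqrt 2)\<^sup>2"
      unfolding power_mult_distrib b1(1) b2(1) by (simp add: algebra_simps power2_eq_square)
    then show ?thesis by (rule power2_eq_imp_eq) (use b1(2) b2(2) in auto)
  qed
  \<comment> \<open>The four possible pairs of values of \<open>r\<close> and \<open>b\<close>; the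
    aim is that each is taken by a quarter of the embeddings.\<close>
  define A where "A = {\<sigma> \<in> E. \<sigma> r = sqrt 2 \<and> \<sigma> b = b1}"
  define B where "B = {\<sigma> \<in> E. \<sigma> r = sqrt 2 \<and> \<sigma> b = - b1}"
  define C where "C = {\<sigma> \<in> E. \<sigma> r = - sqrt 2 \<and> \<sigma> b = b2}"
  define D where "D = {\<sigma> \<in> E. \<sigma> r = - sqrt 2 \<and> \<sigma> b = - b2}"
  have fin: "finite A" "finite B" "finite C" "finite D" using finite_E by (auto simp: A_def B_def C_def D_def)
  have disj: "A \<inter> B = {}" "(A \<union> B) \<inter> C = {}" "(A \<union> B \<union> C) \<inter> D = {}"
    using b1(2) b2(2) sqrt2 by (auto simp: A_def B_def C_def D_def)
  have E: "E = A \<union> B \<union> C \<union> D"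
  proof -
    have "\<sigma> \<in> A \<union> B \<union> C \<union> D" if \<sigma>: "\<sigma> \<in> E" for \<sigma>
    proof -
      note e = emb_simps[OF E_embedding[OF \<sigma>]]
      have r2: "(\<sigma> r)\<^sup>2 = (sqrt 2)\<^sup>2" using arg_cong[OF r, of \<sigma>] by (simp add: e)
      have b2': "(\<sigma> b)\<^sup>2 = 3 * (2 + \<sigma> r)" using arg_cong[OF b, of \<sigma>] by (simp add: e)
      consider "\<sigma> r = sqrt 2" | "\<sigma> r = - sqrt 2" using r2 by (auto simp: power2_eq_iff simp del: real_sqrt_pow2)
      then show ?thesis
      proof cases
        case 1
        then have "(\<sigma> b)\<^sup>2 = b1\<^sup>2" using b2' b1(1) by simp
        with 1 \<sigma> show ?thesis by (auto simp: A_def B_def power2_eq_iff)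
      next
        case 2
        then have "(\<sigma> b)\<^sup>2 = b2\<^sup>2" using b2' b2(1) by simp
        with 2 \<sigma> show ?thesis by (auto simp: C_def D_def power2_eq_iff)
      qed
    qed
    then show ?thesis by (auto simp: A_def B_def C_def D_def)
  qed
  have sum_E: "(\<Sum>\<sigma>\<in>E. h \<sigma>) = sum h A + sum h B + sum h C + sum h D" for h :: "('k \<Rightarrow> real) \<Rightarrow> real"
    unfolding E using fin disj by (simp add: sum.union_disjoint)
  define a b' c d where abcd: "a = int (card A)" "b' = int (card B)" "c = int (card C)" "d = int (card D)"
  have "(\<Sum>\<sigma>\<in>E. \<sigma> r) = sqrt 2 * (a + b' - c - d)"
  proof -
    have "sum (\<lambda>\<sigma>. \<sigma> r) A = sqrt 2 * a" "sum (\<lambda>\<sigma>. \<sigma> r) B = sqrt 2 * b'"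
      "sum (\<lambda>\<sigma>. \<sigma> r) C = - sqrt 2 * c" "sum (\<lambda>\<sigma>. \<sigma> r) D = - sqrt 2 * d"
      unfolding abcd by (simp_all add: A_def B_def C_def D_def)
    then show ?thesis by (simp add: sum_E algebra_simps)
  qed
  then have "0 + real_of_int (a + b' - c - d) * sqrt 2 \<in> \<rat>" using trace_rational[of r] by (simp add: mult.commute)
  then have "real_of_int (a + b' - c - d) = 0" by (rule sqrt2_rational_coefficient) auto
  then have abcd1: "a + b' = c + d" by linarith
  have tr_b: "(\<Sum>\<sigma>\<in>E. \<sigma> b) = b1 * (a - b') + b2 * (c - d)"
  proof -
    have "sum (\<lambda>\<sigma>. \<sigma> b) A = b1 * a" "sum (\<lambda>\<sigma>. \<sigma> b) B = - b1 * b'"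
      "sum (\<lambda>\<sigma>. \<sigma> b) C = b2 * c" "sum (\<lambda>\<sigma>. \<sigma> b) D = - b2 * d"
      unfolding abcd by (simp_all add: A_def B_def C_def D_def)
    then show ?thesis by (simp add: sum_E algebra_simps)
  qed
  define P where "P = a - b'"
  define R where "R = c - d"
  have "(b1 * P + b2 * R)\<^sup>2 \<in> \<rat>"
    using trace_rational[of b] unfolding tr_b P_def R_def by (intro Rats_power) simp
  also have "(b1 * P + b2 * R)\<^sup>2 = b1\<^sup>2 * P\<^sup>2 + b2\<^sup>2 * R\<^sup>2 + 2 * (b1 * b2) * (P * R)"
    by (simp add: power2_eq_square algebra_simps)
  also have "\<dots> = real_of_int (6 * (P\<^sup>2 + R\<^sup>2)) + real_of_int (3 * (P\<^sup>2 - R\<^sup>2 + 2 * P * R)) * sqrt 2"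
    unfolding b1(1) b2(1) b12 by (simp add: algebra_simps)
  finally have "real_of_int (3 * (P\<^sup>2 - R\<^sup>2 + 2 * P * R)) = 0" by (rule sqrt2_rational_coefficient) auto
  then have "P\<^sup>2 - R\<^sup>2 + 2 * P * R = 0" by (subst (asm) of_int_eq_0_iff) simp
  \<comment> \<open>Rationality of the squared trace of \<open>b\<close> makes its coefficient at
    sqrt 2 vanish; completing the square leaves an equation without nonzero integer
    solutions.\<close>
  then have PR: "(P + R)\<^sup>2 = 2 * R\<^sup>2" by (simp add: power2_eq_square algebra_simps)
  then have "R = 0" by (rule int_square_eq_twice_square)
  with PR have "P = 0" by simp
  have "card E = card A + card B + card C + card D"
    unfolding E using fin disj by (simp add: card_Un_disjoint)
  then have cards: "card A = f" "card B = f" "card C = f" "card D = f"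
    using f abcd1 \<open>R = 0\<close> \<open>P = 0\<close> by (auto simp: P_def R_def abcd)
  have "field_norm (3 + r + b) = (\<Prod>\<sigma>\<in>E. 3 + \<sigma> r + \<sigma> b)"
    unfolding field_norm_alt by (intro prod.cong refl) (simp add: emb_add[OF E_embedding] emb_numeral[OF E_embedding])
  also have "\<dots> = (\<Prod>\<sigma>\<in>A. 3 + \<sigma> r + \<sigma> b) * (\<Prod>\<sigma>\<in>B. 3 + \<sigma> r + \<sigma> b) *
      (\<Prod>\<sigma>\<in>C. 3 + \<sigma> r + \<sigma> b) * (\<Prod>\<sigma>\<in>D. 3 + \<sigma> r + \<sigma> b)"
    unfolding E using fin disj by (simp add: prod.union_disjoint)
  also have "(\<Prod>\<sigma>\<in>A. 3 + \<sigma> r + \<sigma> b) = (3 + sqrt 2 + b1) ^ f" using cards(1) by (simp add: A_def)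
  also have "(\<Prod>\<sigma>\<in>B. 3 + \<sigma> r + \<sigma> b) = (3 + sqrt 2 - b1) ^ f" using cards(2) by (simp add: B_def)
  also have "(\<Prod>\<sigma>\<in>C. 3 + \<sigma> r + \<sigma> b) = (3 - sqrt 2 + b2) ^ f" using cards(3) by (simp add: C_def)
  also have "(\<Prod>\<sigma>\<in>D. 3 + \<sigma> r + \<sigma> b) = (3 - sqrt 2 - b2) ^ f" using cards(4) by (simp add: D_def)
  also have "(3 + sqrt 2 + b1) ^ f * (3 + sqrt 2 - b1) ^ f * (3 - sqrt 2 + b2) ^ f * (3 - sqrt 2 - b2) ^ f =
      (((3 + sqrt 2 + b1) * (3 + sqrt 2 - b1)) * ((3 - sqrt 2 + b2) * (3 - sqrt 2 - b2))) ^ f"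
    by (simp add: power_mult_distrib mult.assoc)
  also have "(3 + sqrt 2 + b1) * (3 + sqrt 2 - b1) = 5 + 3 * sqrt 2"
    using b1(1) by (simp add: power2_eq_square algebra_simps)
  also have "(3 - sqrt 2 + b2) * (3 - sqrt 2 - b2) = 5 - 3 * sqrt 2"
    using b2(1) by (simp add: power2_eq_square algebra_simps)
  also have "(5 + 3 * sqrt 2) * (5 - 3 * sqrt 2) = (7 :: real)" by (simp add: algebra_simps)
  finally show ?thesis .
qed

lemma abs_less_of_square: "x\<^sup>2 < y\<^sup>2 \<Longrightarrow> 0 < y \<Longrightarrow> \<bar>x :: real\<bar> < y"
  by (metis abs_le_square_iff abs_of_pos linorder_not_le)

end

context universal_unary_sum
begin

text \<open>The small element \<open>2 + r\<close> is \<open>x\<^sup>2\<close> or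
  \<open>\<epsilon> * x\<^sup>2\<close>, and 3 is \<open>c\<^sup>2\<close> or
  \<open>\<epsilon> * c\<^sup>2\<close>. If \<open>2 + r\<close> is a square, \<open>2 + x\<close>
  is a totally positive element of norm \<open>2 ^ f\<close>, which is excluded. Otherwise
  \<open>x\<close> can serve as auxiliary element of the descent, and this contradicts an element of
  norm \<open>3 ^ f\<close> or \<open>7 ^ f\<close>, according to the form of 3.\<close>

theorem no_sqrt2: "r\<^sup>2 \<noteq> (2 :: 'k)"
proof
  assume r: "r\<^sup>2 = 2"
  have r_int: "algebraic_int r" by (rule algebraic_int_square_root) (simp add: r)
  have rsq: "r * r = 2" using r by (simp add: power2_eq_square)
  have sr: "(\<sigma> r)\<^sup>2 = 2" if "\<sigma> \<in> E" for \<sigma>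
    using arg_cong[OF r, of \<sigma>] by (simp add: emb_simps[OF E_embedding[OF that]])
  have sr_less: "\<bar>\<sigma> r\<bar> < 3 / 2" if "\<sigma> \<in> E" for \<sigma>
  proof (rule abs_less_of_square)
    show "(\<sigma> r)\<^sup>2 < (3 / 2)\<^sup>2" unfolding sr[OF that] by (simp add: power2_eq_square)
  qed simp
  define \<delta> where "\<delta> = 2 + r"
  have \<delta>_int: "algebraic_int \<delta>" unfolding \<delta>_def by (intro algebraic_int_plus r_int) auto
  have \<delta>_pos: "totally_positive \<delta>"
    unfolding totally_positive_alt
  proof
    fix \<sigma> assume \<sigma>: "\<sigma> \<in> E"
    show "\<sigma> \<delta> > 0" using sr_less[OF \<sigma>] by (simp add: \<delta>_def emb_simps[OF E_embedding[OF \<sigma>]])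
  qed
  \<comment> \<open>The conjugate of \<delta> over the field without \<open>r\<close> is \<delta>
    times a unit square, so \<delta> has the square root of the norm of 2.\<close>
  have conj: "2 - r = \<delta> * (r - 1)\<^sup>2"
    using rsq by (simp add: \<delta>_def power2_eq_square algebra_simps)
  have "int_unit (r - 1)"
    by (rule int_unitI[of _ "r + 1"]) (use rsq in \<open>auto simp: algebra_simps intro!: algebraic_int_diff algebraic_int_plus r_int\<close>)
  then have norm_conj: "nat_norm (2 - r) = nat_norm \<delta>"
    unfolding conj using \<delta>_int
    by (simp add: nat_norm_mult nat_norm_square nat_norm_unit algebraic_int_power int_unit_def)
  have "(nat_norm \<delta>)\<^sup>2 = nat_norm (\<delta> * (2 - r))"
    using norm_conj \<delta>_int r_int by (simp add: nat_norm_mult power2_eq_square algebraic_int_diff)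
  also have "\<delta> * (2 - r) = of_nat 2" using rsq by (simp add: \<delta>_def algebra_simps)
  finally have "(nat_norm \<delta>)\<^sup>2 = 2 ^ card E" by (simp only: nat_norm_of_nat)
  then obtain e where e: "nat_norm \<delta> = 2 ^ e" "card E = 2 * e"
    using square_eq_prime_power_nat[OF two_is_prime_nat] by metis
  have e0: "e > 0" using e(2) card_E_pos by simp
  have "nat_norm \<delta> < 2 ^ card E" unfolding e using e0 by simp
  then obtain x where x: "algebraic_int x" "\<delta> = x\<^sup>2 \<or> \<delta> = \<epsilon> * x\<^sup>2" "nat_norm \<delta> = (nat_norm x)\<^sup>2"
    using small_norm_square[OF \<delta>_int \<delta>_pos] by blast
  obtain f where f: "nat_norm x = 2 ^ f" "e = 2 * f"
    using square_eq_prime_power_nat[OF two_is_prime_nat, of "nat_norm x" e] x(3) e(1) by metis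
  have d: "card E = 4 * f" and f0: "f > 0" using e(2) f(2) e0 by auto
  have x0: "x \<noteq> 0" using x(2) totally_positive_nonzero[OF \<delta>_pos] by auto
  obtain c where c: "3 = c\<^sup>2 \<or> 3 = \<epsilon> * c\<^sup>2" using three_or_three_eps_square[OF r] by blast
  have c_int: "algebraic_int c"
  proof (rule algebraic_int_square_root)
    have "c\<^sup>2 = 3 \<or> c\<^sup>2 = 3 / \<epsilon>" using c eps_nonzero by (auto simp: field_simps)
    then show "algebraic_int (c\<^sup>2)" using divide_eps_int[of 3] by auto
  qed
  have c0: "c \<noteq> 0" using c by auto
  have "(nat_norm c)\<^sup>2 = nat_norm (of_nat 3)"
  proof -
    have "nat_norm (\<epsilon> * c\<^sup>2) = (nat_norm c)\<^sup>2" "nat_norm (c\<^sup>2) = (nat_norm c)\<^sup>2"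
      using c_int eps_int unit_eps by (simp_all add: nat_norm_mult nat_norm_square nat_norm_unit algebraic_int_power)
    then show ?thesis using c by (metis of_nat_numeral)
  qed
  then have "(nat_norm c)\<^sup>2 = 3 ^ (4 * f)" by (simp only: nat_norm_of_nat d)
  then have norm_c: "nat_norm c = 3 ^ (2 * f)"
    using square_eq_prime_power_nat[of 3 "nat_norm c" "4 * f"] by auto
  have contra3: False if "3 ^ i = (2 :: nat) ^ m" "i > 0" for i m
    using odd_prime_power_not_power_of_two[of 3 i m] that by simp
  \<comment> \<open>An auxiliary element this small would make the norm \<open>9 ^ f\<close> of
    \<open>c\<close> a power of 2: after squaring, the descent needs 81 * 2 < 256.\<close>
  have half: False
    if s: "algebraic_int s" "s \<noteq> 0" "\<not> pos_associate s" "nat_norm s = 2 ^ k" "2 * k \<le> f" for s k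
  proof -
    have "nat_norm c * nat_norm s < 2 ^ card E"
    proof (rule power2_less_imp_less)
      have "(nat_norm c * nat_norm s)\<^sup>2 = 81 ^ f * 2 ^ (2 * k)"
      proof -
        have "(3 ^ (2 * f))\<^sup>2 = (81 :: nat) ^ f"
          by (simp add: power_mult power2_eq_square flip: power_mult_distrib)
        moreover have "(2 ^ k)\<^sup>2 = (2 :: nat) ^ (2 * k)" by (simp add: mult.commute flip: power_mult)
        ultimately show ?thesis unfolding norm_c s(4) by (simp only: power_mult_distrib)
      qed
      also have "\<dots> \<le> 81 ^ f * 2 ^ f" using s(5) by (intro mult_left_mono power_increasing) auto
      also have "\<dots> = 162 ^ f" by (simp flip: power_mult_distrib)
      also have "\<dots> < (256 :: nat) ^ f" using f0 by (intro power_strict_mono) auto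
      also have "\<dots> = (2 ^ card E)\<^sup>2" unfolding d by (simp add: power_mult flip: power_mult_distrib) (simp add: power2_eq_square flip: power_mult_distrib)
      finally show "(nat_norm c * nat_norm s)\<^sup>2 < (2 ^ card E)\<^sup>2" .
    qed simp
    from norm_power_of_two[OF s(1-4) _ c_int c0 this] s(5) d obtain m where "nat_norm c = 2 ^ m" by auto
    then show False using norm_c contra3[of "2 * f" m] f0 by simp
  qed
  \<comment> \<open>A totally positive associate allows one root before the search for the auxiliary
    element, which then has exponent at most half of \<open>f\<close>.\<close>
  have pos_half: False if g: "algebraic_int g" "pos_associate g" "nat_norm g = 2 ^ f" for g
    using signature_obstruction[OF g(1,3)] g(2) f0 d half by auto
  have x_neg: "\<not> pos_associate x" using pos_half[OF x(1) _ f(1)] by blast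
  \<comment> \<open>Now \<open>x\<close> itself, of norm \<open>2 ^ f\<close>, is the auxiliary
    element; with \<open>card E = 4 * f\<close> the budget is \<open>2 * p < 16\<close>.\<close>
  have descent: False
    if y: "algebraic_int y" "y \<noteq> 0" and norm: "nat_norm y = p ^ f" "prime p" "p \<noteq> 2" "2 * p < 16" for y p
  proof -
    have "nat_norm y * nat_norm x = (2 * p) ^ f" by (simp add: norm(1) f(1) power_mult_distrib mult.commute)
    also have "\<dots> < 16 ^ f" using norm(4) f0 by (intro power_strict_mono) auto
    also have "\<dots> = 2 ^ card E" unfolding d by (simp add: power_mult)
    finally obtain m where "nat_norm y = 2 ^ m"
      using norm_power_of_two[OF x(1) x0 x_neg f(1) _ y] d by auto
    then show False using odd_prime_power_not_power_of_two[OF norm(2,3), of f m] norm(1) f0 by simp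
  qed
  from x(2) show False
  proof
    assume \<delta>x: "\<delta> = x\<^sup>2"
    have t_int: "algebraic_int (2 + x)" "algebraic_int (2 - x)"
      using x(1) by (auto intro!: algebraic_int_plus algebraic_int_diff)
    have small: "\<bar>\<sigma> x\<bar> < 2" if \<sigma>: "\<sigma> \<in> E" for \<sigma>
    proof (rule abs_less_of_square)
      note e = emb_simps[OF E_embedding[OF \<sigma>]]
      have "(\<sigma> x)\<^sup>2 = 2 + \<sigma> r" using arg_cong[OF \<delta>x, of \<sigma>] by (simp add: \<delta>_def e)
      then show "(\<sigma> x)\<^sup>2 < 2\<^sup>2" using sr_less[OF \<sigma>] by simp
    qed simp
    have t_pos: "totally_positive (2 + x)" "totally_positive (2 - x)"
    proof -
      have "0 < \<sigma> (2 + x)" "0 < \<sigma> (2 - x)" if "\<sigma> \<in> E" for \<sigma>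
        using small[OF that] by (auto simp: emb_simps[OF E_embedding[OF that]])
      then show "totally_positive (2 + x)" "totally_positive (2 - x)"
        unfolding totally_positive_alt by blast+
    qed
    \<comment> \<open>The two factors multiply to norm \<open>2 ^ (2 * f)\<close>, and
      \<open>x\<close> divides both because \<open>x\<^sup>2 * (4 - x\<^sup>2) = 2\<close>; so each
      has norm exactly \<open>2 ^ f\<close>.\<close>
    have prod: "nat_norm (2 + x) * nat_norm (2 - x) = 2 ^ (2 * f)"
    proof -
      have "(2 + x) * (2 - x) = 2 - r" using \<delta>x by (simp add: \<delta>_def power2_eq_square algebra_simps)
      then show ?thesis using nat_norm_mult[OF t_int] norm_conj e(1) f(2) by simp
    qed
    have xx: "x * x = 2 + r" using \<delta>x by (simp add: \<delta>_def power2_eq_square)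
    have x4: "x * x * (4 - x * x) = 2" unfolding xx using rsq by (simp add: algebra_simps)
    have "nat_norm x dvd nat_norm (2 + x)"
    proof -
      have "2 + x = x * (1 + x * (4 - x * x))" using x4 by (simp add: algebra_simps)
      moreover have "algebraic_int (1 + x * (4 - x * x))"
        using x(1) by (intro algebraic_int_plus algebraic_int_diff algebraic_int_times) auto
      ultimately show ?thesis using x(1) by (metis dvd_triv_left nat_norm_mult)
    qed
    moreover have "nat_norm x dvd nat_norm (2 - x)"
    proof -
      have "2 - x = x * (x * (4 - x * x) - 1)" using x4 by (simp add: algebra_simps)
      moreover have "algebraic_int (x * (4 - x * x) - 1)"
        using x(1) by (intro algebraic_int_plus algebraic_int_diff algebraic_int_times) auto
      ultimately show ?thesis using x(1) by (metis dvd_triv_left nat_norm_mult)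
    qed
    ultimately obtain a b where ab: "nat_norm (2 + x) = 2 ^ f * a" "nat_norm (2 - x) = 2 ^ f * b"
      unfolding f(1) by (auto elim!: dvdE)
    have "(2 ^ f * a) * (2 ^ f * b) = 2 ^ f * (2 :: nat) ^ f"
      using prod unfolding ab by (simp only: mult_2 power_add)
    then have "a * b = 1" by simp
    then have "nat_norm (2 + x) = 2 ^ f" using ab(1) by simp
    moreover have "pos_associate (2 + x)"
      unfolding pos_associate_def using t_pos(1) int_unit_1 by (intro exI[of _ 1]) simp
    ultimately show False using pos_half[OF t_int(1)] by blast
  next
    assume \<delta>x: "\<delta> = \<epsilon> * x\<^sup>2"
    from c show False
    proof
      assume c2: "3 = c\<^sup>2"
      \<comment> \<open>Its inverse is \<open>c - r\<close>, as 3 - 2 = 1. In absolute value the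
        conjugates of \<open>c\<close> are sqrt 3 and exceed those of \<open>r\<close>, so this unit
        has the signature of \<open>c\<close>.\<close>
      have "int_unit (c + r)"
        by (rule int_unitI[of _ "c - r"])
          (use c2 rsq in \<open>auto simp: power2_eq_square algebra_simps intro!: algebraic_int_plus algebraic_int_diff c_int r_int\<close>)
      moreover have "totally_positive ((c + r) * c)"
        unfolding totally_positive_alt
      proof
        fix \<sigma> assume \<sigma>: "\<sigma> \<in> E"
        note e = emb_simps[OF E_embedding[OF \<sigma>]]
        have sc: "(\<sigma> c)\<^sup>2 = 3" using arg_cong[OF c2, of \<sigma>] by (simp add: e)
        have "\<bar>\<sigma> r * \<sigma> c\<bar> < 3"
          by (rule abs_less_of_square) (simp_all add: power_mult_distrib sr[OF \<sigma>] sc)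
        then show "\<sigma> ((c + r) * c) > 0" using sc by (simp add: e distrib_right power2_eq_square)
      qed
      ultimately have "pos_associate c" unfolding pos_associate_def by blast
      moreover have "nat_norm c < 2 ^ card E"
      proof -
        have "nat_norm c = 9 ^ f" by (simp add: norm_c power_mult)
        also have "\<dots> < 16 ^ f" using f0 by (intro power_strict_mono) auto
        finally show ?thesis unfolding d by (simp add: power_mult)
      qed
      ultimately obtain y where y: "algebraic_int y" "nat_norm c = (nat_norm y)\<^sup>2"
        using pos_associate_square_root[OF c_int] by blast
      have "nat_norm y = 3 ^ f"
        using square_eq_prime_power_nat[of 3 "nat_norm y" "2 * f"] y(2) norm_c by auto
      moreover from this have "y \<noteq> 0" using norm_eq_0_iff[of 0] by (auto simp: nat_norm_def)
      ultimately show False using descent[of y 3] y(1) by simp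
    next
      assume c2: "3 = \<epsilon> * c\<^sup>2"
      define b where "b = \<epsilon> * x * c"
      have b: "b\<^sup>2 = 3 * (2 + r)"
      proof -
        have "b\<^sup>2 = (\<epsilon> * c\<^sup>2) * (\<epsilon> * x\<^sup>2)" by (simp add: b_def power2_eq_square)
        then show ?thesis by (simp flip: c2 \<delta>x add: \<delta>_def)
      qed
      \<comment> \<open>Chosen because \<open>(3 + r)\<^sup>2 - b\<^sup>2 = 5 + 3 * r\<close> is
        totally positive and has product 25 - 18 = 7 with its conjugate: this gives total positivity
        of \<open>g\<close> and an odd norm within the budget.\<close>
      define g where "g = 3 + r + b"
      have b_int: "algebraic_int b" unfolding b_def by (intro algebraic_int_times eps_int x(1) c_int)
      have g_int: "algebraic_int g" unfolding g_def by (intro algebraic_int_plus r_int b_int) auto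
      have "totally_positive g"
        unfolding totally_positive_alt
      proof
        fix \<sigma> assume \<sigma>: "\<sigma> \<in> E"
        note e = emb_simps[OF E_embedding[OF \<sigma>]]
        have sb: "(\<sigma> b)\<^sup>2 = 3 * (2 + \<sigma> r)" using arg_cong[OF b, of \<sigma>] by (simp add: e)
        have "(3 + \<sigma> r)\<^sup>2 - (\<sigma> b)\<^sup>2 = 5 + 3 * \<sigma> r"
          unfolding sb using sr[OF \<sigma>] by (simp add: power2_eq_square algebra_simps)
        then have "\<bar>\<sigma> b\<bar> < 3 + \<sigma> r"
          using sr_less[OF \<sigma>] by (intro abs_less_of_square) linarith+
        then show "\<sigma> g > 0" by (simp add: g_def e)
      qed
      then have "real (nat_norm g) = 7 ^ f"
        using nat_norm_totally_positive[OF g_int] norm_seven[OF r b d] by (simp add: g_def)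
      then have "nat_norm g = 7 ^ f" by (metis of_nat_eq_iff of_nat_numeral of_nat_power)
      then show False
        using descent[of g 7] g_int totally_positive_nonzero[OF \<open>totally_positive g\<close>] by simp
    qed
  qed
qed

section \<open>Consequences for 2, for indecomposables and for small norms\<close>

theorem two_eps_square: "\<exists>s. algebraic_int s \<and> 2 * \<epsilon> = s\<^sup>2"
proof -
  obtain s where s: "2 * \<epsilon> = s\<^sup>2" using two_or_two_eps_square no_sqrt2 by metis
  have "algebraic_int (2 * \<epsilon>)" using eps_int by (intro algebraic_int_times) auto
  then have "algebraic_int s" unfolding s by (rule algebraic_int_square_root)
  with s show ?thesis by blast
qed

theorem indecomposable_square_or_twice:
  assumes "indecomposable (\<mu> :: 'k)"
  shows "integer_square \<mu> \<or> integer_square (2 * \<mu>)"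
proof -
  have "integer_square (2 * \<mu>)" if em: "integer_square (\<epsilon> * \<mu>)"
  proof -
    obtain y where y: "algebraic_int y" "\<epsilon> * \<mu> = y\<^sup>2" using em by (auto simp: integer_square_alt)
    obtain s where s: "algebraic_int s" "2 * \<epsilon> = s\<^sup>2" using two_eps_square by blast
    have "2 * \<mu> = (2 * \<epsilon>) * (\<epsilon> * \<mu>) / \<epsilon>\<^sup>2" using eps_nonzero by (simp add: power2_eq_square)
    then have "2 * \<mu> = (s * y / \<epsilon>)\<^sup>2" by (simp add: s(2) y(2) power_mult_distrib power_divide)
    moreover have "algebraic_int (s * y / \<epsilon>)" by (intro divide_eps_int algebraic_int_times s(1) y(1))
    ultimately show ?thesis unfolding integer_square_alt by blast
  qed
  with indecomposable_square[OF assms] show ?thesis by blast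
qed

theorem twice_sum_of_squares:
  assumes "\<alpha> \<in> (pos_integers :: 'k set)"
  shows "sum_of_integer_squares (2 * \<alpha>)"
proof -
  obtain ls where ls: "\<forall>l\<in>set ls. indecomposable l" "\<alpha> = sum_list ls"
    using sum_of_indecomposables[OF assms] by blast
  from ls(1) have "sum_of_integer_squares (2 * sum_list ls)"
  proof (induction ls)
    case Nil
    show ?case unfolding sum_of_integer_squares_def by (intro exI[of _ "[]"]) simp
  next
    case (Cons l ls)
    then obtain xs where xs: "set xs \<subseteq> integers" "2 * sum_list ls = (\<Sum>x\<leftarrow>xs. x\<^sup>2)"
      unfolding sum_of_integer_squares_def by auto
    have "\<exists>ys. set ys \<subseteq> integers \<and> 2 * l = (\<Sum>x\<leftarrow>ys. x\<^sup>2)"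
    proof -
      from indecomposable_square_or_twice[of l] Cons.prems consider
        x where "x \<in> integers" "l = x\<^sup>2" | x where "x \<in> integers" "2 * l = x\<^sup>2"
        unfolding integer_square_def by auto
      then show ?thesis
      proof cases
        case (1 x)
        then show ?thesis by (intro exI[of _ "[x, x]"]) simp
      next
        case (2 x)
        then show ?thesis by (intro exI[of _ "[x]"]) simp
      qed
    qed
    then obtain ys where "set ys \<subseteq> integers" "2 * l = (\<Sum>x\<leftarrow>ys. x\<^sup>2)" by blast
    with xs show ?case unfolding sum_of_integer_squares_def
      by (intro exI[of _ "ys @ xs"]) (simp add: distrib_left)
  qed
  with ls(2) show ?thesis by simp
qed

text \<open>The root of 2 \<epsilon> has norm \<open>2 ^ (card E div 2)\<close> and yields an
  auxiliary element at most that large. The root \<open>x\<close> of \<alpha>, up to \<epsilon>, has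
  norm below the same number, so the descent applies to \<open>x\<close>.\<close>

theorem small_norm_power_of_two:
  assumes "\<alpha> \<in> (pos_integers :: 'k set)" "field_norm \<alpha> < 2 ^ card E"
  shows "\<exists>m. field_norm \<alpha> = 2 ^ m"
proof -
  have \<alpha>: "algebraic_int \<alpha>" "totally_positive \<alpha>" using assms(1) by (auto simp: pos_integers_alt)
  have "real (nat_norm \<alpha>) < 2 ^ card E" using nat_norm_totally_positive[OF \<alpha>] assms(2) by simp
  then have less: "nat_norm \<alpha> < 2 ^ card E" by (metis of_nat_less_iff of_nat_numeral of_nat_power)
  obtain x where x: "algebraic_int x" "\<alpha> = x\<^sup>2 \<or> \<alpha> = \<epsilon> * x\<^sup>2" "nat_norm \<alpha> = (nat_norm x)\<^sup>2"
    using small_norm_square[OF \<alpha> less] by blast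
  have x0: "x \<noteq> 0" using x(2) totally_positive_nonzero[OF \<alpha>(2)] by auto
  obtain s where s: "algebraic_int s" "2 * \<epsilon> = s\<^sup>2" using two_eps_square by blast
  have "(nat_norm s)\<^sup>2 = nat_norm (of_nat 2 * \<epsilon>)" using s nat_norm_square by simp
  also have "\<dots> = nat_norm (of_nat 2) * nat_norm \<epsilon>"
    by (rule nat_norm_mult) (use eps_int in auto)
  also have "\<dots> = 2 ^ card E" by (simp only: nat_norm_of_nat nat_norm_unit[OF unit_eps] mult_1_right)
  finally obtain e where e: "nat_norm s = 2 ^ e" "card E = 2 * e"
    using square_eq_prime_power_nat[OF two_is_prime_nat] by metis
  have "1 \<le> e" "e < card E" using e(2) card_E_pos by auto
  from signature_obstruction[OF s(1) e(1) this] obtain t k where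
    t: "algebraic_int t" "t \<noteq> 0" "\<not> pos_associate t" "nat_norm t = 2 ^ k" "k \<le> e" by blast
  have "nat_norm x * nat_norm t < 2 ^ card E"
  proof (rule power2_less_imp_less)
    have "(nat_norm x * nat_norm t)\<^sup>2 = nat_norm \<alpha> * 2 ^ (2 * k)"
      by (simp add: x(3) t(4) power_mult_distrib flip: power_mult)
    also have "\<dots> \<le> nat_norm \<alpha> * 2 ^ card E"
      using t(5) e(2) by (intro mult_left_mono power_increasing) auto
    also have "\<dots> < 2 ^ card E * 2 ^ card E" using less by simp
    finally show "(nat_norm x * nat_norm t)\<^sup>2 < (2 ^ card E)\<^sup>2" by (simp add: power2_eq_square)
  qed simp
  from norm_power_of_two[OF t(1-4) _ x(1) x0 this] t(5) e(2) obtain m where "nat_norm x = 2 ^ m" by auto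
  then have "nat_norm \<alpha> = 2 ^ (m * 2)" using x(3) by (simp add: power_mult)
  then have "field_norm \<alpha> = 2 ^ (m * 2)" using nat_norm_totally_positive[OF \<alpha>] by (metis of_nat_numeral of_nat_power)
  then show ?thesis by blast
qed

end

section \<open>Lattices\<close>

lemma ring_of_integers_simps [simp]:
  "x \<in> carrier ring_of_integers \<longleftrightarrow> algebraic_int x"
  "\<zero>\<^bsub>ring_of_integers\<^esub> = (0 :: 'k::field_char_0)" "\<one>\<^bsub>ring_of_integers\<^esub> = (1 :: 'k)"
  "x \<oplus>\<^bsub>ring_of_integers\<^esub> y = x + y" "x \<otimes>\<^bsub>ring_of_integers\<^esub> y = (x * y :: 'k)"
  by (simp_all add: ring_of_integers_def)

section \<open>Forms and linear combinations in a quadratic lattice\<close>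

context quadratic_lattice
begin

lemma form_commute: "u \<in> carrier L \<Longrightarrow> v \<in> carrier L \<Longrightarrow> bform L u v = bform L v u"
  by (simp add: bform_def M.add.m_comm)

lemma neg_eq_smult: "v \<in> carrier L \<Longrightarrow> \<ominus>\<^bsub>L\<^esub> v = (- 1) \<odot>\<^bsub>L\<^esub> v"
proof -
  assume v: "v \<in> carrier L"
  have "(- 1) \<odot>\<^bsub>L\<^esub> v \<oplus>\<^bsub>L\<^esub> v = (- 1 + 1) \<odot>\<^bsub>L\<^esub> v"
    using v smult_l_distr[of "- 1" 1 v] smult_one[OF v] by simp
  also have "\<dots> = \<zero>\<^bsub>L\<^esub>" using smult_l_null[OF v] by simp
  finally show ?thesis using v by (intro M.minus_equality) auto
qed

lemma smult_zero: "v \<in> carrier L \<Longrightarrow> 0 \<odot>\<^bsub>L\<^esub> v = \<zero>\<^bsub>L\<^esub>"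
  using smult_l_null[of v] by simp

lemma smult_1: "v \<in> carrier L \<Longrightarrow> 1 \<odot>\<^bsub>L\<^esub> v = v"
  using smult_one[of v] by simp

lemma smult_mem: "algebraic_int a \<Longrightarrow> v \<in> carrier L \<Longrightarrow> a \<odot>\<^bsub>L\<^esub> v \<in> carrier L"
  by simp

lemma smult_add: "algebraic_int a \<Longrightarrow> algebraic_int b \<Longrightarrow> v \<in> carrier L \<Longrightarrow>
    (a + b) \<odot>\<^bsub>L\<^esub> v = a \<odot>\<^bsub>L\<^esub> v \<oplus>\<^bsub>L\<^esub> b \<odot>\<^bsub>L\<^esub> v"
  using smult_l_distr[of a b v] by simp

lemma smult_smult: "algebraic_int a \<Longrightarrow> algebraic_int b \<Longrightarrow> v \<in> carrier L \<Longrightarrow>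
    a \<odot>\<^bsub>L\<^esub> (b \<odot>\<^bsub>L\<^esub> v) = (a * b) \<odot>\<^bsub>L\<^esub> v"
  using smult_assoc1[of a b v] by simp

lemma form_add: "u \<in> carrier L \<Longrightarrow> v \<in> carrier L \<Longrightarrow> w \<in> carrier L \<Longrightarrow>
    bform L (u \<oplus>\<^bsub>L\<^esub> v) w = bform L u w + bform L v w"
  by (rule bform_add_left)

lemma form_smult: "algebraic_int a \<Longrightarrow> u \<in> carrier L \<Longrightarrow> v \<in> carrier L \<Longrightarrow>
    bform L (a \<odot>\<^bsub>L\<^esub> u) v = a * bform L u v"
  by (rule bform_smult_left) simp

lemma form_zero: "v \<in> carrier L \<Longrightarrow> bform L \<zero>\<^bsub>L\<^esub> v = 0"
  using form_smult[of 0 v v] smult_zero[of v] by simp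

lemma form_int: "u \<in> carrier L \<Longrightarrow> v \<in> carrier L \<Longrightarrow> algebraic_int (bform L u v)"
  using classical_form[of u v] by simp

lemma form_self: "v \<in> carrier L \<Longrightarrow> bform L v v = qform L v"
proof -
  assume v: "v \<in> carrier L"
  have "v \<oplus>\<^bsub>L\<^esub> v = (1 + 1) \<odot>\<^bsub>L\<^esub> v"
    using v smult_1[OF v] by (subst smult_add) auto
  then have "qform L (v \<oplus>\<^bsub>L\<^esub> v) = 4 * qform L v"
    using v qform_smult[of "1 + 1" v] by (simp add: power2_eq_square)
  then show ?thesis by (simp add: bform_def)
qed

definition lincomb :: "('v \<Rightarrow> 'k) \<Rightarrow> 'v set \<Rightarrow> 'v" where
  "lincomb c S = (\<Oplus>\<^bsub>L\<^esub>s\<in>S. c s \<odot>\<^bsub>L\<^esub> s)"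

lemma lincomb_empty: "lincomb c {} = \<zero>\<^bsub>L\<^esub>"
  by (simp add: lincomb_def)

lemma lincomb_insert:
  assumes "finite S" "x \<notin> S" "insert x S \<subseteq> carrier L" "\<And>s. s \<in> insert x S \<Longrightarrow> algebraic_int (c s)"
  shows "lincomb c (insert x S) = c x \<odot>\<^bsub>L\<^esub> x \<oplus>\<^bsub>L\<^esub> lincomb c S"
  unfolding lincomb_def using assms by (intro M.finsum_insert) (auto intro!: smult_mem)

lemma lincomb_closed:
  assumes "finite S" "S \<subseteq> carrier L" "\<And>s. s \<in> S \<Longrightarrow> algebraic_int (c s)"
  shows "lincomb c S \<in> carrier L"
  unfolding lincomb_def using assms by (intro M.finsum_closed) (auto intro!: smult_mem)

lemma lincomb_zero:
  assumes "finite S" "S \<subseteq> carrier L" "\<And>s. s \<in> S \<Longrightarrow> c s = 0"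
  shows "lincomb c S = \<zero>\<^bsub>L\<^esub>"
  using assms
proof (induction S rule: finite_induct)
  case (insert x S)
  then show ?case by (subst lincomb_insert) (auto simp: smult_zero)
qed (simp add: lincomb_empty)

lemma form_lincomb:
  assumes "finite S" "S \<subseteq> carrier L" "\<And>s. s \<in> S \<Longrightarrow> algebraic_int (c s)" "w \<in> carrier L"
  shows "bform L (lincomb c S) w = (\<Sum>s\<in>S. c s * bform L s w)"
  using assms(1-3)
proof (induction S rule: finite_induct)
  case empty
  show ?case using form_zero[OF assms(4)] by (simp add: lincomb_empty)
next
  case (insert x S)
  then show ?case using assms(4) lincomb_closed[of S c]
    by (subst lincomb_insert) (auto simp: form_add form_smult smult_mem)
qed

lemma lin_independent_alt:
  "lin_independent L S \<longleftrightarrow> finite S \<and> S \<subseteq> carrier L \<and>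
     (\<forall>c. (\<forall>s\<in>S. algebraic_int (c s)) \<longrightarrow> lincomb c S = \<zero>\<^bsub>L\<^esub> \<longrightarrow> (\<forall>s\<in>S. c s = 0))"
  unfolding lin_independent_def lincomb_def by (auto simp: Pi_iff)

lemma generates_alt:
  "generates L S \<longleftrightarrow> finite S \<and> S \<subseteq> carrier L \<and>
     (\<forall>v\<in>carrier L. \<exists>c. (\<forall>s\<in>S. algebraic_int (c s)) \<and> v = lincomb c S)"
  unfolding generates_def lincomb_def by (auto simp: Pi_iff Bex_def)

lemma lincomb_add:
  assumes "finite S" "S \<subseteq> carrier L" "\<And>s. s \<in> S \<Longrightarrow> algebraic_int (c s)" "\<And>s. s \<in> S \<Longrightarrow> algebraic_int (d s)"
  shows "lincomb c S \<oplus>\<^bsub>L\<^esub> lincomb d S = lincomb (\<lambda>s. c s + d s) S"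
proof -
  have "lincomb (\<lambda>s. c s + d s) S = (\<Oplus>\<^bsub>L\<^esub>s\<in>S. c s \<odot>\<^bsub>L\<^esub> s \<oplus>\<^bsub>L\<^esub> d s \<odot>\<^bsub>L\<^esub> s)"
    unfolding lincomb_def using assms by (intro M.finsum_cong') (auto simp: smult_add intro!: smult_mem)
  also have "\<dots> = lincomb c S \<oplus>\<^bsub>L\<^esub> lincomb d S"
    unfolding lincomb_def using assms by (intro M.finsum_addf) (auto intro!: smult_mem)
  finally show ?thesis by simp
qed

lemma lincomb_single:
  assumes "finite S" "S \<subseteq> carrier L" "t \<in> S" "algebraic_int a"
  shows "lincomb (\<lambda>s. if s = t then a else 0) S = a \<odot>\<^bsub>L\<^esub> t"
proof -
  have S: "S = insert t (S - {t})" using assms(3) by blast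
  have "lincomb (\<lambda>s. if s = t then a else 0) (S - {t}) = \<zero>\<^bsub>L\<^esub>"
    using assms by (intro lincomb_zero) auto
  then show ?thesis using assms by (subst S, subst lincomb_insert) (auto simp: smult_mem subset_iff)
qed

end

text \<open>
  A lattice with orthogonal vectors of norms 1 and \<open>\<epsilon>\<close>, the latter a unit: \<open>X\<close>, \<open>Y\<close>, \<open>P\<close> are the
  coordinates and the projection onto the orthogonal complement \<open>U\<close>.
\<close>

locale split_lattice = quadratic_lattice L for L :: "('k::field_char_0, 'v) quad_module" +
  fixes \<epsilon> :: 'k and e1 e2 :: 'v
  assumes e1: "e1 \<in> carrier L" "qform L e1 = 1"
    and e2: "e2 \<in> carrier L" "qform L e2 = \<epsilon>"
    and e12: "bform L e1 e2 = 0"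
    and eps: "\<epsilon> \<noteq> 0" "algebraic_int \<epsilon>" "algebraic_int (inverse \<epsilon>)"
    and pos_nonzero: "\<alpha> \<in> pos_integers \<Longrightarrow> \<alpha> \<noteq> (0 :: 'k)"
    and rank: "has_rank L 3"
begin

definition X :: "'v \<Rightarrow> 'k" where "X v = bform L v e1"

definition Y :: "'v \<Rightarrow> 'k" where "Y v = bform L v e2 / \<epsilon>"

definition P :: "'v \<Rightarrow> 'v" where
  "P v = v \<oplus>\<^bsub>L\<^esub> ((- X v) \<odot>\<^bsub>L\<^esub> e1 \<oplus>\<^bsub>L\<^esub> (- Y v) \<odot>\<^bsub>L\<^esub> e2)"

definition U :: "'v set" where "U = {v \<in> carrier L. bform L v e1 = 0 \<and> bform L v e2 = 0}"

lemma X_int: "v \<in> carrier L \<Longrightarrow> algebraic_int (X v)"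
  unfolding X_def using e1 by (intro form_int)

lemma Y_int: "v \<in> carrier L \<Longrightarrow> algebraic_int (Y v)"
  unfolding Y_def divide_inverse using e2 eps by (intro algebraic_int_times form_int)

lemmas e_forms = form_self[OF e1(1), unfolded e1(2)] form_self[OF e2(1), unfolded e2(2)] e12
  form_commute[OF e2(1) e1(1), unfolded e12]

lemma qform_eq_0: "v \<in> carrier L \<Longrightarrow> qform L v = 0 \<Longrightarrow> v = \<zero>\<^bsub>L\<^esub>"
  using positive_definite[of v] pos_nonzero by auto

lemma U_carrier: "v \<in> U \<Longrightarrow> v \<in> carrier L"
  by (simp add: U_def)

lemma P_U: "v \<in> carrier L \<Longrightarrow> P v \<in> U"
  unfolding U_def P_def
  using e1(1) e2(1) e_forms X_int[of v] Y_int[of v] eps(1)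
  by (auto simp: form_add form_smult smult_mem X_def Y_def)

lemma decompose: "v \<in> carrier L \<Longrightarrow> v = (X v \<odot>\<^bsub>L\<^esub> e1 \<oplus>\<^bsub>L\<^esub> Y v \<odot>\<^bsub>L\<^esub> e2) \<oplus>\<^bsub>L\<^esub> P v"
proof -
  assume v: "v \<in> carrier L"
  have neg: "(- X v) \<odot>\<^bsub>L\<^esub> e1 = \<ominus>\<^bsub>L\<^esub> (X v \<odot>\<^bsub>L\<^esub> e1)" "(- Y v) \<odot>\<^bsub>L\<^esub> e2 = \<ominus>\<^bsub>L\<^esub> (Y v \<odot>\<^bsub>L\<^esub> e2)"
    using v e1(1) e2(1) X_int[OF v] Y_int[OF v] by (simp_all add: neg_eq_smult smult_smult smult_mem)
  define a where "a = X v \<odot>\<^bsub>L\<^esub> e1"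
  define b where "b = Y v \<odot>\<^bsub>L\<^esub> e2"
  have ab: "a \<in> carrier L" "b \<in> carrier L"
    using v e1(1) e2(1) X_int[OF v] Y_int[OF v] by (simp_all add: a_def b_def smult_mem)
  have "a \<oplus>\<^bsub>L\<^esub> b \<oplus>\<^bsub>L\<^esub> (v \<oplus>\<^bsub>L\<^esub> (\<ominus>\<^bsub>L\<^esub> a \<oplus>\<^bsub>L\<^esub> \<ominus>\<^bsub>L\<^esub> b)) =
      v \<oplus>\<^bsub>L\<^esub> ((a \<oplus>\<^bsub>L\<^esub> \<ominus>\<^bsub>L\<^esub> a) \<oplus>\<^bsub>L\<^esub> (b \<oplus>\<^bsub>L\<^esub> \<ominus>\<^bsub>L\<^esub> b))"
    using v ab by (simp only: M.a_ac M.a_inv_closed M.a_closed)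
  also have "\<dots> = v" using v ab by (simp add: M.r_neg)
  finally show ?thesis unfolding P_def neg a_def[symmetric] b_def[symmetric] by simp
qed

lemma form_split:
  assumes "a \<in> carrier L" "algebraic_int x" "algebraic_int y" "u \<in> U"
  shows "bform L ((x \<odot>\<^bsub>L\<^esub> e1 \<oplus>\<^bsub>L\<^esub> y \<odot>\<^bsub>L\<^esub> e2) \<oplus>\<^bsub>L\<^esub> u) a = x * bform L e1 a + y * bform L e2 a + bform L u a"
  using assms e1(1) e2(1) by (simp add: form_add form_smult smult_mem U_carrier)

lemma coords:
  assumes "algebraic_int x" "algebraic_int y" "u \<in> U"
  shows "X ((x \<odot>\<^bsub>L\<^esub> e1 \<oplus>\<^bsub>L\<^esub> y \<odot>\<^bsub>L\<^esub> e2) \<oplus>\<^bsub>L\<^esub> u) = x"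
    "Y ((x \<odot>\<^bsub>L\<^esub> e1 \<oplus>\<^bsub>L\<^esub> y \<odot>\<^bsub>L\<^esub> e2) \<oplus>\<^bsub>L\<^esub> u) = y"
    "P ((x \<odot>\<^bsub>L\<^esub> e1 \<oplus>\<^bsub>L\<^esub> y \<odot>\<^bsub>L\<^esub> e2) \<oplus>\<^bsub>L\<^esub> u) = u"
proof -
  let ?v = "(x \<odot>\<^bsub>L\<^esub> e1 \<oplus>\<^bsub>L\<^esub> y \<odot>\<^bsub>L\<^esub> e2) \<oplus>\<^bsub>L\<^esub> u"
  have v: "?v \<in> carrier L" using assms e1(1) e2(1) by (simp add: smult_mem U_carrier)
  show x: "X ?v = x" and y: "Y ?v = y"
    using assms e_forms e1(1) e2(1) eps(1) by (simp_all add: X_def Y_def form_split U_def)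
  have "(x \<odot>\<^bsub>L\<^esub> e1 \<oplus>\<^bsub>L\<^esub> y \<odot>\<^bsub>L\<^esub> e2) \<oplus>\<^bsub>L\<^esub> u = (x \<odot>\<^bsub>L\<^esub> e1 \<oplus>\<^bsub>L\<^esub> y \<odot>\<^bsub>L\<^esub> e2) \<oplus>\<^bsub>L\<^esub> P ?v"
    using decompose[OF v] unfolding x y .
  then show "P ?v = u"
    using assms e1(1) e2(1) P_U[OF v] by (simp add: smult_mem U_carrier)
qed

lemma qform_split:
  assumes "algebraic_int x" "algebraic_int y" "u \<in> U"
  shows "qform L ((x \<odot>\<^bsub>L\<^esub> e1 \<oplus>\<^bsub>L\<^esub> y \<odot>\<^bsub>L\<^esub> e2) \<oplus>\<^bsub>L\<^esub> u) = x\<^sup>2 + \<epsilon> * y\<^sup>2 + qform L u"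
proof -
  have u: "bform L e1 u = 0" "bform L e2 u = 0"
    using assms(3) form_commute[OF e1(1)] form_commute[OF e2(1)] by (auto simp: U_def)
  let ?v = "(x \<odot>\<^bsub>L\<^esub> e1 \<oplus>\<^bsub>L\<^esub> y \<odot>\<^bsub>L\<^esub> e2) \<oplus>\<^bsub>L\<^esub> u"
  have v: "?v \<in> carrier L" using assms e1(1) e2(1) by (simp add: smult_mem U_carrier)
  have "qform L ?v = x * bform L e1 ?v + y * bform L e2 ?v + bform L u ?v"
    using form_split[OF v assms] form_self[OF v] by simp
  also have "bform L e1 ?v = x"
    using coords(1)[OF assms] form_commute[OF v e1(1)] by (simp add: X_def)
  also have "bform L e2 ?v = \<epsilon> * y"
    using coords(2)[OF assms] form_commute[OF v e2(1)] eps(1) by (simp add: Y_def field_simps)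
  also have "bform L u ?v = qform L u"
    using form_split[OF U_carrier[OF assms(3)] assms] form_commute[OF v U_carrier[OF assms(3)]]
      form_self[OF U_carrier[OF assms(3)]] u by simp
  finally show ?thesis by (simp add: power2_eq_square)
qed

lemma X_add: "u \<in> carrier L \<Longrightarrow> v \<in> carrier L \<Longrightarrow> X (u \<oplus>\<^bsub>L\<^esub> v) = X u + X v"
  using e1(1) by (simp add: X_def form_add)

lemma Y_add: "u \<in> carrier L \<Longrightarrow> v \<in> carrier L \<Longrightarrow> Y (u \<oplus>\<^bsub>L\<^esub> v) = Y u + Y v"
  using e2(1) by (simp add: Y_def form_add add_divide_distrib)

lemma X_smult: "algebraic_int a \<Longrightarrow> v \<in> carrier L \<Longrightarrow> X (a \<odot>\<^bsub>L\<^esub> v) = a * X v"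
  using e1(1) by (simp add: X_def form_smult)

lemma Y_smult: "algebraic_int a \<Longrightarrow> v \<in> carrier L \<Longrightarrow> Y (a \<odot>\<^bsub>L\<^esub> v) = a * Y v"
  using e2(1) by (simp add: Y_def form_smult)

lemma U_add: "u \<in> U \<Longrightarrow> v \<in> U \<Longrightarrow> u \<oplus>\<^bsub>L\<^esub> v \<in> U"
  using e1(1) e2(1) by (auto simp: U_def form_add)

lemma U_smult: "algebraic_int a \<Longrightarrow> v \<in> U \<Longrightarrow> a \<odot>\<^bsub>L\<^esub> v \<in> U"
  using e1(1) e2(1) by (auto simp: U_def form_smult smult_mem)

lemma U_zero: "\<zero>\<^bsub>L\<^esub> \<in> U"
  using e1(1) e2(1) by (simp add: U_def form_zero)

lemma P_add: "u \<in> carrier L \<Longrightarrow> v \<in> carrier L \<Longrightarrow> P (u \<oplus>\<^bsub>L\<^esub> v) = P u \<oplus>\<^bsub>L\<^esub> P v"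
proof -
  assume uv: "u \<in> carrier L" "v \<in> carrier L"
  note int = X_int[OF uv(1)] X_int[OF uv(2)] Y_int[OF uv(1)] Y_int[OF uv(2)]
  have mem: "X u \<odot>\<^bsub>L\<^esub> e1 \<in> carrier L" "Y u \<odot>\<^bsub>L\<^esub> e2 \<in> carrier L" "P u \<in> carrier L"
    "X v \<odot>\<^bsub>L\<^esub> e1 \<in> carrier L" "Y v \<odot>\<^bsub>L\<^esub> e2 \<in> carrier L" "P v \<in> carrier L"
    using int e1(1) e2(1) uv P_U U_carrier by (simp_all add: smult_mem)
  have "u \<oplus>\<^bsub>L\<^esub> v = ((X u \<odot>\<^bsub>L\<^esub> e1 \<oplus>\<^bsub>L\<^esub> Y u \<odot>\<^bsub>L\<^esub> e2) \<oplus>\<^bsub>L\<^esub> P u) \<oplus>\<^bsub>L\<^esub> ((X v \<odot>\<^bsub>L\<^esub> e1 \<oplus>\<^bsub>L\<^esub> Y v \<odot>\<^bsub>L\<^esub> e2) \<oplus>\<^bsub>L\<^esub> P v)"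
    using decompose uv by simp
  also have "\<dots> = ((X u \<odot>\<^bsub>L\<^esub> e1 \<oplus>\<^bsub>L\<^esub> X v \<odot>\<^bsub>L\<^esub> e1) \<oplus>\<^bsub>L\<^esub> (Y u \<odot>\<^bsub>L\<^esub> e2 \<oplus>\<^bsub>L\<^esub> Y v \<odot>\<^bsub>L\<^esub> e2)) \<oplus>\<^bsub>L\<^esub> (P u \<oplus>\<^bsub>L\<^esub> P v)"
    using mem by (simp only: M.a_ac M.a_closed)
  also have "\<dots> = ((X u + X v) \<odot>\<^bsub>L\<^esub> e1 \<oplus>\<^bsub>L\<^esub> (Y u + Y v) \<odot>\<^bsub>L\<^esub> e2) \<oplus>\<^bsub>L\<^esub> (P u \<oplus>\<^bsub>L\<^esub> P v)"
    using int e1(1) e2(1) by (simp add: smult_add)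
  finally have eq: "u \<oplus>\<^bsub>L\<^esub> v = \<dots>" .
  show ?thesis
    unfolding eq using int uv by (intro coords(3) algebraic_int_plus U_add P_U)
qed

lemma P_smult: "algebraic_int a \<Longrightarrow> v \<in> carrier L \<Longrightarrow> P (a \<odot>\<^bsub>L\<^esub> v) = a \<odot>\<^bsub>L\<^esub> P v"
proof -
  assume a: "algebraic_int a" and v: "v \<in> carrier L"
  note int = X_int[OF v] Y_int[OF v]
  have mem: "X v \<odot>\<^bsub>L\<^esub> e1 \<in> carrier L" "Y v \<odot>\<^bsub>L\<^esub> e2 \<in> carrier L" "P v \<in> carrier L"
    using int e1(1) e2(1) v P_U U_carrier by (simp_all add: smult_mem)
  have "a \<odot>\<^bsub>L\<^esub> v = a \<odot>\<^bsub>L\<^esub> ((X v \<odot>\<^bsub>L\<^esub> e1 \<oplus>\<^bsub>L\<^esub> Y v \<odot>\<^bsub>L\<^esub> e2) \<oplus>\<^bsub>L\<^esub> P v)"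
    using decompose v by simp
  also have "\<dots> = ((a * X v) \<odot>\<^bsub>L\<^esub> e1 \<oplus>\<^bsub>L\<^esub> (a * Y v) \<odot>\<^bsub>L\<^esub> e2) \<oplus>\<^bsub>L\<^esub> a \<odot>\<^bsub>L\<^esub> P v"
    using a mem int e1(1) e2(1) by (simp add: smult_r_distr smult_smult)
  finally have eq: "a \<odot>\<^bsub>L\<^esub> v = \<dots>" .
  show ?thesis unfolding eq using a int v by (intro coords(3) algebraic_int_times U_smult P_U)
qed

lemma e_not_U: "e1 \<notin> U" "e2 \<notin> U" "e1 \<noteq> e2"
  using e_forms eps(1) by (auto simp: U_def)

text \<open>Two vectors of \<open>U\<close> are dependent, since together with \<open>e1\<close>, \<open>e2\<close> they exceed the rank.\<close>

lemma U_dependent: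
  assumes "u \<in> U" "v \<in> U" "u \<noteq> v"
  obtains a b where "algebraic_int a" "algebraic_int b" "a \<noteq> 0 \<or> b \<noteq> 0" "a \<odot>\<^bsub>L\<^esub> u \<oplus>\<^bsub>L\<^esub> b \<odot>\<^bsub>L\<^esub> v = \<zero>\<^bsub>L\<^esub>"
proof -
  define S where "S = {e1, e2, u, v}"
  have dist: "e1 \<notin> {e2, u, v}" "e2 \<notin> {u, v}" "u \<notin> {v}" using assms e_not_U by auto
  have S: "finite S" "S \<subseteq> carrier L" "card S = 4"
    using assms e1(1) e2(1) dist by (auto simp: S_def U_carrier)
  have "\<not> lin_independent L S" using rank S(3) unfolding has_rank_def by auto
  then obtain c s where c: "\<forall>s\<in>S. algebraic_int (c s)" "lincomb c S = \<zero>\<^bsub>L\<^esub>" "s \<in> S" "c s \<noteq> 0"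
    unfolding lin_independent_alt using S by blast
  have c_int: "algebraic_int (c e1)" "algebraic_int (c e2)" "algebraic_int (c u)" "algebraic_int (c v)"
    using c(1) by (auto simp: S_def)
  note uv = U_carrier[OF assms(1)] U_carrier[OF assms(2)]
  have "lincomb c S = c e1 \<odot>\<^bsub>L\<^esub> e1 \<oplus>\<^bsub>L\<^esub> (c e2 \<odot>\<^bsub>L\<^esub> e2 \<oplus>\<^bsub>L\<^esub> (c u \<odot>\<^bsub>L\<^esub> u \<oplus>\<^bsub>L\<^esub> (c v \<odot>\<^bsub>L\<^esub> v \<oplus>\<^bsub>L\<^esub> \<zero>\<^bsub>L\<^esub>)))"
  proof -
    have "lincomb c {v} = c v \<odot>\<^bsub>L\<^esub> v \<oplus>\<^bsub>L\<^esub> \<zero>\<^bsub>L\<^esub>"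
      using lincomb_insert[of "{}" v c] uv c_int by (simp add: lincomb_empty)
    moreover have "lincomb c {u, v} = c u \<odot>\<^bsub>L\<^esub> u \<oplus>\<^bsub>L\<^esub> lincomb c {v}"
      using uv c_int dist by (intro lincomb_insert) auto
    moreover have "lincomb c {e2, u, v} = c e2 \<odot>\<^bsub>L\<^esub> e2 \<oplus>\<^bsub>L\<^esub> lincomb c {u, v}"
      using uv e2(1) c_int dist by (intro lincomb_insert) auto
    moreover have "lincomb c S = c e1 \<odot>\<^bsub>L\<^esub> e1 \<oplus>\<^bsub>L\<^esub> lincomb c {e2, u, v}"
      unfolding S_def using uv e1(1) e2(1) c_int dist by (intro lincomb_insert) auto
    ultimately show ?thesis by simp
  qed
  also have "\<dots> = (c e1 \<odot>\<^bsub>L\<^esub> e1 \<oplus>\<^bsub>L\<^esub> c e2 \<odot>\<^bsub>L\<^esub> e2) \<oplus>\<^bsub>L\<^esub> (c u \<odot>\<^bsub>L\<^esub> u \<oplus>\<^bsub>L\<^esub> c v \<odot>\<^bsub>L\<^esub> v)"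
    using uv e1(1) e2(1) c_int by (simp add: smult_mem M.a_assoc)
  finally have zero: "(c e1 \<odot>\<^bsub>L\<^esub> e1 \<oplus>\<^bsub>L\<^esub> c e2 \<odot>\<^bsub>L\<^esub> e2) \<oplus>\<^bsub>L\<^esub> (c u \<odot>\<^bsub>L\<^esub> u \<oplus>\<^bsub>L\<^esub> c v \<odot>\<^bsub>L\<^esub> v) = \<zero>\<^bsub>L\<^esub>"
    using c(2) by simp
  have w: "c u \<odot>\<^bsub>L\<^esub> u \<oplus>\<^bsub>L\<^esub> c v \<odot>\<^bsub>L\<^esub> v \<in> U" using assms c_int by (intro U_add U_smult)
  have "X \<zero>\<^bsub>L\<^esub> = 0" "Y \<zero>\<^bsub>L\<^esub> = 0" using e1(1) e2(1) by (simp_all add: X_def Y_def form_zero)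
  then have "c e1 = 0" "c e2 = 0"
    using coords(1,2)[OF c_int(1,2) w] unfolding zero by auto
  then have "c u \<odot>\<^bsub>L\<^esub> u \<oplus>\<^bsub>L\<^esub> c v \<odot>\<^bsub>L\<^esub> v = \<zero>\<^bsub>L\<^esub>" "c u \<noteq> 0 \<or> c v \<noteq> 0"
    using zero e1(1) e2(1) U_carrier[OF w] c(3,4) by (auto simp: smult_zero S_def)
  with c_int show ?thesis by (intro that[of "c u" "c v"]) auto
qed

text \<open>The Gram determinant of two dependent vectors vanishes. This supplies the square
  products required of the unary values.\<close>

lemma U_square:
  assumes "u \<in> U" "v \<in> U"
  shows "qform L u * qform L v = (bform L u v)\<^sup>2"
proof (cases "u = v")
  case True
  then show ?thesis using form_self[OF U_carrier[OF assms(1)]] by (simp add: power2_eq_square)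
next
  case False
  obtain a b where ab: "algebraic_int a" "algebraic_int b" "a \<noteq> 0 \<or> b \<noteq> 0"
    "a \<odot>\<^bsub>L\<^esub> u \<oplus>\<^bsub>L\<^esub> b \<odot>\<^bsub>L\<^esub> v = \<zero>\<^bsub>L\<^esub>"
    using U_dependent[OF assms False] .
  note uv = U_carrier[OF assms(1)] U_carrier[OF assms(2)]
  have lin: "a * bform L u w + b * bform L v w = 0" if "w \<in> carrier L" for w
    using form_zero[OF that] uv that ab(1,2) unfolding ab(4)[symmetric] by (simp add: form_add form_smult smult_mem)
  have 1: "a * qform L u + b * bform L u v = 0"
    using lin[OF uv(1)] form_self[OF uv(1)] form_commute[OF uv] by simp
  have 2: "a * bform L u v + b * qform L v = 0"
    using lin[OF uv(2)] form_self[OF uv(2)] by simp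
  have "a * (qform L u * qform L v - (bform L u v)\<^sup>2) =
      (a * qform L u + b * bform L u v) * qform L v - (a * bform L u v + b * qform L v) * bform L u v"
    by (simp add: power2_eq_square algebra_simps)
  moreover have "b * (qform L u * qform L v - (bform L u v)\<^sup>2) =
      (a * bform L u v + b * qform L v) * qform L u - (a * qform L u + b * bform L u v) * bform L u v"
    by (simp add: power2_eq_square algebra_simps)
  ultimately show ?thesis using ab(3) unfolding 1 2 by auto
qed

section \<open>The orthogonal complement as a unary lattice\<close>

definition L_u :: "('k, 'v) quad_module" where "L_u = L\<lparr>carrier := U\<rparr>"

lemma L_u_simps [simp]:
  "carrier L_u = U" "\<zero>\<^bsub>L_u\<^esub> = \<zero>\<^bsub>L\<^esub>" "u \<oplus>\<^bsub>L_u\<^esub> v = u \<oplus>\<^bsub>L\<^esub> v" "a \<odot>\<^bsub>L_u\<^esub> v = a \<odot>\<^bsub>L\<^esub> v"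
  "qform L_u = qform L" "bform L_u = bform L"
  by (simp_all add: L_u_def bform_def fun_eq_iff)

lemma abelian_group_L_u: "abelian_group L_u"
proof (rule abelian_groupI)
  show "\<exists>y\<in>carrier L_u. y \<oplus>\<^bsub>L_u\<^esub> x = \<zero>\<^bsub>L_u\<^esub>" if "x \<in> carrier L_u" for x
    using that U_smult[of "- 1" x] neg_eq_smult[of x] U_carrier M.l_neg[of x] by (intro bexI[of _ "(- 1) \<odot>\<^bsub>L\<^esub> x"]) auto
qed (auto simp: U_add U_zero U_carrier M.a_ac)

text \<open>The two sums are evaluated in different records; they agree because the complement is
  closed under the operations of \<open>L\<close>.\<close>

lemma finsum_L_u: "finite S \<Longrightarrow> f \<in> S \<rightarrow> U \<Longrightarrow> finsum L_u f S = finsum L f S"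
proof (induction S rule: finite_induct)
  case empty
  interpret U: abelian_group L_u by (rule abelian_group_L_u)
  show ?case by simp
next
  case (insert x S)
  interpret U: abelian_group L_u by (rule abelian_group_L_u)
  have "f \<in> S \<rightarrow> carrier L" "f x \<in> carrier L" "f \<in> S \<rightarrow> U" "f x \<in> U" using insert.prems U_carrier by (auto simp: Pi_iff)
  then show ?case using insert by (simp add: U.finsum_insert M.finsum_insert)
qed

lemma lin_independent_L_u: "lin_independent L_u S \<longleftrightarrow> S \<subseteq> U \<and> lin_independent L S"
proof -
  have "(\<Oplus>\<^bsub>L_u\<^esub>s\<in>S. c s \<odot>\<^bsub>L_u\<^esub> s) = (\<Oplus>\<^bsub>L\<^esub>s\<in>S. c s \<odot>\<^bsub>L\<^esub> s)"
    if "finite S" "S \<subseteq> U" "c \<in> S \<rightarrow> integers" for c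
    using that by (simp add: finsum_L_u Pi_iff subset_iff U_smult)
  then show ?thesis unfolding lin_independent_def using U_carrier by (auto simp: subset_iff)
qed

text \<open>Finite generation is the only axiom not inherited directly: the projection is linear and
  fixes \<open>U\<close>, so it maps generators of \<open>L\<close> to generators of
  \<open>U\<close>.\<close>

lemma quadratic_lattice_L_u: "quadratic_lattice L_u"
proof -
  obtain S where "generates L S" using finitely_generated by blast
  then have S: "finite S" "S \<subseteq> carrier L"
    "\<And>v. v \<in> carrier L \<Longrightarrow> \<exists>c. (\<forall>s\<in>S. algebraic_int (c s)) \<and> v = lincomb c S"
    unfolding generates_alt by auto
  define T where "T = P ` S"
  have T: "finite T" "T \<subseteq> U" "T \<subseteq> carrier L" using S P_U U_carrier by (auto simp: T_def)
  have span: "\<exists>d. (\<forall>t\<in>T. algebraic_int (d t)) \<and> P (lincomb c S') = lincomb d T"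
    if "finite S'" "S' \<subseteq> S" "\<forall>s\<in>S'. algebraic_int (c s)" for c S'
    using that
  proof (induction S' rule: finite_induct)
    case empty
    have "P \<zero>\<^bsub>L\<^esub> = \<zero>\<^bsub>L\<^esub>"
      using P_smult[of 0 "\<zero>\<^bsub>L\<^esub>"] smult_zero[of "\<zero>\<^bsub>L\<^esub>"] smult_zero[of "P \<zero>\<^bsub>L\<^esub>"] P_U[of "\<zero>\<^bsub>L\<^esub>"] U_carrier by simp
    then show ?case using T by (intro exI[of _ "\<lambda>_. 0"]) (simp add: lincomb_empty lincomb_zero)
  next
    case (insert x S')
    then obtain d where d: "\<forall>t\<in>T. algebraic_int (d t)" "P (lincomb c S') = lincomb d T" by auto
    have x: "x \<in> carrier L" "algebraic_int (c x)" "P x \<in> T" using insert.prems S(2) by (auto simp: T_def)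
    have S': "S' \<subseteq> carrier L" using insert.prems S(2) by auto
    have "P (lincomb c (insert x S')) = P (c x \<odot>\<^bsub>L\<^esub> x \<oplus>\<^bsub>L\<^esub> lincomb c S')"
      using insert S' x by (subst lincomb_insert) auto
    also have "\<dots> = c x \<odot>\<^bsub>L\<^esub> P x \<oplus>\<^bsub>L\<^esub> lincomb d T"
      using x insert S' by (simp add: P_add P_smult smult_mem lincomb_closed d(2))
    \<comment> \<open>Different generators may have the same projection, so the new coefficient is
      added to the one already present.\<close>
    also have "c x \<odot>\<^bsub>L\<^esub> P x = lincomb (\<lambda>t. if t = P x then c x else 0) T"
      using T x by (simp add: lincomb_single)
    also have "\<dots> \<oplus>\<^bsub>L\<^esub> lincomb d T = lincomb (\<lambda>t. (if t = P x then c x else 0) + d t) T"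
      using T x d(1) by (intro lincomb_add) auto
    finally show ?case using d(1) x(2)
      by (intro exI[of _ "\<lambda>t. (if t = P x then c x else 0) + d t"]) (auto intro: algebraic_int_plus)
  qed
  have "generates L_u T"
    unfolding generates_def
  proof (intro conjI ballI)
    fix v assume "v \<in> carrier L_u"
    then have v: "v \<in> U" by simp
    have "P v = v"
      using coords(3)[of 0 0 v] v e1(1) e2(1) U_carrier[OF v] by (simp add: smult_zero)
    moreover obtain c where "\<forall>s\<in>S. algebraic_int (c s)" "v = lincomb c S" using S(3)[OF U_carrier[OF v]] by blast
    ultimately obtain d where d: "\<forall>t\<in>T. algebraic_int (d t)" "v = lincomb d T"
      using span[OF S(1) order.refl] by metis
    have "(\<Oplus>\<^bsub>L_u\<^esub>s\<in>T. d s \<odot>\<^bsub>L_u\<^esub> s) = lincomb d T"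
      using T d(1) by (simp add: finsum_L_u lincomb_def Pi_iff subset_iff U_smult)
    then show "\<exists>c\<in>T \<rightarrow> integers. v = (\<Oplus>\<^bsub>L_u\<^esub>s\<in>T. c s \<odot>\<^bsub>L_u\<^esub> s)"
      using d by (intro bexI[of _ d]) (auto simp: Pi_iff)
  qed (use T in auto)
  then have gen: "\<exists>S. generates L_u S" by blast
  have "Module.module ring_of_integers L_u"
  proof (rule moduleI[OF _ abelian_group_L_u])
    show "cring (ring_of_integers :: 'k ring)" by (rule R.is_cring)
  qed (auto simp: U_smult U_carrier smult_add smult_r_distr smult_smult smult_1)
  then show ?thesis
  proof (rule quadratic_lattice.intro, unfold_locales)
    show "\<exists>S. generates L_u S" by (rule gen)
  qed (use torsion_free qform_closed qform_smult bform_add_left bform_smult_left bform_add_right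
      bform_smult_right classical_form positive_definite U_carrier in auto)
qed

text \<open>If \<open>U\<close> were 0, the coordinates \<open>X\<close>, \<open>Y\<close> would
  determine every vector, and three vectors with two coordinates each are dependent.\<close>

lemma U_nontrivial: "\<exists>u\<in>U. u \<noteq> \<zero>\<^bsub>L\<^esub>"
proof (rule ccontr)
  assume no: "\<not> ?thesis"
  obtain S where S: "lin_independent L S" "card S = 3" using rank by (auto simp: has_rank_def)
  obtain v1 v2 v3 where v: "S = {v1, v2, v3}" "v1 \<noteq> v2" "v2 \<noteq> v3" "v1 \<noteq> v3"
    using card_3_iff[THEN iffD1, OF S(2)] by blast
  have vc: "v1 \<in> carrier L" "v2 \<in> carrier L" "v3 \<in> carrier L" using S(1) v(1) by (auto simp: lin_independent_def)
  note int = X_int[OF vc(1)] X_int[OF vc(2)] X_int[OF vc(3)] Y_int[OF vc(1)] Y_int[OF vc(2)] Y_int[OF vc(3)]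
  have zero_iff: "w = \<zero>\<^bsub>L\<^esub>" if "w \<in> carrier L" "X w = 0" "Y w = 0" for w
    using decompose[OF that(1)] that no P_U[OF that(1)] e1(1) e2(1) by (auto simp: smult_zero)
  have dep: "a = 0 \<and> b = 0 \<and> c = 0"
    if abc: "algebraic_int a" "algebraic_int b" "algebraic_int c"
      "a * X v1 + b * X v2 + c * X v3 = 0" "a * Y v1 + b * Y v2 + c * Y v3 = 0" for a b c
  proof -
    define d where "d = (\<lambda>s. if s = v1 then a else if s = v2 then b else c)"
    have d: "\<forall>s\<in>S. algebraic_int (d s)" using abc(1-3) by (simp add: d_def)
    have mem: "lincomb d S \<in> carrier L" using d S(1) by (intro lincomb_closed) (auto simp: lin_independent_def)
    have "X (lincomb d S) = 0" "Y (lincomb d S) = 0"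
      using form_lincomb[of S d e1] form_lincomb[of S d e2] d S(1) e1(1) e2(1) v abc(4,5) eps(1)
      by (auto simp: X_def Y_def lin_independent_def d_def field_simps add.assoc)
    then have "lincomb d S = \<zero>\<^bsub>L\<^esub>" using zero_iff mem by blast
    then have "\<forall>s\<in>S. d s = 0" using S(1) d unfolding lin_independent_alt by blast
    then show ?thesis using v by (auto simp: d_def)
  qed
  \<comment> \<open>The cross product of the two coordinate rows is a relation, so independence
    kills all minors. With the minors gone, the coordinates of \<open>v1\<close> and
    \<open>v2\<close> themselves give relations and vanish; then \<open>v1\<close> alone satisfies a
    nontrivial one.\<close>
  have "X v2 * Y v3 - X v3 * Y v2 = 0 \<and> X v3 * Y v1 - X v1 * Y v3 = 0 \<and> X v1 * Y v2 - X v2 * Y v1 = 0"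
    using int by (intro dep) (auto intro!: algebraic_int_diff algebraic_int_times simp: algebra_simps)
  then have cross: "X v1 * Y v2 = X v2 * Y v1" by auto
  have "- X v2 = 0 \<and> X v1 = 0 \<and> (0 :: 'k) = 0"
    using int cross by (intro dep) (auto simp: algebra_simps)
  moreover have "- Y v2 = 0 \<and> Y v1 = 0 \<and> (0 :: 'k) = 0"
    using int cross by (intro dep) (auto simp: algebra_simps)
  ultimately have "1 = (0 :: 'k) \<and> (0 :: 'k) = 0 \<and> (0 :: 'k) = 0" by (intro dep) auto
  then show False by simp
qed

lemma has_rank_L_u: "has_rank L_u 1"
  unfolding has_rank_def lin_independent_L_u
proof (intro conjI allI impI)
  obtain u where u: "u \<in> U" "u \<noteq> \<zero>\<^bsub>L\<^esub>" using U_nontrivial by blast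
  have "lincomb c {u} = c u \<odot>\<^bsub>L\<^esub> u" if "algebraic_int (c u)" for c
    using lincomb_insert[of "{}" u c] that u(1) by (simp add: lincomb_empty U_carrier smult_mem)
  then have "lin_independent L {u}"
    unfolding lin_independent_alt using u U_carrier torsion_free[of _ u] by auto
  then show "\<exists>S. (S \<subseteq> U \<and> lin_independent L S) \<and> card S = 1" using u(1) by (intro exI[of _ "{u}"]) auto
next
  fix S assume S: "S \<subseteq> U \<and> lin_independent L S"
  then have fin: "finite S" "S \<subseteq> carrier L" by (auto simp: lin_independent_def)
  show "card S \<le> 1"
  proof (rule ccontr)
    assume "\<not> card S \<le> 1"
    then obtain u v where uv: "u \<in> S" "v \<in> S" "u \<noteq> v"
      using card_le_Suc0_iff_eq[OF fin(1)] by auto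
    obtain a b where ab: "algebraic_int a" "algebraic_int b" "a \<noteq> 0 \<or> b \<noteq> 0" "a \<odot>\<^bsub>L\<^esub> u \<oplus>\<^bsub>L\<^esub> b \<odot>\<^bsub>L\<^esub> v = \<zero>\<^bsub>L\<^esub>"
      using U_dependent[of u v] S uv by blast
    define c where "c = (\<lambda>s. (if s = u then a else 0) + (if s = v then b else 0))"
    have "lincomb c S = a \<odot>\<^bsub>L\<^esub> u \<oplus>\<^bsub>L\<^esub> b \<odot>\<^bsub>L\<^esub> v"
      unfolding c_def using fin uv ab(1,2) by (subst lincomb_add[symmetric]) (auto simp: lincomb_single)
    moreover have "\<forall>s\<in>S. algebraic_int (c s)" using ab(1,2) by (auto simp: c_def intro: algebraic_int_plus)
    ultimately have "\<forall>s\<in>S. c s = 0" using S ab(4) unfolding lin_independent_alt by metis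
    then have "c u = 0" "c v = 0" using uv by auto
    then show False using ab(3) uv(3) by (auto simp: c_def)
  qed
qed

lemma diag_carrier: "carrier (diag_lattice [1, \<epsilon>]) = {[x, y] | x y. algebraic_int x \<and> algebraic_int y}"
  by (auto simp: diag_lattice_def length_Suc_conv)

theorem isometric_split: "isometric L (orth_sum (diag_lattice [1, \<epsilon>]) L_u)"
  unfolding isometric_def
proof (intro exI conjI ballI)
  define f where "f = (\<lambda>v. ([X v, Y v], P v))"
  have target: "carrier (orth_sum (diag_lattice [1, \<epsilon>]) L_u) =
      {[x, y] | x y. algebraic_int x \<and> algebraic_int y} \<times> U"
    by (simp add: orth_sum_def diag_carrier)
  show "bij_betw f (carrier L) (carrier (orth_sum (diag_lattice [1, \<epsilon>]) L_u))"
    unfolding target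
  proof (rule bij_betw_byWitness[where f' = "\<lambda>(l, u). (l ! 0 \<odot>\<^bsub>L\<^esub> e1 \<oplus>\<^bsub>L\<^esub> l ! 1 \<odot>\<^bsub>L\<^esub> e2) \<oplus>\<^bsub>L\<^esub> u"])
    show "\<forall>v\<in>carrier L. (\<lambda>(l, u). (l ! 0 \<odot>\<^bsub>L\<^esub> e1 \<oplus>\<^bsub>L\<^esub> l ! 1 \<odot>\<^bsub>L\<^esub> e2) \<oplus>\<^bsub>L\<^esub> u) (f v) = v"
      by (simp add: f_def flip: decompose)
    show "\<forall>p\<in>{[x, y] | x y. algebraic_int x \<and> algebraic_int y} \<times> U.
        f ((\<lambda>(l, u). (l ! 0 \<odot>\<^bsub>L\<^esub> e1 \<oplus>\<^bsub>L\<^esub> l ! 1 \<odot>\<^bsub>L\<^esub> e2) \<oplus>\<^bsub>L\<^esub> u) p) = p"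
      by (auto simp: f_def coords)
    show "f ` carrier L \<subseteq> {[x, y] | x y. algebraic_int x \<and> algebraic_int y} \<times> U"
      by (auto simp: f_def X_int Y_int P_U)
    show "(\<lambda>(l, u). (l ! 0 \<odot>\<^bsub>L\<^esub> e1 \<oplus>\<^bsub>L\<^esub> l ! 1 \<odot>\<^bsub>L\<^esub> e2) \<oplus>\<^bsub>L\<^esub> u) `
        ({[x, y] | x y. algebraic_int x \<and> algebraic_int y} \<times> U) \<subseteq> carrier L"
      using e1(1) e2(1) by (auto simp: smult_mem U_carrier)
  qed
  fix u v assume uv: "u \<in> carrier L" "v \<in> carrier L"
  show "f (u \<oplus>\<^bsub>L\<^esub> v) = f u \<oplus>\<^bsub>orth_sum (diag_lattice [1, \<epsilon>]) L_u\<^esub> f v"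
    using uv by (simp add: f_def orth_sum_def diag_lattice_def X_add Y_add P_add)
next
  fix a :: 'k and v assume "a \<in> integers" "v \<in> carrier L"
  then show "([X (a \<odot>\<^bsub>L\<^esub> v), Y (a \<odot>\<^bsub>L\<^esub> v)], P (a \<odot>\<^bsub>L\<^esub> v)) =
      a \<odot>\<^bsub>orth_sum (diag_lattice [1, \<epsilon>]) L_u\<^esub> ([X v, Y v], P v)"
    by (simp add: orth_sum_def diag_lattice_def X_smult Y_smult P_smult)
next
  fix v assume v: "v \<in> carrier L"
  show "qform (orth_sum (diag_lattice [1, \<epsilon>]) L_u) ([X v, Y v], P v) = qform L v"
    using qform_split[OF X_int[OF v] Y_int[OF v] P_U[OF v]] decompose[OF v]
    by (simp add: orth_sum_def diag_lattice_def lessThan_Suc numeral_2_eq_2)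
qed

text \<open>
  If \<open>L\<close> is generated by three vectors \<open>b\<^sub>i\<close>, then \<open>U\<close> is generated by
  \<open>\<Sum> m\<^sub>i P b\<^sub>i\<close>, where \<open>m\<close> is the cross product of the coordinate vectors \<open>(X b\<^sub>i)\<close> and \<open>(Y b\<^sub>i)\<close>.
\<close>

lemma U_principal:
  assumes b: "b1 \<in> carrier L" "b2 \<in> carrier L" "b3 \<in> carrier L"
    and gen: "\<And>v. v \<in> carrier L \<Longrightarrow> \<exists>p1 p2 p3. algebraic_int p1 \<and> algebraic_int p2 \<and> algebraic_int p3 \<and>
      v = (p1 \<odot>\<^bsub>L\<^esub> b1 \<oplus>\<^bsub>L\<^esub> p2 \<odot>\<^bsub>L\<^esub> b2) \<oplus>\<^bsub>L\<^esub> p3 \<odot>\<^bsub>L\<^esub> b3"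
  obtains u0 where "u0 \<in> U" "\<And>v. v \<in> U \<Longrightarrow> \<exists>z. algebraic_int z \<and> v = z \<odot>\<^bsub>L\<^esub> u0"
proof -
  obtain p1 p2 p3 where p: "algebraic_int p1" "algebraic_int p2" "algebraic_int p3"
    "e1 = (p1 \<odot>\<^bsub>L\<^esub> b1 \<oplus>\<^bsub>L\<^esub> p2 \<odot>\<^bsub>L\<^esub> b2) \<oplus>\<^bsub>L\<^esub> p3 \<odot>\<^bsub>L\<^esub> b3" using gen[OF e1(1)] by blast
  obtain q1 q2 q3 where q: "algebraic_int q1" "algebraic_int q2" "algebraic_int q3"
    "e2 = (q1 \<odot>\<^bsub>L\<^esub> b1 \<oplus>\<^bsub>L\<^esub> q2 \<odot>\<^bsub>L\<^esub> b2) \<oplus>\<^bsub>L\<^esub> q3 \<odot>\<^bsub>L\<^esub> b3" using gen[OF e2(1)] by blast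
  define x1 x2 x3 y1 y2 y3 where xy: "x1 = X b1" "x2 = X b2" "x3 = X b3" "y1 = Y b1" "y2 = Y b2" "y3 = Y b3"
  have xy_int: "algebraic_int x1" "algebraic_int x2" "algebraic_int x3"
    "algebraic_int y1" "algebraic_int y2" "algebraic_int y3"
    using b by (simp_all add: xy X_int Y_int)
  define m1 m2 m3 where m: "m1 = x2 * y3 - x3 * y2" "m2 = x3 * y1 - x1 * y3" "m3 = x1 * y2 - x2 * y1"
  \<comment> \<open>The cross product of the coefficient vectors of \<open>e1\<close> and
    \<open>e2\<close> in the generators. Its scalar product with \<open>m\<close> is the determinant
    of the 2 by 2 identity matrix, by Lagrange's identity.\<close>
  define n1 n2 n3 where n: "n1 = p2 * q3 - p3 * q2" "n2 = p3 * q1 - p1 * q3" "n3 = p1 * q2 - p2 * q1"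
  have m_int: "algebraic_int m1" "algebraic_int m2" "algebraic_int m3"
    unfolding m using xy_int by (auto intro!: algebraic_int_diff algebraic_int_times)
  have n_int: "algebraic_int n1" "algebraic_int n2" "algebraic_int n3"
    unfolding n using p q by (auto intro!: algebraic_int_diff algebraic_int_times)
  have Xe: "X e1 = 1" "X e2 = 0" "Y e1 = 0" "Y e2 = 1" using e_forms eps(1) by (simp_all add: X_def Y_def)
  have px: "p1 * x1 + p2 * x2 + p3 * x3 = 1" and py: "p1 * y1 + p2 * y2 + p3 * y3 = 0"
  proof -
    have "X ((p1 \<odot>\<^bsub>L\<^esub> b1 \<oplus>\<^bsub>L\<^esub> p2 \<odot>\<^bsub>L\<^esub> b2) \<oplus>\<^bsub>L\<^esub> p3 \<odot>\<^bsub>L\<^esub> b3) = 1"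
      "Y ((p1 \<odot>\<^bsub>L\<^esub> b1 \<oplus>\<^bsub>L\<^esub> p2 \<odot>\<^bsub>L\<^esub> b2) \<oplus>\<^bsub>L\<^esub> p3 \<odot>\<^bsub>L\<^esub> b3) = 0"
      by (simp_all only: p(4)[symmetric] Xe)
    then show "p1 * x1 + p2 * x2 + p3 * x3 = 1" "p1 * y1 + p2 * y2 + p3 * y3 = 0"
      using p(1-3) b by (simp_all add: X_add Y_add X_smult Y_smult smult_mem xy)
  qed
  have qx: "q1 * x1 + q2 * x2 + q3 * x3 = 0" and qy: "q1 * y1 + q2 * y2 + q3 * y3 = 1"
  proof -
    have "X ((q1 \<odot>\<^bsub>L\<^esub> b1 \<oplus>\<^bsub>L\<^esub> q2 \<odot>\<^bsub>L\<^esub> b2) \<oplus>\<^bsub>L\<^esub> q3 \<odot>\<^bsub>L\<^esub> b3) = 0"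
      "Y ((q1 \<odot>\<^bsub>L\<^esub> b1 \<oplus>\<^bsub>L\<^esub> q2 \<odot>\<^bsub>L\<^esub> b2) \<oplus>\<^bsub>L\<^esub> q3 \<odot>\<^bsub>L\<^esub> b3) = 1"
      by (simp_all only: q(4)[symmetric] Xe)
    then show "q1 * x1 + q2 * x2 + q3 * x3 = 0" "q1 * y1 + q2 * y2 + q3 * y3 = 1"
      using q(1-3) b by (simp_all add: X_add Y_add X_smult Y_smult smult_mem xy)
  qed
  define u1 u2 u3 where u: "u1 = P b1" "u2 = P b2" "u3 = P b3"
  have uU: "u1 \<in> U" "u2 \<in> U" "u3 \<in> U" using b by (simp_all add: u P_U)
  note uc = uU[THEN U_carrier]
  have Pe: "P e1 = \<zero>\<^bsub>L\<^esub>" "P e2 = \<zero>\<^bsub>L\<^esub>"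
    using coords(3)[of 1 0 "\<zero>\<^bsub>L\<^esub>"] coords(3)[of 0 1 "\<zero>\<^bsub>L\<^esub>"] U_zero e1(1) e2(1) by (simp_all add: smult_zero smult_1)
  have P3: "P ((a1 \<odot>\<^bsub>L\<^esub> b1 \<oplus>\<^bsub>L\<^esub> a2 \<odot>\<^bsub>L\<^esub> b2) \<oplus>\<^bsub>L\<^esub> a3 \<odot>\<^bsub>L\<^esub> b3) = (a1 \<odot>\<^bsub>L\<^esub> u1 \<oplus>\<^bsub>L\<^esub> a2 \<odot>\<^bsub>L\<^esub> u2) \<oplus>\<^bsub>L\<^esub> a3 \<odot>\<^bsub>L\<^esub> u3"
    if "algebraic_int a1" "algebraic_int a2" "algebraic_int a3" for a1 a2 a3
    using that b by (simp add: P_add P_smult smult_mem u)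
  have B3: "bform L ((a1 \<odot>\<^bsub>L\<^esub> u1 \<oplus>\<^bsub>L\<^esub> a2 \<odot>\<^bsub>L\<^esub> u2) \<oplus>\<^bsub>L\<^esub> a3 \<odot>\<^bsub>L\<^esub> u3) h = a1 * bform L u1 h + a2 * bform L u2 h + a3 * bform L u3 h"
    if "algebraic_int a1" "algebraic_int a2" "algebraic_int a3" "h \<in> carrier L" for a1 a2 a3 h
    using that uc by (simp add: form_add form_smult smult_mem)
  define u0 where "u0 = (m1 \<odot>\<^bsub>L\<^esub> u1 \<oplus>\<^bsub>L\<^esub> m2 \<odot>\<^bsub>L\<^esub> u2) \<oplus>\<^bsub>L\<^esub> m3 \<odot>\<^bsub>L\<^esub> u3"
  have u0: "u0 \<in> U" unfolding u0_def using m_int uU by (intro U_add U_smult)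
  have forms: "bform L u1 h = n1 * bform L u0 h" "bform L u2 h = n2 * bform L u0 h" "bform L u3 h = n3 * bform L u0 h"
    if h: "h \<in> carrier L" for h
  proof -
    \<comment> \<open>Since \<open>e1\<close> and \<open>e2\<close> project to 0, the vector
      \<open>t\<close> is orthogonal to both coefficient vectors, hence parallel to
      \<open>n\<close>; the factor is found by pairing with \<open>m\<close>.\<close>
    define t1 t2 t3 where t: "t1 = bform L u1 h" "t2 = bform L u2 h" "t3 = bform L u3 h"
    have pt: "p1 * t1 + p2 * t2 + p3 * t3 = 0"
      using B3[OF p(1-3) h] form_zero[OF h] Pe(1) P3[OF p(1-3)] unfolding p(4)[symmetric] t by simp
    have qt: "q1 * t1 + q2 * t2 + q3 * t3 = 0"
      using B3[OF q(1-3) h] form_zero[OF h] Pe(2) P3[OF q(1-3)] unfolding q(4)[symmetric] t by simp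
    have mt: "bform L u0 h = m1 * t1 + m2 * t2 + m3 * t3"
      unfolding u0_def t by (rule B3[OF m_int h])
    have nm: "n1 * m1 + n2 * m2 + n3 * m3 = 1"
    proof -
      have "n1 * m1 + n2 * m2 + n3 * m3 =
          (p1 * x1 + p2 * x2 + p3 * x3) * (q1 * y1 + q2 * y2 + q3 * y3) -
          (p1 * y1 + p2 * y2 + p3 * y3) * (q1 * x1 + q2 * x2 + q3 * x3)"
        by (simp add: m n algebra_simps)
      then show ?thesis unfolding px py qx qy by simp
    qed
    have "n1 * (m1 * t1 + m2 * t2 + m3 * t3) - t1 * (n1 * m1 + n2 * m2 + n3 * m3) =
        m2 * (q3 * (p1 * t1 + p2 * t2 + p3 * t3) * 0 + (n1 * t2 - n2 * t1)) - m3 * (n3 * t1 - n1 * t3)"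
      by (simp add: algebra_simps)
    moreover have cross: "n1 * t2 - n2 * t1 = 0" "n3 * t1 - n1 * t3 = 0" "n2 * t3 - n3 * t2 = 0"
    proof -
      have "n1 * t2 - n2 * t1 = q3 * (p1 * t1 + p2 * t2 + p3 * t3) - p3 * (q1 * t1 + q2 * t2 + q3 * t3)"
        "n3 * t1 - n1 * t3 = q2 * (p1 * t1 + p2 * t2 + p3 * t3) - p2 * (q1 * t1 + q2 * t2 + q3 * t3)"
        "n2 * t3 - n3 * t2 = q1 * (p1 * t1 + p2 * t2 + p3 * t3) - p1 * (q1 * t1 + q2 * t2 + q3 * t3)"
        by (simp_all add: n algebra_simps)
      then show "n1 * t2 - n2 * t1 = 0" "n3 * t1 - n1 * t3 = 0" "n2 * t3 - n3 * t2 = 0"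
        unfolding pt qt by simp_all
    qed
    moreover have "n2 * (m1 * t1 + m2 * t2 + m3 * t3) - t2 * (n1 * m1 + n2 * m2 + n3 * m3) =
        m3 * (n2 * t3 - n3 * t2) - m1 * (n1 * t2 - n2 * t1)"
      "n3 * (m1 * t1 + m2 * t2 + m3 * t3) - t3 * (n1 * m1 + n2 * m2 + n3 * m3) =
        m1 * (n3 * t1 - n1 * t3) - m2 * (n2 * t3 - n3 * t2)"
      by (simp_all add: algebra_simps)
    ultimately show "bform L u1 h = n1 * bform L u0 h" "bform L u2 h = n2 * bform L u0 h" "bform L u3 h = n3 * bform L u0 h"
      unfolding mt t[symmetric] nm by simp_all
  qed
  show ?thesis
  proof (rule that[OF u0])
    fix v assume v: "v \<in> U"
    obtain c1 c2 c3 where c: "algebraic_int c1" "algebraic_int c2" "algebraic_int c3"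
      "v = (c1 \<odot>\<^bsub>L\<^esub> b1 \<oplus>\<^bsub>L\<^esub> c2 \<odot>\<^bsub>L\<^esub> b2) \<oplus>\<^bsub>L\<^esub> c3 \<odot>\<^bsub>L\<^esub> b3" using gen[OF U_carrier[OF v]] by blast
    have "P v = v" using coords(3)[of 0 0 v] v e1(1) e2(1) U_carrier[OF v] by (simp add: smult_zero)
    then have v3: "v = (c1 \<odot>\<^bsub>L\<^esub> u1 \<oplus>\<^bsub>L\<^esub> c2 \<odot>\<^bsub>L\<^esub> u2) \<oplus>\<^bsub>L\<^esub> c3 \<odot>\<^bsub>L\<^esub> u3" using P3[OF c(1-3)] c(4) by simp
    define z where "z = c1 * n1 + c2 * n2 + c3 * n3"
    have z: "algebraic_int z" unfolding z_def using c n_int by (intro algebraic_int_plus algebraic_int_times)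
    have form_v: "bform L v h = z * bform L u0 h" if "h \<in> carrier L" for h
      unfolding v3 B3[OF c(1-3) that] forms[OF that] by (simp add: z_def algebra_simps)
    \<comment> \<open>So far \<open>v\<close> and the multiple of \<open>u0\<close> agree only under
      the form with every vector; definiteness turns this into equality.\<close>
    define w where "w = v \<oplus>\<^bsub>L\<^esub> (- z) \<odot>\<^bsub>L\<^esub> u0"
    note vu = U_carrier[OF v] U_carrier[OF u0]
    have w: "w \<in> carrier L" unfolding w_def using vu z by (simp add: smult_mem)
    have "qform L w = bform L v w + (- z) * bform L u0 w"
      using form_self[OF w] vu z w unfolding w_def by (simp add: form_add form_smult smult_mem)
    then have "qform L w = 0" using form_v[OF w] by simp
    then have "w = \<zero>\<^bsub>L\<^esub>" using qform_eq_0[OF w] by blast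
    then have "v \<oplus>\<^bsub>L\<^esub> \<ominus>\<^bsub>L\<^esub> (z \<odot>\<^bsub>L\<^esub> u0) = \<zero>\<^bsub>L\<^esub>"
      using vu z by (simp add: w_def neg_eq_smult smult_smult smult_mem)
    then have "v = z \<odot>\<^bsub>L\<^esub> u0"
      using vu z M.minus_equality[of v "\<ominus>\<^bsub>L\<^esub> (z \<odot>\<^bsub>L\<^esub> u0)"] by (simp add: smult_mem)
    with z show "\<exists>z. algebraic_int z \<and> v = z \<odot>\<^bsub>L\<^esub> u0" by blast
  qed
qed

lemma free_U_principal:
  assumes "free_lattice L"
  obtains u0 where "u0 \<in> U" "\<And>v. v \<in> U \<Longrightarrow> \<exists>z. algebraic_int z \<and> v = z \<odot>\<^bsub>L\<^esub> u0"
proof -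
  obtain B where B: "lin_independent L B" "generates L B" using assms by (auto simp: free_lattice_def)
  have fin: "finite B" "B \<subseteq> carrier L" and "card B \<le> 3"
    using B(1) rank by (auto simp: lin_independent_def has_rank_def)
  obtain bs where bs: "set bs = B" "distinct bs" using finite_distinct_list[OF fin(1)] by blast
  \<comment> \<open>Padding with zero vectors to three generators, so that
    \<open>U_principal\<close> applies to a basis of any size up to 3.\<close>
  define b where "b = (\<lambda>i. if i < length bs then bs ! i else \<zero>\<^bsub>L\<^esub>)"
  have len: "length bs \<le> 3" using bs \<open>card B \<le> 3\<close> distinct_card by metis
  have bc: "b i \<in> carrier L" for i using bs(1) fin(2) nth_mem by (fastforce simp: b_def)
  have lin: "lincomb c B = (c' 0 \<odot>\<^bsub>L\<^esub> b 0 \<oplus>\<^bsub>L\<^esub> c' 1 \<odot>\<^bsub>L\<^esub> b 1) \<oplus>\<^bsub>L\<^esub> c' 2 \<odot>\<^bsub>L\<^esub> b 2"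
    if c: "\<forall>s\<in>B. algebraic_int (c s)" and c': "c' = (\<lambda>i. if i < length bs then c (bs ! i) else 0)" for c c'
  proof -
    have sum: "lincomb c (set (x # xs)) = c x \<odot>\<^bsub>L\<^esub> x \<oplus>\<^bsub>L\<^esub> lincomb c (set xs)"
      if "distinct (x # xs)" "set (x # xs) \<subseteq> B" for x xs
      unfolding list.set by (rule lincomb_insert) (use that fin c in auto)
    consider "bs = []" | x where "bs = [x]" | x y where "bs = [x, y]" | x y z where "bs = [x, y, z]"
    proof -
      have "length bs = 0 \<or> length bs = 1 \<or> length bs = 2 \<or> length bs = 3" using len by linarith
      then show ?thesis by (elim disjE) (auto simp: length_Suc_conv eval_nat_numeral intro: that)
    qed
    then show ?thesis
    proof cases
      case 1
      then show ?thesis using bs(1) by (simp add: c' b_def lincomb_empty smult_zero)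
    next
      case (2 x)
      have "x \<in> carrier L" "algebraic_int (c x)" using 2 bs(1) fin c by auto
      moreover have "lincomb c B = c x \<odot>\<^bsub>L\<^esub> x \<oplus>\<^bsub>L\<^esub> \<zero>\<^bsub>L\<^esub>"
        using sum[of x "[]"] 2 bs by (auto simp: lincomb_empty)
      ultimately show ?thesis using 2 by (simp add: c' b_def smult_mem smult_zero)
    next
      case (3 x y)
      have "x \<in> carrier L" "algebraic_int (c x)" "y \<in> carrier L" "algebraic_int (c y)" using 3 bs(1) fin c by auto
      moreover have "lincomb c B = c x \<odot>\<^bsub>L\<^esub> x \<oplus>\<^bsub>L\<^esub> (c y \<odot>\<^bsub>L\<^esub> y \<oplus>\<^bsub>L\<^esub> \<zero>\<^bsub>L\<^esub>)"
        using sum[of x "[y]"] sum[of y "[]"] 3 bs by (auto simp: lincomb_empty)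
      ultimately show ?thesis using 3 by (simp add: c' b_def smult_mem smult_zero)
    next
      case (4 x y z)
      have "x \<in> carrier L" "algebraic_int (c x)" "y \<in> carrier L" "algebraic_int (c y)"
        "z \<in> carrier L" "algebraic_int (c z)" using 4 bs(1) fin c by auto
      moreover have "lincomb c B = c x \<odot>\<^bsub>L\<^esub> x \<oplus>\<^bsub>L\<^esub> (c y \<odot>\<^bsub>L\<^esub> y \<oplus>\<^bsub>L\<^esub> (c z \<odot>\<^bsub>L\<^esub> z \<oplus>\<^bsub>L\<^esub> \<zero>\<^bsub>L\<^esub>))"
        using sum[of x "[y, z]"] sum[of y "[z]"] sum[of z "[]"] 4 bs by (auto simp: lincomb_empty)
      ultimately show ?thesis using 4 by (simp add: c' b_def smult_mem M.a_assoc)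
    qed
  qed
  have "\<exists>p1 p2 p3. algebraic_int p1 \<and> algebraic_int p2 \<and> algebraic_int p3 \<and>
      v = (p1 \<odot>\<^bsub>L\<^esub> b 0 \<oplus>\<^bsub>L\<^esub> p2 \<odot>\<^bsub>L\<^esub> b 1) \<oplus>\<^bsub>L\<^esub> p3 \<odot>\<^bsub>L\<^esub> b 2" if v: "v \<in> carrier L" for v
  proof -
    obtain c where c: "\<forall>s\<in>B. algebraic_int (c s)" "v = lincomb c B" using B(2) v unfolding generates_alt by blast
    define c' where "c' = (\<lambda>i. if i < length bs then c (bs ! i) else 0)"
    have "algebraic_int (c' i)" for i using c(1) bs(1) nth_mem[of i bs] by (auto simp: c'_def)
    then show ?thesis using lin[OF c(1) c'_def] c(2) by blast
  qed
  from U_principal[OF bc bc bc this] that show ?thesis by blast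
qed

end

section \<open>Ramification of 2\<close>

text \<open>Zorn's lemma on the ideals that contain \<open>I\<close> but not 1; a maximal member is
  a maximal ideal, hence prime.\<close>

lemma (in cring) ex_primeideal_above:
  assumes "ideal I R" "\<one> \<notin> I"
  obtains P where "primeideal P R" "I \<subseteq> P"
proof -
  let ?A = "{J. ideal J R \<and> I \<subseteq> J \<and> \<one> \<notin> J}"
  have "\<exists>M\<in>?A. \<forall>J\<in>?A. M \<subseteq> J \<longrightarrow> J = M"
  proof (rule subset_Zorn_nonempty)
    show "?A \<noteq> {}" using assms by blast
    fix C assume C: "C \<noteq> {}" "subset.chain ?A C"
    then have "subset.chain {J. ideal J R} C" by (auto simp: pred_on.chain_def)
    from chain_Union_is_ideal[OF this] C show "\<Union>C \<in> ?A"
      by (auto simp: pred_on.chain_def)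
  qed
  then obtain M where "M \<in> ?A" and max: "\<forall>J\<in>?A. M \<subseteq> J \<longrightarrow> J = M" by (rule bexE)
  then have M: "ideal M R" "I \<subseteq> M" "\<one> \<notin> M" by simp_all
  have "maximalideal M R"
  proof (rule maximalidealI[OF M(1)])
    show "carrier R \<noteq> M" using M(3) one_closed by blast
    fix J assume J: "ideal J R" "M \<subseteq> J"
    then show "J = M \<or> J = carrier R" using bspec[OF max, of J] M(2) ideal.one_imp_carrier[OF J(1)] by (cases "\<one> \<in> J") auto
  qed
  with M(2) that show ?thesis using maximalideal_prime by blast
qed

lemma cring_ring_of_integers: "cring (ring_of_integers :: 'k::field_char_0 ring)"
proof (intro cringI abelian_groupI comm_monoidI)
  fix x :: 'k assume "x \<in> carrier ring_of_integers"
  then show "\<exists>y\<in>carrier ring_of_integers. y \<oplus>\<^bsub>ring_of_integers\<^esub> x = \<zero>\<^bsub>ring_of_integers\<^esub>"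
    by (intro bexI[of _ "- x"]) auto
qed (auto simp: algebra_simps algebraic_int_plus algebraic_int_times)

context totally_real_field
begin

lemma Units_ring_of_integers: "u \<in> Units ring_of_integers \<longleftrightarrow> int_unit (u :: 'k)"
proof
  assume "u \<in> Units ring_of_integers"
  then show "int_unit u" by (auto simp: Units_def intro: int_unitI)
next
  assume u: "int_unit u"
  then show "u \<in> Units ring_of_integers"
    by (auto simp: Units_def int_unit_def intro!: bexI[of _ "inverse u"])
qed

text \<open>Any prime above \<open>s\<close> contains 2 in its square, since 2 is
  \<open>s\<^sup>2\<close> up to a unit. Such a prime exists because a unit \<open>s\<close> would
  make 2 a unit, of norm 1.\<close>

lemma ramified_2:
  assumes "int_unit e" "algebraic_int s" "2 * e = (s :: 'k)\<^sup>2"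
  shows "ramified 2 TYPE('k)"
proof -
  interpret cring "ring_of_integers :: 'k ring" by (rule cring_ring_of_integers)
  have s: "s \<in> carrier ring_of_integers" using assms(2) by simp
  have "\<one>\<^bsub>ring_of_integers\<^esub> \<notin> cgenideal ring_of_integers s"
  proof
    assume "\<one>\<^bsub>ring_of_integers\<^esub> \<in> cgenideal ring_of_integers s"
    then obtain t where "algebraic_int t" "t * s = 1" by (auto simp: cgenideal_def)
    then have "int_unit s" using assms(2) int_unitI[of s t] by (simp add: mult.commute)
    then have "int_unit (s\<^sup>2 / e)" using assms(1) by (intro int_unit_divide) (simp_all add: power2_eq_square int_unit_mult)
    also have "s\<^sup>2 / e = of_nat 2" using assms(1) by (simp flip: assms(3) add: int_unit_def)
    finally have "(2 :: nat) ^ card E = 1" using nat_norm_unit nat_norm_of_nat[of 2] by metis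
    then show False using card_E_pos by simp
  qed
  then obtain P where P: "primeideal P (ring_of_integers :: 'k ring)" "cgenideal ring_of_integers s \<subseteq> P"
    using ex_primeideal_above[OF cgenideal_ideal[OF s]] by blast
  interpret P: primeideal P "ring_of_integers :: 'k ring" by (rule P(1))
  have sP: "s \<in> P" using P(2) cgenideal_self[OF s] by blast
  show ?thesis unfolding ramified_def
  proof (intro exI conjI subsetI)
    show "primeideal P ring_of_integers" by (rule P(1))
    fix z :: 'k assume "z \<in> cgenideal ring_of_integers (of_nat 2)"
    then obtain x where x: "algebraic_int x" "z = x * 2" by (auto simp: cgenideal_def)
    define r where "r = x * s * inverse e"
    have "x * inverse e \<in> carrier ring_of_integers" using x(1) assms(1) by (simp add: algebraic_int_times int_unit_def)
    from P.I_l_closed[OF sP this] have "r \<in> P" by (simp add: r_def ac_simps)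
    from ideal_prod.prod[OF this sP, of ring_of_integers] have "r * s \<in> ideal_prod ring_of_integers P P" by simp
    also have "r * s = inverse e * x * (2 * e)" unfolding assms(3) by (simp add: r_def power2_eq_square)
    also have "\<dots> = z" using assms(1) by (simp add: x(2) int_unit_def)
    finally show "z \<in> ideal_prod ring_of_integers P P" .
  qed
qed

section \<open>Classes of totally positive units, and unit vectors\<close>

text \<open>A unit outside both classes would give, with 1 and \<epsilon>, three distinct cosets in
  a quotient of order 2.\<close>

lemma unit_classes_of_order_2:
  fixes \<epsilon> u :: 'k
  assumes ord: "Coset.order ((pos_unit_group :: 'k monoid) Mod unit_squares) = 2"
    and \<epsilon>: "\<epsilon> \<in> pos_units - unit_squares" and u: "u \<in> pos_units"
  shows "\<exists>t. int_unit t \<and> (u = t\<^sup>2 \<or> u = \<epsilon> * t\<^sup>2)"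
proof (rule ccontr)
  define C where "C = (\<lambda>a :: 'k. {h * a |h. h \<in> unit_squares})"
  have sq: "v \<in> unit_squares \<longleftrightarrow> (\<exists>t. int_unit t \<and> v = t\<^sup>2)" for v :: 'k
    by (auto simp: unit_squares_def Units_ring_of_integers)
  have self: "a \<in> C a" for a using int_unit_1 by (auto simp: C_def sq intro!: exI[of _ 1])
  assume "\<not> ?thesis"
  then have "u \<notin> C 1" "u \<notin> C \<epsilon>" by (auto simp: C_def sq mult.commute)
  moreover have "\<epsilon> \<notin> C 1" using \<epsilon> by (auto simp: C_def)
  ultimately have "card {C 1, C \<epsilon>, C u} = 3" using self[of \<epsilon>] self[of u]
    by (subst card_3_iff) metis
  moreover have "{C 1, C \<epsilon>, C u} \<subseteq> carrier ((pos_unit_group :: 'k monoid) Mod unit_squares)"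
  proof -
    have "carrier ((pos_unit_group :: 'k monoid) Mod unit_squares) = C ` pos_units"
      by (auto simp: FactGroup_def RCOSETS_def r_coset_def pos_unit_group_def units_of_def C_def)
    moreover have "1 \<in> (pos_units :: 'k set)"
      using int_unit_1 totally_positive_of_nat[of 1] by (simp add: pos_units_def Units_ring_of_integers)
    ultimately show ?thesis using \<epsilon> u by blast
  qed
  moreover have "finite (carrier ((pos_unit_group :: 'k monoid) Mod unit_squares))"
    using ord by (intro card_ge_0_finite) (simp add: Coset.order_def)
  ultimately have "3 \<le> card (carrier ((pos_unit_group :: 'k monoid) Mod unit_squares))"
    using card_mono by metis
  then show False using ord by (simp add: Coset.order_def)
qed

lemma int_unit_indecomposable:
  assumes "int_unit (u :: 'k)" "totally_positive u"
  shows "indecomposable u"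
proof (rule small_norm_indecomposable)
  show "u \<in> pos_integers" using assms by (simp add: pos_integers_alt int_unit_def)
  have "\<bar>field_norm u\<bar> = 1" using assms(1) int_unit_iff_norm[of u] by (auto simp: int_unit_def)
  then have "field_norm u \<le> 1" by linarith
  also have "(1 :: real) < 2 ^ card E" using card_E_pos by simp
  finally show "field_norm u < 2 ^ card E" .
qed

lemma int_unit_of_square:
  assumes "int_unit (x\<^sup>2 :: 'k)"
  shows "int_unit x"
proof -
  have "algebraic_int x" using assms by (simp add: int_unit_def algebraic_int_square_root)
  moreover from this have "algebraic_int (x * inverse (x\<^sup>2))" using assms by (intro algebraic_int_times) (simp_all add: int_unit_def)
  moreover have "x * (x * inverse (x\<^sup>2)) = 1" using assms by (simp add: int_unit_def field_simps power2_eq_square)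
  ultimately show ?thesis by (rule int_unitI)
qed

text \<open>A totally positive unit is indecomposable, which forces the projection of a vector of norm
  \<open>\<epsilon>\<close> to a vector of norm 1 to vanish.\<close>

lemma unit_vectors_orthogonal:
  fixes L :: "('k, 'v) quad_module"
  assumes "quadratic_lattice L"
    and \<epsilon>: "int_unit \<epsilon>" "totally_positive \<epsilon>" "\<And>t. int_unit t \<Longrightarrow> \<epsilon> \<noteq> t\<^sup>2"
    and v: "v \<in> carrier L" "qform L v = 1" and w: "w \<in> carrier L" "qform L w = \<epsilon>"
  shows "bform L v w = 0"
proof (rule ccontr)
  interpret quadratic_lattice L by fact
  define x where "x = bform L v w"
  assume "bform L v w \<noteq> 0"
  then have x0: "x \<noteq> 0" by (simp add: x_def)
  have x: "algebraic_int x" unfolding x_def using v w by (intro form_int)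
  define w' where "w' = w \<oplus>\<^bsub>L\<^esub> (- x) \<odot>\<^bsub>L\<^esub> v"
  have w': "w' \<in> carrier L" using v w x by (simp add: w'_def smult_mem)
  have B: "bform L w w = \<epsilon>" "bform L v v = 1" "bform L w v = x" "bform L v w = x"
    using v w form_self form_commute by (simp_all add: x_def)
  have "bform L w' y = bform L w y - x * bform L v y" if "y \<in> carrier L" for y
    using that v w x by (simp add: w'_def form_add form_smult smult_mem)
  then have "qform L w' = bform L w' w - x * bform L w' v"
    using form_self[OF w'] form_commute[OF w'] v(1) w(1) w' by simp
  also have "\<dots> = \<epsilon> - x\<^sup>2"
    using v w x B by (simp add: w'_def form_add form_smult smult_mem power2_eq_square algebra_simps)
  finally have q: "\<epsilon> = x\<^sup>2 + qform L w'" by simp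
  have "w' \<noteq> \<zero>\<^bsub>L\<^esub>"
  proof
    assume "w' = \<zero>\<^bsub>L\<^esub>"
    then have "\<epsilon> = x\<^sup>2" using q form_self[OF w'] form_zero[OF w'] by simp
    moreover from this have "int_unit x" using \<epsilon>(1) int_unit_of_square by blast
    ultimately show False using \<epsilon>(3) by blast
  qed
  then have "qform L w' \<in> pos_integers" using positive_definite[OF w'] by blast
  moreover have "x\<^sup>2 \<in> pos_integers" using x x0 by (simp add: pos_integers_alt totally_positive_square algebraic_int_power)
  ultimately show False using int_unit_indecomposable[OF \<epsilon>(1,2)] q unfolding indecomposable_def by blast
qed

end

text \<open>For the quaternary form: \<gamma> will be the value of the generator of the complement.
  If \<open>z\<close> were nonzero, \<open>(\<epsilon> - z\<^sup>2) * \<gamma>\<close> would have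
  nonnegative conjugates, so \<open>z\<^sup>2\<close> would split off the indecomposable \<epsilon>.
  With \<open>z = 0\<close>, division by \<epsilon> exchanges the two terms of the form.\<close>

lemma (in universal_unary_sum) binary_representation:
  assumes "\<gamma> \<in> pos_integers" "algebraic_int x" "algebraic_int y" "algebraic_int z"
    and eq: "\<epsilon> * \<gamma> = x\<^sup>2 + \<epsilon> * y\<^sup>2 + \<gamma> * z\<^sup>2"
  shows "\<exists>a b. algebraic_int a \<and> algebraic_int b \<and> \<gamma> = a\<^sup>2 + \<epsilon> * b\<^sup>2"
proof -
  have "z = 0"
  proof (rule ccontr)
    assume z: "z \<noteq> 0"
    have "totally_positive (\<epsilon> - z\<^sup>2)"
      unfolding totally_positive_alt
    proof
      fix \<sigma> assume \<sigma>: "\<sigma> \<in> E"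
      note emb = emb_simps[OF E_embedding[OF \<sigma>]]
      have "(\<epsilon> - z\<^sup>2) * \<gamma> = x\<^sup>2 + \<epsilon> * y\<^sup>2" using eq by (simp add: algebra_simps)
      then have "\<sigma> ((\<epsilon> - z\<^sup>2) * \<gamma>) = \<sigma> (x\<^sup>2 + \<epsilon> * y\<^sup>2)" by simp
      then have "\<sigma> (\<epsilon> - z\<^sup>2) * \<sigma> \<gamma> = (\<sigma> x)\<^sup>2 + \<sigma> \<epsilon> * (\<sigma> y)\<^sup>2" by (simp only: emb)
      also have "\<dots> \<ge> 0" using pos_eps \<sigma> by (simp add: totally_positive_alt less_imp_le)
      finally have "\<sigma> (\<epsilon> - z\<^sup>2) * \<sigma> \<gamma> \<ge> 0" .
      moreover have "\<sigma> \<gamma> > 0" using assms(1) \<sigma> by (auto simp: pos_integers_alt totally_positive_alt)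
      moreover have "\<sigma> (\<epsilon> - z\<^sup>2) \<noteq> 0" using E_eq_0_iff[OF \<sigma>] eps_not_square[of z] by simp
      ultimately show "\<sigma> (\<epsilon> - z\<^sup>2) > 0" by (simp add: zero_le_mult_iff)
    qed
    then have "\<epsilon> - z\<^sup>2 \<in> pos_integers"
      using eps_int assms(4) by (simp add: pos_integers_alt algebraic_int_diff algebraic_int_power)
    moreover have "z\<^sup>2 \<in> pos_integers"
      using assms(4) z by (simp add: pos_integers_alt algebraic_int_power totally_positive_square)
    moreover have "\<epsilon> = z\<^sup>2 + (\<epsilon> - z\<^sup>2)" by simp
    ultimately show False using int_unit_indecomposable[OF unit_eps pos_eps] unfolding indecomposable_def by blast
  qed
  then have "\<epsilon> * \<gamma> = \<epsilon> * (y\<^sup>2 + \<epsilon> * (x / \<epsilon>)\<^sup>2)" using eq eps_nonzero by (simp add: field_simps power2_eq_square)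
  then have "\<gamma> = y\<^sup>2 + \<epsilon> * (x / \<epsilon>)\<^sup>2" using eps_nonzero by simp
  then show ?thesis using assms(2,3) divide_eps_int by blast
qed

theorem theorem3p1:
  fixes \<epsilon> :: "'k::field_char_0"
    and L :: "('k, 'v) quad_module"
  assumes "number_field TYPE('k)"
    and "totally_real TYPE('k)"
    and "Coset.order ((pos_unit_group :: 'k monoid) Mod unit_squares) = 2"
    and "\<epsilon> \<in> pos_units - unit_squares"
    and "quadratic_lattice L"
    and "has_rank L 3"
    and "universal L"
  shows "(\<exists>L\<^sub>u :: ('k, 'v) quad_module. quadratic_lattice L\<^sub>u \<and> has_rank L\<^sub>u 1 \<and>
            isometric L (orth_sum (diag_lattice [1, \<epsilon>]) L\<^sub>u)) \<and>
         (free_lattice L \<longrightarrow> universal (diag_lattice [1, 1, \<epsilon>, \<epsilon>])) \<and>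
         (\<forall>\<mu>::'k. indecomposable \<mu> \<longrightarrow> integer_square \<mu> \<or> integer_square (\<epsilon> * \<mu>)) \<and>
         (\<forall>\<mu>::'k. indecomposable \<mu> \<longrightarrow> integer_square \<mu> \<or> integer_square (2 * \<mu>)) \<and>
         integer_square (2 * \<epsilon>) \<and> ramified 2 TYPE('k) \<and>
         \<not> (\<exists>x::'k. x\<^sup>2 = 2) \<and>
         (\<forall>\<alpha>::'k. \<alpha> \<in> pos_integers \<longrightarrow> sum_of_integer_squares (2 * \<alpha>)) \<and>
         (\<forall>\<alpha>::'k. \<alpha> \<in> pos_integers \<and> field_norm \<alpha> < 2 ^ field_degree TYPE('k) \<longrightarrow>
            (\<exists>m::nat. field_norm \<alpha> = 2 ^ m))"
proof -
  interpret totally_real_field "TYPE('k)" using assms(1,2) by unfold_locales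
  interpret quadratic_lattice L by fact
  have \<epsilon>: "int_unit \<epsilon>" "totally_positive \<epsilon>" "\<And>t. int_unit t \<Longrightarrow> \<epsilon> \<noteq> t\<^sup>2"
    using assms(4) by (auto simp: pos_units_def unit_squares_def Units_ring_of_integers)
  have "1 \<in> (pos_integers :: 'k set)" "\<epsilon> \<in> pos_integers"
    using \<epsilon> totally_positive_of_nat[of 1] by (auto simp: pos_integers_alt int_unit_def)
  then obtain e1 e2 where e: "e1 \<in> carrier L" "qform L e1 = 1" "e2 \<in> carrier L" "qform L e2 = \<epsilon>"
    using assms(7) unfolding universal_def by metis
  interpret split_lattice L \<epsilon> e1 e2
    using e unit_vectors_orthogonal[OF assms(5) \<epsilon> e] \<epsilon>(1) assms(6)
    by unfold_locales (auto simp: int_unit_def pos_integers_alt dest: totally_positive_nonzero)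
  have rep: "\<exists>x y u. algebraic_int x \<and> algebraic_int y \<and> u \<in> U \<and> \<alpha> = x\<^sup>2 + \<epsilon> * y\<^sup>2 + qform L u"
    if \<alpha>: "\<alpha> \<in> pos_integers" for \<alpha>
  proof -
    obtain v where v: "v \<in> carrier L" "qform L v = \<alpha>" using assms(7) \<alpha> unfolding universal_def by blast
    have "\<alpha> = (X v)\<^sup>2 + \<epsilon> * (Y v)\<^sup>2 + qform L (P v)"
      using qform_split[OF X_int[OF v(1)] Y_int[OF v(1)] P_U[OF v(1)]] decompose[OF v(1)] v(2) by simp
    then show ?thesis using X_int[OF v(1)] Y_int[OF v(1)] P_U[OF v(1)] by blast
  qed
  have qform_zero: "qform L \<zero>\<^bsub>L\<^esub> = 0" using form_self[of "\<zero>\<^bsub>L\<^esub>"] form_zero[of "\<zero>\<^bsub>L\<^esub>"] by simp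
  interpret universal_unary_sum "TYPE('k)" \<epsilon> "qform L ` U"
  proof unfold_locales
    show "\<exists>t. int_unit t \<and> (u = t\<^sup>2 \<or> u = \<epsilon> * t\<^sup>2)" if "int_unit u" "totally_positive u" for u
      using unit_classes_of_order_2[OF assms(3,4)] that by (simp add: pos_units_def Units_ring_of_integers)
    show "q = 0 \<or> q \<in> pos_integers" if "q \<in> qform L ` U" for q
      using that positive_definite U_carrier qform_zero by auto
    show "\<exists>b. q * q' = b\<^sup>2" if "q \<in> qform L ` U" "q' \<in> qform L ` U" for q q'
      using that U_square by auto
    show "\<exists>x y q. algebraic_int x \<and> algebraic_int y \<and> q \<in> qform L ` U \<and> \<alpha> = x\<^sup>2 + \<epsilon> * y\<^sup>2 + q"
      if "\<alpha> \<in> pos_integers" for \<alpha>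
      using rep[OF that] by blast
  qed (use \<epsilon> in auto)
  have b: "universal (diag_lattice [1, 1, \<epsilon>, \<epsilon>])" if free: "free_lattice L"
  proof -
    obtain u0 where u0: "u0 \<in> U" "\<And>v. v \<in> U \<Longrightarrow> \<exists>z. algebraic_int z \<and> v = z \<odot>\<^bsub>L\<^esub> u0"
      by (rule free_U_principal[OF free]) (rule that, assumption, simp)
    define \<gamma> where "\<gamma> = qform L u0"
    have rep': "\<exists>x y z. algebraic_int x \<and> algebraic_int y \<and> algebraic_int z \<and> \<alpha> = x\<^sup>2 + \<epsilon> * y\<^sup>2 + \<gamma> * z\<^sup>2"
      if \<alpha>: "\<alpha> \<in> pos_integers" for \<alpha>
    proof -
      obtain x y u where xyu: "algebraic_int x" "algebraic_int y" "u \<in> U" "\<alpha> = x\<^sup>2 + \<epsilon> * y\<^sup>2 + qform L u"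
        using rep[OF \<alpha>] by blast
      obtain z where "algebraic_int z" "u = z \<odot>\<^bsub>L\<^esub> u0" using u0(2)[OF xyu(3)] by blast
      moreover from this have "qform L u = \<gamma> * z\<^sup>2"
        using qform_smult[of z u0] U_carrier[OF u0(1)] by (simp add: \<gamma>_def mult.commute)
      ultimately show ?thesis using xyu by auto
    qed
    have "\<exists>a b. algebraic_int a \<and> algebraic_int b \<and> \<gamma> = a\<^sup>2 + \<epsilon> * b\<^sup>2"
    proof (cases "u0 = \<zero>\<^bsub>L\<^esub>")
      case True
      then show ?thesis by (intro exI[of _ 0]) (simp add: \<gamma>_def qform_zero)
    next
      case False
      then have \<gamma>: "\<gamma> \<in> pos_integers" using positive_definite U_carrier u0(1) by (simp add: \<gamma>_def)
      then show ?thesis using rep'[OF pos_integers_mult_eps[OF \<gamma>]] binary_representation[OF \<gamma>] by blast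
    qed
    then obtain a b where ab: "algebraic_int a" "algebraic_int b" "\<gamma> = a\<^sup>2 + \<epsilon> * b\<^sup>2" by blast
    show ?thesis unfolding universal_def
    proof
      fix \<alpha> :: 'k assume "\<alpha> \<in> pos_integers"
      then obtain x y z where xyz: "algebraic_int x" "algebraic_int y" "algebraic_int z"
        "\<alpha> = x\<^sup>2 + \<epsilon> * y\<^sup>2 + \<gamma> * z\<^sup>2" using rep' by blast
      show "\<exists>v\<in>carrier (diag_lattice [1, 1, \<epsilon>, \<epsilon>]). qform (diag_lattice [1, 1, \<epsilon>, \<epsilon>]) v = \<alpha>"
      \<comment> \<open>Substituting \<open>\<gamma> = a\<^sup>2 + \<epsilon> * b\<^sup>2\<close>
        into the ternary representation turns its last term into one square and \<epsilon> times
        another.\<close>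
      proof (rule bexI[of _ "[x, a * z, y, b * z]"])
        show "qform (diag_lattice [1, 1, \<epsilon>, \<epsilon>]) [x, a * z, y, b * z] = \<alpha>"
          by (simp add: diag_lattice_def xyz(4) ab(3) eval_nat_numeral algebra_simps)
      qed (use xyz ab in \<open>simp add: diag_lattice_def algebraic_int_times\<close>)
    qed
  qed
  show ?thesis
  proof (intro conjI allI impI)
    show "\<exists>L\<^sub>u :: ('k, 'v) quad_module. quadratic_lattice L\<^sub>u \<and> has_rank L\<^sub>u 1 \<and>
        isometric L (orth_sum (diag_lattice [1, \<epsilon>]) L\<^sub>u)"
      using quadratic_lattice_L_u has_rank_L_u isometric_split by blast
    show "integer_square \<mu> \<or> integer_square (\<epsilon> * \<mu>)" if "indecomposable \<mu>" for \<mu> :: 'k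
      using indecomposable_square[OF that] .
    show "integer_square \<mu> \<or> integer_square (2 * \<mu>)" if "indecomposable \<mu>" for \<mu> :: 'k
      using indecomposable_square_or_twice[OF that] .
    show "integer_square (2 * \<epsilon>)" using two_eps_square by (simp add: integer_square_alt)
    show "ramified 2 TYPE('k)" using two_eps_square ramified_2[OF unit_eps] by blast
    show "\<not> (\<exists>x::'k. x\<^sup>2 = 2)" using no_sqrt2 by blast
    show "sum_of_integer_squares (2 * \<alpha>)" if "\<alpha> \<in> pos_integers" for \<alpha> :: 'k
      using twice_sum_of_squares[OF that] .
    show "\<exists>m::nat. field_norm \<alpha> = 2 ^ m"
      if "\<alpha> \<in> pos_integers \<and> field_norm \<alpha> < 2 ^ field_degree TYPE('k)" for \<alpha> :: 'k
      using small_norm_power_of_two that by (simp add: card_E)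
  qed (rule b)
qed

end
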